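(* Let $F \in C^3_{\mathrm{per}}(\mathbb{R}^d)$ satisfy $F(0)=0$, $\operatorname{argmin}_{x\in\mathbb{T}^d}F(x)=\{0\}$, and $D^2F(0)$ strictly positive definite. Then there exist $\lambda>0$, $\nu_0>0$ and $C>0$, depending only on $F$, such that for all $\nu\in(0,\nu_0)$ and all initial conditions $\varphi_0\in C_{\mathrm{per}}(\mathbb{R}^d)$, the solution $\varphi^\nu_{-n}(x,t)$ of the kicked viscous Hamilton-Jacobi equation with kick potential $F$ and initial condition $\varphi_0$ at time $-n$ satisfies $$\|\varphi^\nu_{-n}(\cdot,0)-\psi^\nu(\cdot)\|_* \le B e^{-\lambda n},\qquad n\ge 0,$$ where $\psi^\nu$ is the stationary solution and the constant $B>0$ depends only on $\|\varphi_0\|_*$ and $C$.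
   Context: $C_{\mathrm{per}}(\mathbb{R}^d)$ and $C^s_{\mathrm{per}}(\mathbb{R}^d)$ denote the $\mathbb{Z}^d$-periodic continuous, respectively $C^s$, functions on $\mathbb{R}^d$; $\mathbb{T}^d=\mathbb{R}^d/\mathbb{Z}^d$. $\|f\|_*=\inf_{c\in\mathbb{R}}\sup_x|f(x)+c|$. The equation is $\varphi_t+\frac12|\nabla\varphi|^2=\nu\Delta\varphi+F(x,t)$ with kicked forcing $F(x,t)=\sum_{j\in\mathbb{Z}}F(x)\,\delta(t-j)$, on the time interval $[-n,0]$ ($n$ a non-negative integer) with $\varphi(\cdot,-n)=\varphi_0$. The solution is understood through the Hopf-Cole transformation $u=e^{-\varphi/(2\nu)}$: over each unit time interval one first multiplies $u$ by $e^{-F/(2\nu)}$ (the kick) and then solves the heat equation $u_t=\nu\Delta u$ for unit time. Thus $\varphi^\nu_{-n}(\cdot,0)=-2\nu\log \mathcal{L}_\nu^n(e^{-\varphi_0/(2\nu)})$, where $$\mathcal{L}_\nu(u)(x)=\frac1{(4\pi\nu)^{d/2}}\int_{\mathbb{R}^d}\exp\Big(-\frac1{2\nu}\big(\tfrac12|y-x|^2+F(y)\big)\Big)u(y)\,dy .$$ The stationary solution $\psi^\nu\in C_{\mathrm{per}}(\mathbb{R}^d)$ is the function, unique up to an additive constant, such that $-2\nu\log\mathcal{L}_\nu(e^{-\psi^\nu/(2\nu)})-\psi^\nu$ is constant. *)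

theory Defs
  imports "HOL-Analysis.Analysis"
begin

definition integer_lattice :: "(real ^ 'd) set" where
  "integer_lattice = {k. \<forall>i. k $ i \<in> \<int>}"

definition periodic :: "(real ^ 'd \<Rightarrow> real) \<Rightarrow> bool" where
  "periodic f \<longleftrightarrow> (\<forall>x. \<forall>k\<in>integer_lattice. f (x + k) = f x)"

definition partial_deriv :: "'d \<Rightarrow> (real ^ 'd \<Rightarrow> real) \<Rightarrow> real ^ 'd \<Rightarrow> real" where
  "partial_deriv i f x = frechet_derivative f (at x) (axis i 1)"

fun C_k :: "nat \<Rightarrow> (real ^ 'd \<Rightarrow> real) \<Rightarrow> bool" where
  "C_k 0 f \<longleftrightarrow> continuous_on UNIV f"
| "C_k (Suc k) f \<longleftrightarrow> (\<forall>x. f differentiable (at x)) \<and> (\<forall>i. C_k k (partial_deriv i f))"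

definition C_per :: "nat \<Rightarrow> (real ^ 'd \<Rightarrow> real) set" where
  "C_per s = {f. C_k s f \<and> periodic f}"

definition hessian :: "(real ^ 'd \<Rightarrow> real) \<Rightarrow> real ^ 'd \<Rightarrow> real ^ 'd ^ 'd" where
  "hessian f x = (\<chi> i j. partial_deriv i (partial_deriv j f) x)"

(* Symmetry is not required here; it is automatic for the Hessian of a C^2 function. *)
definition positive_definite :: "real ^ 'd ^ 'd \<Rightarrow> bool" where
  "positive_definite A \<longleftrightarrow> (\<forall>v. v \<noteq> 0 \<longrightarrow> 0 < v \<bullet> (A *v v))"

(* Only meaningful for bounded f, in particular for f in C_per 0: the supremum and
   infimum are taken in the reals. *)
definition star_norm :: "(real ^ 'd \<Rightarrow> real) \<Rightarrow> real" where
  "star_norm f = (INF c. SUP x. \<bar>f x + c\<bar>)"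

(* One period of the kicked equation after the Hopf-Cole substitution
   u = exp (- phi / (2 * nu)): multiplication by exp (- F / (2 * nu)), followed by
   the heat semigroup of u_t = nu * Laplacian u at time 1. *)
definition kick_heat_op ::
    "real \<Rightarrow> (real ^ 'd \<Rightarrow> real) \<Rightarrow> (real ^ 'd \<Rightarrow> real) \<Rightarrow> real ^ 'd \<Rightarrow> real" where
  "kick_heat_op \<nu> F u x =
     1 / (4 * pi * \<nu>) powr (real CARD('d) / 2) *
     (LINT y|lborel. exp (- (1 / (2 * \<nu>)) * ((norm (y - x))\<^sup>2 / 2 + F y)) * u y)"

(* The value at time 0 of the solution started from phi0 at time -n; the n kicks act
   at the times -n, ..., -1. *)
definition kicked_solution ::
    "real \<Rightarrow> (real ^ 'd \<Rightarrow> real) \<Rightarrow> (real ^ 'd \<Rightarrow> real) \<Rightarrow> nat \<Rightarrow> real ^ 'd \<Rightarrow> real" where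
  "kicked_solution \<nu> F \<phi>0 n x =
     - 2 * \<nu> * ln ((kick_heat_op \<nu> F ^^ n) (\<lambda>y. exp (- \<phi>0 y / (2 * \<nu>))) x)"

definition stationary_solution ::
    "real \<Rightarrow> (real ^ 'd \<Rightarrow> real) \<Rightarrow> (real ^ 'd \<Rightarrow> real) \<Rightarrow> bool" where
  "stationary_solution \<nu> F \<psi> \<longleftrightarrow> \<psi> \<in> C_per 0 \<and>
     (\<exists>c. \<forall>x. - 2 * \<nu> * ln (kick_heat_op \<nu> F (\<lambda>y. exp (- \<psi> y / (2 * \<nu>))) x) - \<psi> x = c)"

end

theory Submission
  imports Defs "HOL-Probability.Distributions"
begin

text \<open>
  Write \<open>L\<close> for one kick followed by unit time of the heat flow, and \<open>w\<close> for its positive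
  eigenfunction, so that \<open>\<psi> = -2 \<nu> ln w\<close>. The proof has two halves.

  For times up to a multiple of \<open>ln (1 / \<nu>)\<close> one bounds the cross ratio
  \<open>L\<^sup>n u x * L\<^sup>n v y / (L\<^sup>n v x * L\<^sup>n u y)\<close>. It compares the weight of pairs of paths, one from \<open>x\<close>
  and one from \<open>y\<close>, before and after their tails are exchanged. While both paths stay in the well
  around a lattice point, the exchange can be made gradually: multiply half the difference of the
  two paths by \<open>tanh\<close> of an arithmetic progression running from negative to positive values. By
  strong convexity of \<open>F\<close> in the well this does not increase the action, its Jacobian is bounded
  below, and the factors at both ends are exponentially close to \<open>1\<close> in absolute value. Pairs
  without a long common stay in the wells make several excursions and are negligible. So the
  oscillation of \<open>\<phi> - \<psi>\<close> is at most \<open>B exp (- \<lambda> n) + K \<nu>\<close>.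

  For later times one uses a spectral gap uniform in \<open>\<nu>\<close>. The operator \<open>L\<close> is self-adjoint in
  \<open>L\<^sup>2\<close> of the torus with density \<open>exp (- F / (2 \<nu>))\<close>. Its kernel dominates a constant \<open>\<beta>\<close> on the
  ball of radius \<open>R sqrt \<nu>\<close>, and \<open>L\<close> is small outside it; subtracting \<open>\<beta>\<close> there keeps the kernel
  nonnegative but lowers the norm by a fixed factor, and this rank one change does not affect
  functions of mean zero on the ball. The cross ratio bound then turns the \<open>L\<^sup>2\<close> decay into
  uniform decay without loss in \<open>\<nu>\<close>.
\<close>

subsection \<open>Gaussian kernels\<close>

text \<open>The obstacle is uniformity in \<nu>. The one-step contraction of positive operators has
  factor \<open>1 - osc_ratio\<^sup>2\<close>, exponentially close to 1 for small \<nu>, so it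
  serves only to produce the eigenfunction. The exchange of tails has constants free of \<nu>, but
  its Jacobian leaves a factor \<open>Kc\<close> in the cross ratio at all times; after
  multiplication by \<open>2 * \<nu>\<close> this is the floor of order \<nu> that the spectral gap
  has to remove. The two halves meet at time \<open>2 * n1\<close>, with \<open>n1\<close> close to
  \<open>ln (1 / \<nu>) / lam\<close>. There \<nu> is at most a constant times
  \<open>exp (- lam * n1)\<close>, which is why the final rate is capped by \<open>lam / 2\<close>.
  A bounded number \<open>m\<close> of excursions suffices: after one kick the oscillation of
  \<open>-2 * \<nu> * ln u\<close> is at most the squared dimension, so all a priori losses are of
  size \<open>exp (const / \<nu>)\<close>, and each excursion gains a factor
  \<open>exp (- const / \<nu>)\<close>. Losses of a fixed factor per kick are only polynomial in
  \<open>1 / \<nu>\<close> over times of order \<open>ln (1 / \<nu>)\<close>.\<close>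

lemma nn_integral_lborel_affine:
  fixes f :: "'a::euclidean_space \<Rightarrow> ennreal"
  assumes [measurable]: "f \<in> borel_measurable borel" and c: "c \<noteq> 0"
  shows "(\<integral>\<^sup>+x. f x \<partial>lborel) = ennreal (\<bar>c\<bar> ^ DIM('a)) * (\<integral>\<^sup>+x. f (t + c *\<^sub>R x) \<partial>lborel)"
  by (subst lborel_affine[OF c, of t])
    (simp add: nn_integral_density nn_integral_distr nn_integral_cmult ennreal_power)

lemma nn_integral_lborel_shift:
  fixes f :: "'a::euclidean_space \<Rightarrow> ennreal"
  assumes "f \<in> borel_measurable borel"
  shows "(\<integral>\<^sup>+x. f (x + t) \<partial>lborel) = (\<integral>\<^sup>+x. f x \<partial>lborel)"
  using nn_integral_lborel_affine[OF assms, of 1 t] by (simp add: add.commute)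

lemma lborel_distr_shift: "distr lborel borel (\<lambda>x. x + t) = (lborel :: 'a::euclidean_space measure)"
  using lborel_affine[of 1 t] by (simp add: add.commute density_1)

lemma integral_lborel_shift:
  fixes f :: "'a::euclidean_space \<Rightarrow> real"
  assumes [measurable]: "f \<in> borel_measurable borel"
  shows "(\<integral>x. f (x + t) \<partial>lborel) = (\<integral>x. f x \<partial>lborel)"
proof -
  have "(\<integral>x. f x \<partial>lborel) = (\<integral>x. f x \<partial>distr lborel borel (\<lambda>x. x + t))"
    by (simp add: lborel_distr_shift)
  also have "\<dots> = (\<integral>x. f (x + t) \<partial>lborel)"
    by (subst integral_distr) auto
  finally show ?thesis by simp
qed

text \<open>Heat kernel at time \<open>s\<close> for diffusion constant 1; with
  \<open>s = \<nu>\<close> it is the unit-time kernel of the kicked equation. Keeping the time as a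
  parameter allows a Gaussian factor to be traded for a kernel at time \<open>2 * s\<close>.\<close>

definition gauss :: "real \<Rightarrow> real ^ 'd \<Rightarrow> real" where
  "gauss s z = exp (- (norm z)\<^sup>2 / (4 * s)) / (4 * pi * s) powr (real CARD('d) / 2)"

lemma gauss_pos: "s > 0 \<Longrightarrow> 0 < gauss s z"
  by (simp add: gauss_def)

lemma gauss_measurable [measurable]: "gauss s \<in> borel_measurable borel"
  unfolding gauss_def by measurable

lemma gauss_minus: "gauss s (x - y) = gauss s (y - x)"
  by (simp add: gauss_def norm_minus_commute)

lemma nn_integral_gauss:
  fixes x :: "real ^ 'd"
  assumes s: "s > 0"
  shows "(\<integral>\<^sup>+z. gauss s (z :: real ^ 'd) \<partial>lborel) = 1"
proof -
  define \<sigma> where "\<sigma> = sqrt (2 * s)"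
  have \<sigma>: "\<sigma> > 0" "\<sigma>\<^sup>2 = 2 * s" using s by (auto simp: \<sigma>_def)
  have one: "normal_density 0 \<sigma> t = exp (- t\<^sup>2 / (4 * s)) / sqrt (4 * pi * s)" for t
    unfolding normal_density_def \<sigma>(2) by (simp add: mult_ac)
  have "gauss s z = (\<Prod>b\<in>Basis. normal_density 0 \<sigma> (z \<bullet> b))" for z :: "real ^ 'd"
  proof -
    have "(\<Prod>b\<in>Basis. normal_density 0 \<sigma> (z \<bullet> b)) =
      exp (\<Sum>b\<in>Basis. - (z \<bullet> b)\<^sup>2 / (4 * s)) / sqrt (4 * pi * s) ^ DIM(real ^ 'd)"
      by (simp add: one prod_dividef exp_sum)
    also have "(\<Sum>b\<in>Basis. - (z \<bullet> b)\<^sup>2 / (4 * s)) = - (norm z)\<^sup>2 / (4 * s)"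
      by (simp add: norm_eq_sqrt_inner euclidean_inner[of z z] power2_eq_square sum_negf
          sum_divide_distrib sum_nonneg)
    also have "sqrt (4 * pi * s) ^ DIM(real ^ 'd) = (4 * pi * s) powr (real CARD('d) / 2)"
      using s by (simp add: powr_half_sqrt[symmetric] powr_powr powr_realpow[symmetric])
    finally show ?thesis by (simp add: gauss_def)
  qed
  then have "(\<integral>\<^sup>+z. gauss s (z :: real ^ 'd) \<partial>lborel) =
      (\<integral>\<^sup>+z. (\<Prod>b\<in>Basis. ennreal (normal_density 0 \<sigma> ((z :: real ^ 'd) \<bullet> b))) \<partial>lborel)"
    by (simp add: prod_ennreal)
  also have "\<dots> = (\<Prod>b\<in>(Basis :: (real ^ 'd) set). \<integral>\<^sup>+t. ennreal (normal_density 0 \<sigma> t) \<partial>lborel)"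
    by (rule nn_integral_lborel_prod) auto
  also have "(\<integral>\<^sup>+t. ennreal (normal_density 0 \<sigma> t) \<partial>lborel) = 1"
    using \<sigma> by (subst nn_integral_eq_integral) auto
  finally show ?thesis by simp
qed

lemma integrable_gauss [simp]: "s > 0 \<Longrightarrow> integrable lborel (gauss s :: real ^ 'd \<Rightarrow> real)"
  by (rule integrableI_nn_integral_finite[where x=1])
    (auto simp: nn_integral_gauss intro: less_imp_le gauss_pos)

lemma integral_gauss: "s > 0 \<Longrightarrow> (\<integral>z. gauss s (z :: real ^ 'd) \<partial>lborel) = 1"
  by (rule integral_eq_nn_integral[THEN trans])
    (auto simp: nn_integral_gauss intro: less_imp_le gauss_pos)

lemma integrable_gauss_shift [simp]:
  "s > 0 \<Longrightarrow> integrable lborel (\<lambda>y. gauss s (y - x :: real ^ 'd))"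
  using integrable_distr_eq[of "\<lambda>y. y - x" lborel borel "gauss s :: real ^ 'd \<Rightarrow> real"]
    lborel_distr_shift[of "- x"] by simp

lemma integral_gauss_shift:
  "s > 0 \<Longrightarrow> (\<integral>y. gauss s (y - x :: real ^ 'd) \<partial>lborel) = 1"
  using integral_lborel_shift[of "gauss s :: real ^ 'd \<Rightarrow> real" "- x"] by (simp add: integral_gauss)

text \<open>Half of the Gaussian exponent is split off as an explicit factor, to be estimated when
  \<open>z\<close> is large, while the other half remains a kernel of total mass 1. The change of
  normalisation is the factor later called \<open>gauss_ratio\<close>.\<close>

lemma gauss_double:
  assumes s: "s > 0"
  shows "gauss s (z :: real ^ 'd) =
    2 powr (real CARD('d) / 2) * exp (- (norm z)\<^sup>2 / (8 * s)) * gauss (2 * s) z"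
proof -
  have "exp (- (norm z)\<^sup>2 / (4 * s)) = exp (- (norm z)\<^sup>2 / (8 * s)) * exp (- (norm z)\<^sup>2 / (4 * (2 * s)))"
    by (subst exp_add[symmetric]) (use s in \<open>simp add: field_simps\<close>)
  moreover have "(4 * pi * (2 * s)) powr (real CARD('d) / 2)
      = 2 powr (real CARD('d) / 2) * (4 * pi * s) powr (real CARD('d) / 2)"
    using s by (subst powr_mult[symmetric]) (auto simp: mult_ac)
  ultimately show ?thesis using s by (simp add: gauss_def field_simps)
qed

lemma gauss_le_double:
  assumes s: "s > 0"
  shows "gauss s (z :: real ^ 'd) \<le> 2 powr (real CARD('d) / 2) * gauss (2 * s) z"
proof -
  have "exp (- (norm z)\<^sup>2 / (8 * s)) \<le> 1" using s by simp
  then have "2 powr (real CARD('d) / 2) * exp (- (norm z)\<^sup>2 / (8 * s)) * gauss (2 * s) z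
      \<le> 2 powr (real CARD('d) / 2) * 1 * gauss (2 * s) z"
    using gauss_pos[of "2 * s" z] s by (intro mult_right_mono mult_left_mono) auto
  then show ?thesis using gauss_double[OF s, of z] by simp
qed

subsection \<open>The lattice and periodic functions\<close>

lemma zero_in_lattice [simp]: "0 \<in> integer_lattice"
  by (simp add: integer_lattice_def)

lemma lattice_add: "k \<in> integer_lattice \<Longrightarrow> l \<in> integer_lattice \<Longrightarrow> k + l \<in> integer_lattice"
  by (simp add: integer_lattice_def)

lemma lattice_minus: "k \<in> integer_lattice \<Longrightarrow> - k \<in> integer_lattice"
  by (simp add: integer_lattice_def)

lemma lattice_diff: "k \<in> integer_lattice \<Longrightarrow> l \<in> integer_lattice \<Longrightarrow> k - l \<in> integer_lattice"
  by (simp add: integer_lattice_def)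

lemma axis_in_lattice: "axis i 1 \<in> integer_lattice"
  by (auto simp: integer_lattice_def axis_def)

lemma lattice_norm_ge1:
  assumes "k \<in> integer_lattice" "k \<noteq> 0" shows "norm k \<ge> 1"
proof -
  obtain i where i: "k $ i \<noteq> 0" using assms(2) by (auto simp: vec_eq_iff)
  then have "\<bar>k $ i\<bar> \<ge> 1" using assms(1) by (auto simp: integer_lattice_def intro: Ints_nonzero_abs_ge1)
  then show ?thesis using component_le_norm_cart[of k i] by linarith
qed

lemma countable_lattice: "countable (integer_lattice :: (real ^ 'd) set)"
proof -
  have "integer_lattice \<subseteq> (\<lambda>f. \<chi> i. f i) ` (PiE (UNIV :: 'd set) (\<lambda>_. \<int> :: real set))"
    by (auto simp: integer_lattice_def image_iff intro!: bexI[where x="\<lambda>i. _ $ i"])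
  moreover have "countable (\<int> :: real set)"
    unfolding Ints_def by auto
  ultimately show ?thesis
    by (metis countable_PiE countable_image countable_subset finite)
qed

definition nearest :: "real ^ 'd \<Rightarrow> real ^ 'd" where
  "nearest x = (\<chi> i. of_int \<lfloor>x $ i + 1/2\<rfloor>)"

text \<open>Half-open, so that its integer translates partition the space; integrals over the torus
  become integrals over this set.\<close>

definition cube :: "(real ^ 'd) set" where
  "cube = {x. \<forall>i. - 1/2 \<le> x $ i \<and> x $ i < 1/2}"

lemma nearest_in_lattice [simp]: "nearest x \<in> integer_lattice"
  by (simp add: integer_lattice_def nearest_def)

lemma cube_shift_iff: "k \<in> integer_lattice \<Longrightarrow> x - k \<in> cube \<longleftrightarrow> k = nearest x"
proof -
  assume k: "k \<in> integer_lattice"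
  have "- 1/2 \<le> x $ i - k $ i \<and> x $ i - k $ i < 1/2 \<longleftrightarrow> k $ i = of_int \<lfloor>x $ i + 1/2\<rfloor>" for i
  proof -
    obtain n where n: "k $ i = of_int n" using k by (auto simp: integer_lattice_def elim: Ints_cases)
    have "n = \<lfloor>x $ i + 1/2\<rfloor> \<longleftrightarrow> of_int n \<le> x $ i + 1/2 \<and> x $ i + 1/2 < of_int n + 1"
      by (metis floor_eq_iff)
    then show ?thesis unfolding n of_int_eq_iff by linarith
  qed
  then show ?thesis by (simp add: cube_def nearest_def vec_eq_iff)
qed

lemma diff_nearest_in_cube: "x - nearest x \<in> cube"
  by (simp add: cube_shift_iff)

lemma cube_measurable [measurable]: "cube \<in> sets borel"
  unfolding cube_def by measurable

lemma norm_cube_le: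
  assumes "x \<in> (cube :: (real ^ 'd) set)" shows "norm x \<le> real CARD('d) / 2"
proof -
  have "norm x \<le> (\<Sum>i\<in>UNIV. \<bar>x $ i\<bar>)" by (rule norm_le_l1_cart)
  also have "\<dots> \<le> (\<Sum>i\<in>(UNIV::'d set). 1/2)" 
  proof (intro sum_mono)
    fix i show "\<bar>x $ i\<bar> \<le> 1/2" using assms by (auto simp: cube_def abs_le_iff dest!: spec[of _ i])
  qed
  finally show ?thesis by simp
qed

text \<open>The common domain of all operators below. Measurability instead of continuity keeps it
  stable under operators whose kernels are cut off by indicators.\<close>

definition bmp :: "(real ^ 'd \<Rightarrow> real) \<Rightarrow> bool" where
  "bmp f \<longleftrightarrow> f \<in> borel_measurable borel \<and> periodic f \<and> (\<exists>C. \<forall>x. \<bar>f x\<bar> \<le> C)"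

lemma bmpD: "bmp f \<Longrightarrow> f \<in> borel_measurable borel" "bmp f \<Longrightarrow> k \<in> integer_lattice \<Longrightarrow> f (x + k) = f x"
  by (auto simp: bmp_def periodic_def)

lemma bmp_const [simp]: "bmp (\<lambda>_. c)" by (auto simp: bmp_def periodic_def)

lemma bmp_lin:
  assumes f: "bmp f" and g: "bmp g" shows "bmp (\<lambda>x. a * f x + b * g x)"
proof -
  obtain C1 C2 where "\<And>x. \<bar>f x\<bar> \<le> C1" "\<And>x. \<bar>g x\<bar> \<le> C2" using f g by (auto simp: bmp_def)
  then have "\<bar>a * f x + b * g x\<bar> \<le> \<bar>a\<bar> * C1 + \<bar>b\<bar> * C2" for x
    by (intro abs_triangle_ineq[THEN order_trans] add_mono) (auto simp: abs_mult intro: mult_left_mono)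
  then show ?thesis using f g by (auto simp: bmp_def periodic_def)
qed

lemma bmp_diff: "bmp f \<Longrightarrow> bmp g \<Longrightarrow> bmp (\<lambda>x. f x - g x)" using bmp_lin[of f g 1 "-1"] by simp
lemma bmp_scale: "bmp f \<Longrightarrow> bmp (\<lambda>x. c * f x)" using bmp_lin[of f f c 0] by simp
lemma bmp_abs: "bmp f \<Longrightarrow> bmp (\<lambda>x. \<bar>f x\<bar>)" by (auto simp: bmp_def periodic_def)

lemma bmp_mult:
  assumes f: "bmp f" and g: "bmp g" shows "bmp (\<lambda>x. f x * g x)"
proof -
  obtain C1 C2 where "\<And>x. \<bar>f x\<bar> \<le> C1" "\<And>x. \<bar>g x\<bar> \<le> C2" using f g by (auto simp: bmp_def)
  then have "\<bar>f x * g x\<bar> \<le> C1 * C2" for x by (simp add: abs_mult mult_mono')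
  then show ?thesis using f g by (auto simp: bmp_def periodic_def)
qed

lemma periodic_bounded:
  fixes f :: "real ^ 'd \<Rightarrow> real"
  assumes f: "continuous_on UNIV f" "periodic f"
  shows "\<exists>C. \<forall>x. \<bar>f x\<bar> \<le> C"
proof -
  have "compact (f ` cball 0 (real CARD('d)))"
    using f(1) by (intro compact_continuous_image) (auto intro: continuous_on_subset)
  then obtain C where C: "\<And>x. x \<in> cball 0 (real CARD('d)) \<Longrightarrow> \<bar>f x\<bar> \<le> C"
    by (fastforce dest: compact_imp_bounded simp: bounded_iff)
  have "\<bar>f x\<bar> \<le> C" for x
  proof -
    have "f x = f (x - nearest x)"
      using f(2) lattice_minus[OF nearest_in_lattice[of x]] by (simp add: periodic_def)
        (metis add_uminus_conv_diff)
    moreover have "norm (x - nearest x) \<le> real CARD('d)"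
      using norm_cube_le[OF diff_nearest_in_cube[of x]] by simp
    ultimately show ?thesis using C by simp
  qed
  then show ?thesis by blast
qed

lemma bmp_cont: "continuous_on UNIV f \<Longrightarrow> periodic f \<Longrightarrow> bmp f"
  using periodic_bounded by (auto simp: bmp_def intro: borel_measurable_continuous_onI)

subsection \<open>Positive linear operators and the kicked heat operator\<close>

text \<open>An abstract notion rather than a class of integral kernels: powers, and differences of
  powers that happen to be positive, are then treated on the same footing as the one-step
  operators.\<close>

definition plin :: "((real ^ 'd \<Rightarrow> real) \<Rightarrow> real ^ 'd \<Rightarrow> real) \<Rightarrow> bool" where
  "plin R \<longleftrightarrow> (\<forall>f. bmp f \<longrightarrow> bmp (R f)) \<and>
     (\<forall>f g a b. bmp f \<longrightarrow> bmp g \<longrightarrow> R (\<lambda>x. a * f x + b * g x) = (\<lambda>x. a * R f x + b * R g x)) \<and>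
     (\<forall>f. bmp f \<longrightarrow> (\<forall>x. 0 \<le> f x) \<longrightarrow> (\<forall>x. 0 \<le> R f x))"

lemma plin_bmp: "plin R \<Longrightarrow> bmp f \<Longrightarrow> bmp (R f)"
  and plin_lin: "plin R \<Longrightarrow> bmp f \<Longrightarrow> bmp g \<Longrightarrow> R (\<lambda>x. a * f x + b * g x) = (\<lambda>x. a * R f x + b * R g x)"
  and plin_pos: "plin R \<Longrightarrow> bmp f \<Longrightarrow> (\<And>x. 0 \<le> f x) \<Longrightarrow> 0 \<le> R f x"
  by (auto simp: plin_def)

lemma plin_scale: "plin R \<Longrightarrow> bmp f \<Longrightarrow> R (\<lambda>x. c * f x) = (\<lambda>x. c * R f x)"
  using plin_lin[of R f f c 0] by simp

lemma plin_diff: "plin R \<Longrightarrow> bmp f \<Longrightarrow> bmp g \<Longrightarrow> R (\<lambda>x. f x - g x) = (\<lambda>x. R f x - R g x)"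
  using plin_lin[of R f g 1 "-1"] by simp

lemma plin_mono:
  assumes "plin R" "bmp f" "bmp g" "\<And>x. f x \<le> g x" shows "R f x \<le> R g x"
  using plin_pos[OF assms(1) bmp_diff[OF assms(3,2)], of x] assms(4) plin_diff[OF assms(1,3,2)] by simp

lemma plin_funpow: "plin R \<Longrightarrow> plin (R ^^ n)"
proof (induction n)
  case 0 then show ?case by (simp add: plin_def)
next
  case (Suc n) then show ?case unfolding plin_def by simp
qed

lemma plin_abs:
  assumes R: "plin R" and f: "bmp f" shows "\<bar>R f x\<bar> \<le> R (\<lambda>x. \<bar>f x\<bar>) x"
proof -
  have "R f x \<le> R (\<lambda>x. \<bar>f x\<bar>) x" using f by (intro plin_mono[OF R]) (auto intro: bmp_abs)
  moreover have "R (\<lambda>x. - f x) x \<le> R (\<lambda>x. \<bar>f x\<bar>) x"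
    using f by (intro plin_mono[OF R]) (auto intro: bmp_abs bmp_scale[of f "-1", simplified])
  ultimately show ?thesis using plin_scale[OF R f, of "-1"] by (simp add: abs_le_iff)
qed

text \<open>A positive operator can be applied in one variable while the other is frozen. Thus a
  pointwise bound on products of values at two points is carried along by two independent paths, one
  starting at \<open>x\<close> and one at \<open>y\<close>.\<close>

lemma plin_tensor:
  assumes R: "plin R" and S: "plin S" and b: "bmp A" "bmp B" "bmp A'" "bmp B'" "bmp f"
    and le: "\<And>x y. A x * B y \<le> c * (A' x * B' y) + e * (f x * f y)"
  shows "R A x * S B y \<le> c * (R A' x * S B' y) + e * (R f x * S f y)"
proof -
  have "R A x * B y \<le> c * (R A' x * B' y) + e * (R f x * f y)" for y
  proof -
    have "R (\<lambda>x. B y * A x) x \<le> R (\<lambda>x. (c * B' y) * A' x + (e * f y) * f x) x"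
      using le by (intro plin_mono[OF R] bmp_scale bmp_lin b) (simp add: mult_ac)
    then show ?thesis
      unfolding plin_scale[OF R b(1)] plin_lin[OF R b(3,5)] by (simp add: mult_ac)
  qed
  then have "S (\<lambda>y. R A x * B y) y \<le> S (\<lambda>y. (c * R A' x) * B' y + (e * R f x) * f y) y"
    by (intro plin_mono[OF S] bmp_scale bmp_lin b) (simp add: mult_ac)
  then show ?thesis
    unfolding plin_scale[OF S b(2)] plin_lin[OF S b(4,5)] by (simp add: mult_ac)
qed

section \<open>Lattice-invariant weights on pairs of points\<close>

definition weight :: "(real ^ 'd \<Rightarrow> real ^ 'd \<Rightarrow> real) \<Rightarrow> bool" where
  "weight \<eta> \<longleftrightarrow> (\<lambda>(x, y). \<eta> x y) \<in> borel_measurable (borel \<Otimes>\<^sub>M borel) \<and>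
     (\<exists>C. \<forall>x y. \<eta> x y \<le> C) \<and> (\<forall>x y. 0 \<le> \<eta> x y) \<and>
     (\<forall>k\<in>integer_lattice. \<forall>x y. \<eta> (x + k) (y + k) = \<eta> x y)"

lemma weightD:
  "weight \<eta> \<Longrightarrow> (\<lambda>(x, y). \<eta> x y) \<in> borel_measurable (borel \<Otimes>\<^sub>M borel)"
  "weight \<eta> \<Longrightarrow> 0 \<le> \<eta> x y"
  "weight \<eta> \<Longrightarrow> k \<in> integer_lattice \<Longrightarrow> \<eta> (x + k) (y + k) = \<eta> x y"
  by (auto simp: weight_def)

lemma weight_const: "0 \<le> c \<Longrightarrow> weight (\<lambda>_ _. c)" by (auto simp: weight_def)

text \<open>The lattice point has to be common to both arguments, so a jump from one well to another
  counts as an excursion just like a visit outside the wells.\<close>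

definition same :: "real \<Rightarrow> real ^ 'd \<Rightarrow> real ^ 'd \<Rightarrow> real" where
  "same r x y = (if \<exists>k\<in>integer_lattice. x \<in> ball k r \<and> y \<in> ball k r then 1 else 0)"

lemma same_cases: "same r x y = 0 \<or> same r x y = 1" by (simp add: same_def)
lemma same_nonneg: "0 \<le> same r x y" by (simp add: same_def)
lemma same_le1: "same r x y \<le> 1" by (simp add: same_def)
lemma same_measurable [measurable]: "(\<lambda>(x, y). same r x y) \<in> borel_measurable (borel \<Otimes>\<^sub>M borel)"
proof -
  have "open (\<Union>k\<in>integer_lattice. ball k r \<times> ball k r :: ((real ^ 'd) \<times> (real ^ 'd)) set)"
    by (intro open_UN open_Times ballI) auto
  then have "(\<Union>k\<in>integer_lattice. ball k r \<times> ball k r) \<in>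
      sets (borel \<Otimes>\<^sub>M borel :: ((real ^ 'd) \<times> (real ^ 'd)) measure)"
    unfolding borel_prod by (rule borel_open)
  then have "indicator (\<Union>k\<in>integer_lattice. ball k r \<times> ball k r) \<in>
     borel_measurable (borel \<Otimes>\<^sub>M borel :: ((real ^ 'd) \<times> (real ^ 'd)) measure)"
    by (rule borel_measurable_indicator)
  also have "(indicator (\<Union>k\<in>integer_lattice. ball k r \<times> ball k r) :: _ \<Rightarrow> real) = (\<lambda>(x, y). same r x y)"
    by (auto simp: fun_eq_iff same_def indicator_def)
  finally show ?thesis .
qed

lemma same_shift:
  assumes k: "k \<in> integer_lattice" shows "same r (x + k) (y + k) = same r x y"
proof -
  have *: "(\<exists>l\<in>integer_lattice. x + k \<in> ball l r \<and> y + k \<in> ball l r)"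
    if "l \<in> integer_lattice" "x \<in> ball l r" "y \<in> ball l r" "k \<in> integer_lattice" for x y k l :: "real ^ 'd"
    using that by (intro bexI[of _ "l + k"]) (auto simp: lattice_add dist_norm)
  show ?thesis unfolding same_def
    using *[of _ x y k] *[of _ "x + k" "y + k" "- k"] k lattice_minus[OF k] by auto
qed

text \<open>Distinct lattice points are at distance at least 1, so with radius at most 1/4 the
  position of \<open>x\<close> already determines the well.\<close>

lemma same_center:
  assumes "x \<in> ball 0 s" "s \<le> 1 / 4" shows "same s x y = indicator (ball 0 s) y"
proof -
  have "k = 0" if k: "k \<in> integer_lattice" "x \<in> ball k s" for k
  proof (rule ccontr)
    assume "k \<noteq> 0"
    then have "1 \<le> norm k" using k lattice_norm_ge1 by blast
    also have "norm k \<le> norm (k - x) + norm x" using norm_triangle_ineq[of "k - x" x] by simp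
    finally show False using k(2) assms by (simp add: dist_norm)
  qed
  then have "(\<exists>k\<in>integer_lattice. x \<in> ball k s \<and> y \<in> ball k s) \<longleftrightarrow> y \<in> ball 0 s"
    using assms zero_in_lattice by blast
  then show ?thesis unfolding same_def indicator_def by simp
qed

lemma weight_same: "weight (same r)"
  using same_measurable same_le1 by (auto simp: weight_def same_nonneg same_shift)

lemma weight_not_same: "0 \<le> t \<Longrightarrow> 0 \<le> s \<Longrightarrow> weight (\<lambda>x y. s * same r x y + t * (1 - same r x y))"
proof -
  assume "0 \<le> t" "0 \<le> s"
  then have "s * same r x y + t * (1 - same r x y) \<le> max s t" "0 \<le> s * same r x y + t * (1 - same r x y)"
    for x y :: "real ^ 'd"
    using same_cases[of r x y] by auto
  then show ?thesis using same_measurable[of r]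
    by (auto simp: weight_def same_shift case_prod_unfold intro!: exI[of _ "max s t"])
qed

section \<open>The kicked heat operator as an integral operator\<close>

locale kicked =
  fixes F :: "real ^ 'd \<Rightarrow> real" and \<nu> :: real
  assumes F_cont: "continuous_on UNIV F" and F_per: "periodic F" and F_nonneg: "\<And>x. 0 \<le> F x"
    and nu_pos: "0 < \<nu>"
begin

lemma F_measurable [measurable]: "F \<in> borel_measurable borel"
  by (rule borel_measurable_continuous_onI[OF F_cont])

definition ker :: "real ^ 'd \<Rightarrow> real ^ 'd \<Rightarrow> real" where
  "ker x y = gauss \<nu> (y - x) * exp (- F y / (2 * \<nu>))"

lemma ker_pos: "0 < ker x y"
  using nu_pos by (simp add: ker_def gauss_pos)

lemma ker_nonneg: "0 \<le> ker x y"
  using ker_pos by (simp add: less_imp_le)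

lemma ker_le: "ker x y \<le> gauss \<nu> (y - x)"
  unfolding ker_def using gauss_pos[OF nu_pos, of "y - x"] F_nonneg[of y] nu_pos
  by (intro mult_left_le) auto

lemma ker_measurable [measurable]:
  "(\<lambda>(x, y). ker x y) \<in> borel_measurable (borel \<Otimes>\<^sub>M borel)"
  unfolding ker_def by measurable

lemma ker_shift: "k \<in> integer_lattice \<Longrightarrow> ker (x + k) (y + k) = ker x y"
  using F_per by (simp add: ker_def periodic_def)

definition opr :: "(real ^ 'd \<Rightarrow> real ^ 'd \<Rightarrow> real) \<Rightarrow> (real ^ 'd \<Rightarrow> real) \<Rightarrow> real ^ 'd \<Rightarrow> real" where
  "opr \<eta> f x = (\<integral>y. \<eta> x y * ker x y * f y \<partial>lborel)"

lemma opr_integrable: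
  assumes \<eta>: "weight \<eta>" and f: "bmp f"
  shows "integrable lborel (\<lambda>y. \<eta> x y * ker x y * f y)"
proof -
  obtain C where C: "\<And>x y. \<eta> x y \<le> C" using \<eta> by (auto simp: weight_def)
  obtain C' where C': "\<And>x. \<bar>f x\<bar> \<le> C'" using f by (auto simp: bmp_def)
  note [measurable] = weightD(1)[OF \<eta>] bmpD(1)[OF f]
  have *: "(\<lambda>y. \<eta> x y) \<in> borel_measurable borel"
    using measurable_compose[OF measurable_Pair1' weightD(1)[OF \<eta>], of x] by simp
  have **: "(\<lambda>y. ker x y) \<in> borel_measurable borel" unfolding ker_def by measurable
  show ?thesis
  proof (rule Bochner_Integration.integrable_bound)
    show "integrable lborel (\<lambda>y. C * C' * gauss \<nu> (y - x))"
      using nu_pos by simp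
    show "AE y in lborel. norm (\<eta> x y * ker x y * f y) \<le> norm (C * C' * gauss \<nu> (y - x))"
    proof (rule AE_I2)
      fix y
      have "0 \<le> C" "0 \<le> C'" using C[of x y] weightD(2)[OF \<eta>, of x y] C'[of x] by linarith+
      have "\<eta> x y * ker x y * \<bar>f y\<bar> \<le> C * gauss \<nu> (y - x) * C'"
        using C C' ker_le[of x y] ker_nonneg[of x y] weightD(2)[OF \<eta>, of x y] \<open>0 \<le> C\<close> \<open>0 \<le> C'\<close>
          gauss_pos[OF nu_pos, of "y - x"]
        by (intro mult_mono mult_nonneg_nonneg) auto
      then show "norm (\<eta> x y * ker x y * f y) \<le> norm (C * C' * gauss \<nu> (y - x))"
        using \<open>0 \<le> C\<close> \<open>0 \<le> C'\<close> gauss_pos[OF nu_pos, of "y - x"] ker_nonneg[of x y] weightD(2)[OF \<eta>, of x y]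
        by (simp add: abs_mult mult_ac)
    qed
  qed (use * ** in measurable)
qed

lemma opr_bmp:
  assumes \<eta>: "weight \<eta>" and f: "bmp f"
  shows "bmp (opr \<eta> f)"
  unfolding bmp_def
proof (intro conjI)
  note [measurable] = weightD(1)[OF \<eta>] bmpD(1)[OF f]
  obtain C where C: "\<And>x y. \<eta> x y \<le> C" using \<eta> by (auto simp: weight_def)
  obtain C' where C': "\<And>x. \<bar>f x\<bar> \<le> C'" using f by (auto simp: bmp_def)
  have "(\<lambda>(x, y). \<eta> x y * ker x y * f y) \<in> borel_measurable (borel \<Otimes>\<^sub>M lborel)"
    by (simp cong: measurable_cong_sets sets_pair_measure_cong)
  then show "opr \<eta> f \<in> borel_measurable borel"
    unfolding opr_def by (rule lborel.borel_measurable_lebesgue_integral)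
  have [measurable]: "(\<lambda>y. \<eta> x y * ker x y * f y) \<in> borel_measurable borel" for x
    using borel_measurable_integrable[OF opr_integrable[OF \<eta> f]] by simp
  show "periodic (opr \<eta> f)"
    unfolding periodic_def
  proof (intro allI ballI)
    fix x k :: "real ^ 'd" assume k: "k \<in> integer_lattice"
    have "opr \<eta> f (x + k) = (\<integral>y. \<eta> (x + k) (y + k) * ker (x + k) (y + k) * f (y + k) \<partial>lborel)"
      unfolding opr_def by (rule integral_lborel_shift[symmetric]) measurable
    also have "\<dots> = opr \<eta> f x"
      using k by (simp add: opr_def weightD(3)[OF \<eta>] ker_shift bmpD(2)[OF f])
    finally show "opr \<eta> f (x + k) = opr \<eta> f x" .
  qed
  show "\<exists>C. \<forall>x. \<bar>opr \<eta> f x\<bar> \<le> C"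
  proof (intro exI allI)
    fix x
    have "0 \<le> C" "0 \<le> C'" using C[of x x] weightD(2)[OF \<eta>, of x x] C'[of x] by linarith+
    have "\<bar>opr \<eta> f x\<bar> \<le> (\<integral>y. \<bar>\<eta> x y * ker x y * f y\<bar> \<partial>lborel)"
      unfolding opr_def by (rule integral_abs_bound)
    also have "\<dots> \<le> (\<integral>y. C * C' * gauss \<nu> (y - x) \<partial>lborel)"
    proof (rule integral_mono)
      show "integrable lborel (\<lambda>y. \<bar>\<eta> x y * ker x y * f y\<bar>)"
        using opr_integrable[OF \<eta> f] by simp
      fix y
      have "\<eta> x y * ker x y * \<bar>f y\<bar> \<le> C * gauss \<nu> (y - x) * C'"
        using C C' ker_le[of x y] ker_nonneg[of x y] weightD(2)[OF \<eta>, of x y] \<open>0 \<le> C\<close> \<open>0 \<le> C'\<close>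
          gauss_pos[OF nu_pos, of "y - x"]
        by (intro mult_mono mult_nonneg_nonneg) auto
      then show "\<bar>\<eta> x y * ker x y * f y\<bar> \<le> C * C' * gauss \<nu> (y - x)"
        using ker_nonneg[of x y] weightD(2)[OF \<eta>, of x y] by (simp add: abs_mult mult_ac)
    qed (use nu_pos in simp)
    also have "\<dots> = C * C'" using nu_pos by (simp add: integral_gauss_shift)
    finally show "\<bar>opr \<eta> f x\<bar> \<le> C * C'" .
  qed
qed

lemma opr_plin:
  assumes \<eta>: "weight \<eta>" shows "plin (opr \<eta>)"
  unfolding plin_def
proof (intro conjI allI impI)
  fix f g :: "real ^ 'd \<Rightarrow> real" and a b assume fg: "bmp f" "bmp g"
  show "opr \<eta> (\<lambda>x. a * f x + b * g x) = (\<lambda>x. a * opr \<eta> f x + b * opr \<eta> g x)"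
  proof
    fix x
    have "opr \<eta> (\<lambda>x. a * f x + b * g x) x =
       (\<integral>y. a * (\<eta> x y * ker x y * f y) + b * (\<eta> x y * ker x y * g y) \<partial>lborel)"
      unfolding opr_def by (simp add: algebra_simps)
    also have "\<dots> = a * opr \<eta> f x + b * opr \<eta> g x"
      unfolding opr_def using opr_integrable[OF \<eta> fg(1)] opr_integrable[OF \<eta> fg(2)] by simp
    finally show "opr \<eta> (\<lambda>x. a * f x + b * g x) x = a * opr \<eta> f x + b * opr \<eta> g x" .
  qed
next
  fix f :: "real ^ 'd \<Rightarrow> real" and x assume "\<forall>x. 0 \<le> f x"
  then show "0 \<le> opr \<eta> f x"
    unfolding opr_def using weightD(2)[OF \<eta>] ker_nonneg by (intro integral_nonneg_AE) auto
qed (rule opr_bmp[OF \<eta>])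

lemma opr_weight_lin:
  assumes "weight \<eta>" "weight \<eta>'" "bmp f"
  shows "opr (\<lambda>x y. a * \<eta> x y + b * \<eta>' x y) f x = a * opr \<eta> f x + b * opr \<eta>' f x"
proof -
  have "opr (\<lambda>x y. a * \<eta> x y + b * \<eta>' x y) f x =
     (\<integral>y. a * (\<eta> x y * ker x y * f y) + b * (\<eta>' x y * ker x y * f y) \<partial>lborel)"
    unfolding opr_def by (simp add: algebra_simps)
  also have "\<dots> = a * opr \<eta> f x + b * opr \<eta>' f x"
    unfolding opr_def using opr_integrable[OF assms(1,3), of x] opr_integrable[OF assms(2,3), of x] by simp
  finally show ?thesis .
qed

lemma ennreal_opr:
  assumes \<eta>: "weight \<eta>" and f: "bmp f" "\<And>x. 0 \<le> f x"
  shows "ennreal (opr \<eta> f x) = (\<integral>\<^sup>+y. ennreal (\<eta> x y * ker x y * f y) \<partial>lborel)"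
  unfolding opr_def using opr_integrable[OF \<eta> f(1)] weightD(2)[OF \<eta>] ker_nonneg f(2)
  by (intro nn_integral_eq_integral[symmetric]) auto

definition L :: "(real ^ 'd \<Rightarrow> real) \<Rightarrow> real ^ 'd \<Rightarrow> real" where "L = opr (\<lambda>_ _. 1)"

lemma kick_heat_op_eq: "kick_heat_op \<nu> F u = L u"
proof
  fix x
  have e: "exp (- (1 / (2 * \<nu>)) * ((norm (y - x))\<^sup>2 / 2 + F y)) =
    exp (- (norm (y - x))\<^sup>2 / (4 * \<nu>)) * exp (- F y / (2 * \<nu>))" for y
    by (subst exp_add[symmetric]) (use nu_pos in \<open>simp add: field_simps\<close>)
  show "kick_heat_op \<nu> F u x = L u x"
    unfolding kick_heat_op_def L_def opr_def ker_def gauss_def e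
    by (subst integral_mult_right_zero[symmetric], intro Bochner_Integration.integral_cong) auto
qed

lemma L_plin: "plin L"
  unfolding L_def by (intro opr_plin weight_const) auto

lemma Ln_plin: "plin (L ^^ n)" by (rule plin_funpow[OF L_plin])

lemma L_integrable: "bmp f \<Longrightarrow> integrable lborel (\<lambda>y. ker x y * f y)"
  using opr_integrable[OF weight_const[of 1]] by simp

lemma L_eq: "L f x = (\<integral>y. ker x y * f y \<partial>lborel)"
  by (simp add: L_def opr_def)

lemma L_pos:
  assumes f: "bmp f" "\<And>x. 0 < f x" shows "0 < L f x"
proof -
  have "0 \<le> L f x" by (rule plin_pos[OF L_plin f(1)]) (simp add: f less_imp_le)
  moreover have "L f x \<noteq> 0"
  proof
    assume "L f x = 0"
    then have "AE y in lborel. ker x y * f y = 0"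
      unfolding L_eq using L_integrable[OF f(1), of x] ker_pos f(2)
      by (subst (asm) integral_nonneg_eq_0_iff_AE) (auto intro!: AE_I2 less_imp_le[OF mult_pos_pos])
    then have "AE y in (lborel :: (real ^ 'd) measure). False"
      using ker_pos f(2) by (simp add: less_imp_neq[symmetric])
    then have "emeasure (lborel :: (real ^ 'd) measure) UNIV = 0"
      using ae_filter_eq_bot_iff[of "lborel :: (real ^ 'd) measure"] by (simp add: eventually_False)
    then show False by simp
  qed
  ultimately show ?thesis by simp
qed

lemma Ln_pos: "bmp f \<Longrightarrow> (\<And>x. 0 < f x) \<Longrightarrow> 0 < (L ^^ n) f x"
  by (induction n arbitrary: x) (auto intro: L_pos plin_bmp[OF Ln_plin])

lemma L_one_le: "L (\<lambda>_. 1) x \<le> 1"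
proof -
  have "(\<integral>y. ker x y \<partial>lborel) \<le> (\<integral>y. gauss \<nu> (y - x) \<partial>lborel)"
    using L_integrable[OF bmp_const[of 1], of x] nu_pos ker_le by (intro integral_mono) auto
  then show ?thesis using nu_pos by (simp add: L_eq integral_gauss_shift)
qed

end

context kicked
begin

subsection \<open>Regularity gained in one step\<close>

definition gauss_ratio :: real where "gauss_ratio = 2 powr (real CARD('d) / 2)"

lemma gauss_ratio_ge1: "1 \<le> gauss_ratio" unfolding gauss_ratio_def by (rule ge_one_powr_ge_zero) auto

text \<open>In terms of \<open>-2 * \<nu> * ln u\<close> this is a Lipschitz bound with constant
  \<open>CARD('d)\<close>, free of \<nu>. It is asked up to distance \<open>CARD('d)\<close>, the
  range in which the quadratic term of semiconcavity is dominated by a linear one.\<close>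

definition slow :: "(real ^ 'd \<Rightarrow> real) \<Rightarrow> bool" where
  "slow u \<longleftrightarrow> (\<forall>x y. norm (x - y) \<le> real CARD('d) \<longrightarrow>
     u x \<le> u y * exp (real CARD('d) * norm (x - y) / (2 * \<nu>)))"

lemma gauss_shift:
  "gauss \<nu> (z - h) = gauss \<nu> z * exp ((z \<bullet> h - (norm h)\<^sup>2 / 2) / (2 * \<nu>))" for z h :: "real ^ 'd"
proof -
  have "(norm (z - h))\<^sup>2 = (norm z)\<^sup>2 - 2 * (z \<bullet> h) + (norm h)\<^sup>2"
    by (simp add: power2_norm_eq_inner inner_diff_left inner_diff_right inner_commute)
  then have "- (norm (z - h))\<^sup>2 / (4 * \<nu>) = (- (norm z)\<^sup>2 + 2 * (z \<bullet> h) - (norm h)\<^sup>2) / (4 * \<nu>)"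
    by simp
  then have "- (norm (z - h))\<^sup>2 / (4 * \<nu>) = - (norm z)\<^sup>2 / (4 * \<nu>) + (z \<bullet> h - (norm h)\<^sup>2 / 2) / (2 * \<nu>)"
    using nu_pos by (simp add: diff_divide_distrib add_divide_distrib)
  then show ?thesis by (simp add: gauss_def mult_exp_exp)
qed

lemma ker_shift_left:
  "ker (x + h) y = ker x y * exp (((y - x) \<bullet> h - (norm h)\<^sup>2 / 2) / (2 * \<nu>))"
  using gauss_shift[of "y - x" h] by (simp add: ker_def diff_diff_add mult_ac)

text \<open>\<open>-2 \<nu> ln (L u)\<close> is semiconcave; by Jensen's inequality the mean of \<open>y - x\<close>
  under the normalised integrand is a supergradient.\<close>

lemma L_supergradient:
  assumes u: "bmp u" "\<And>x. 0 < u x"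
  shows "\<exists>e. \<forall>h. L u (x + h) \<ge> L u x * exp ((e \<bullet> h - (norm h)\<^sup>2 / 2) / (2 * \<nu>))"
proof -
  define m where "m y = ker x y * u y" for y
  define Z where "Z = L u x"
  have Z: "Z > 0" "Z = (\<integral>y. m y \<partial>lborel)" using L_pos[OF u, of x] by (auto simp: Z_def L_eq m_def)
  have m: "0 < m y" for y using ker_pos u by (simp add: m_def)
  have int_m: "integrable lborel m" using L_integrable[OF u(1), of x] by (simp add: m_def[abs_def])
  have shift: "ker (x + h) y * u y = exp (- (norm h)\<^sup>2 / (4 * \<nu>)) * (m y * exp ((y - x) \<bullet> h / (2 * \<nu>)))" for h y
  proof -
    have "((y - x) \<bullet> h - (norm h)\<^sup>2 / 2) / (2 * \<nu>) = - (norm h)\<^sup>2 / (4 * \<nu>) + (y - x) \<bullet> h / (2 * \<nu>)"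
      using nu_pos by (simp add: field_simps)
    then show ?thesis unfolding ker_shift_left m_def by (simp add: mult_exp_exp)
  qed
  have int_exp: "integrable lborel (\<lambda>y. m y * exp ((y - x) \<bullet> h / (2 * \<nu>)))" for h
  proof -
    have "integrable lborel (\<lambda>y. exp (- (norm h)\<^sup>2 / (4 * \<nu>)) * (m y * exp ((y - x) \<bullet> h / (2 * \<nu>))))"
      using L_integrable[OF u(1), of "x + h"] unfolding shift .
    then show ?thesis by simp
  qed
  have int_lin: "integrable lborel (\<lambda>y. m y * ((y - x) \<bullet> h))" for h
  proof (rule Bochner_Integration.integrable_bound)
    show "integrable lborel (\<lambda>y. 2 * \<nu> * (m y * exp ((y - x) \<bullet> h / (2 * \<nu>)) + m y * exp ((y - x) \<bullet> (- h) / (2 * \<nu>))))"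
      using int_exp[of h] int_exp[of "- h"] by simp
    have [measurable]: "m \<in> borel_measurable borel" using borel_measurable_integrable[OF int_m] by simp
    show "(\<lambda>y. m y * ((y - x) \<bullet> h)) \<in> borel_measurable lborel" by measurable
    show "AE y in lborel. norm (m y * ((y - x) \<bullet> h))
      \<le> norm (2 * \<nu> * (m y * exp ((y - x) \<bullet> h / (2 * \<nu>)) + m y * exp ((y - x) \<bullet> (- h) / (2 * \<nu>))))"
    proof (rule AE_I2)
      fix y
      define t where "t = (y - x) \<bullet> h / (2 * \<nu>)"
      have "\<bar>t\<bar> \<le> exp t + exp (- t)"
        using exp_ge_add_one_self[of t] exp_ge_add_one_self[of "- t"] exp_gt_zero[of t] exp_gt_zero[of "- t"]
        by linarith
      then have "2 * \<nu> * m y * \<bar>t\<bar> \<le> 2 * \<nu> * m y * (exp t + exp (- t))"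
        using nu_pos m[of y] by (intro mult_left_mono) auto
      then have *: "norm (m y * (2 * \<nu> * t)) \<le> norm (2 * \<nu> * (m y * exp t + m y * exp (- t)))"
        using nu_pos m[of y] by (simp add: abs_mult algebra_simps)
      have A: "(y - x) \<bullet> h = 2 * \<nu> * t" using nu_pos by (simp add: t_def)
      have B: "(y - x) \<bullet> (- h) / (2 * \<nu>) = - t" by (simp add: t_def)
      show "norm (m y * ((y - x) \<bullet> h))
        \<le> norm (2 * \<nu> * (m y * exp ((y - x) \<bullet> h / (2 * \<nu>)) + m y * exp ((y - x) \<bullet> (- h) / (2 * \<nu>))))"
        unfolding B t_def[symmetric] unfolding A by (rule *)
    qed
  qed
  define e :: "real ^ 'd" where "e = (\<chi> i. (\<integral>y. m y * ((y - x) \<bullet> axis i 1) \<partial>lborel) / Z)"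
  have e: "(\<integral>y. m y * ((y - x) \<bullet> h) \<partial>lborel) = Z * (e \<bullet> h)" for h
  proof -
    have "(\<integral>y. m y * ((y - x) \<bullet> h) \<partial>lborel) = (\<integral>y. (\<Sum>i\<in>UNIV. h $ i * (m y * ((y - x) \<bullet> axis i 1))) \<partial>lborel)"
      by (simp add: inner_vec_def[of _ h] inner_axis sum_distrib_left mult_ac)
    also have "\<dots> = (\<Sum>i\<in>UNIV. h $ i * (\<integral>y. m y * ((y - x) \<bullet> axis i 1) \<partial>lborel))"
      using int_lin by (subst Bochner_Integration.integral_sum) auto
    also have "\<dots> = Z * (e \<bullet> h)"
      using Z by (simp add: e_def inner_vec_def sum_distrib_left field_simps)
    finally show ?thesis .
  qed
  have lin: "(\<integral>y. a * m y + b * (m y * ((y - x) \<bullet> h)) \<partial>lborel) = a * Z + b * (Z * (e \<bullet> h))" for a b h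
    using int_m int_lin[of h] by (simp add: e Z(2))
  show ?thesis
  proof (intro exI allI)
    fix h
    define \<mu> where "\<mu> = e \<bullet> h / (2 * \<nu>)"
    \<comment> \<open>Jensen's inequality in tangent form: the exponential lies above its tangent at
      the mean \<open>\<mu>\<close>, and the integral of that tangent against \<open>m\<close> is
      \<open>Z * exp \<mu>\<close>.\<close>
    have "Z * exp \<mu> = (\<integral>y. exp \<mu> * (1 - \<mu>) * m y + exp \<mu> / (2 * \<nu>) * (m y * ((y - x) \<bullet> h)) \<partial>lborel)"
      unfolding lin using nu_pos by (simp add: \<mu>_def field_simps)
    also have "\<dots> \<le> (\<integral>y. m y * exp ((y - x) \<bullet> h / (2 * \<nu>)) \<partial>lborel)"
    proof (rule integral_mono)
      fix y
      define t where "t = (y - x) \<bullet> h / (2 * \<nu>)"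
      have "exp \<mu> * (1 + (t - \<mu>)) \<le> exp \<mu> * exp (t - \<mu>)" by (intro mult_left_mono exp_ge_add_one_self) auto
      then have *: "m y * (exp \<mu> * (1 + (t - \<mu>))) \<le> m y * exp t"
        using m[of y] by (intro mult_left_mono) (auto simp: exp_diff)
      have A: "(y - x) \<bullet> h = 2 * \<nu> * t" using nu_pos by (simp add: t_def)
      show "exp \<mu> * (1 - \<mu>) * m y + exp \<mu> / (2 * \<nu>) * (m y * ((y - x) \<bullet> h)) \<le> m y * exp ((y - x) \<bullet> h / (2 * \<nu>))"
        unfolding t_def[symmetric] unfolding A using nu_pos * by (simp add: algebra_simps)
    qed (use int_m int_lin[of h] int_exp[of h] in auto)
    finally have "exp (- (norm h)\<^sup>2 / (4 * \<nu>)) * (Z * exp \<mu>) \<le> exp (- (norm h)\<^sup>2 / (4 * \<nu>)) * (\<integral>y. m y * exp ((y - x) \<bullet> h / (2 * \<nu>)) \<partial>lborel)"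
      by (intro mult_left_mono) auto
    also have "\<dots> = L u (x + h)" by (simp add: L_eq shift)
    also have "exp (- (norm h)\<^sup>2 / (4 * \<nu>)) * (Z * exp \<mu>) = Z * exp ((e \<bullet> h - (norm h)\<^sup>2 / 2) / (2 * \<nu>))"
      using nu_pos by (simp add: \<mu>_def exp_add[symmetric] field_simps)
    finally show "L u (x + h) \<ge> L u x * exp ((e \<bullet> h - (norm h)\<^sup>2 / 2) / (2 * \<nu>))" by (simp add: Z_def)
  qed
qed

text \<open>Periodicity bounds the supergradient: moving by a unit lattice vector does not change
  \<open>L u\<close>, so each component is at most 1/2 in absolute value. Hence one kick regularises
  any positive initial function to a degree that does not depend on it, on \<open>F\<close> or on
  \<nu>.\<close>

lemma L_slow:
  assumes u: "bmp u" "\<And>x. 0 < u x" shows "slow (L u)"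
  unfolding slow_def
proof (intro allI impI)
  fix x y :: "real ^ 'd" assume d: "norm (x - y) \<le> real CARD('d)"
  obtain e where e: "\<And>h. L u (x + h) \<ge> L u x * exp ((e \<bullet> h - (norm h)\<^sup>2 / 2) / (2 * \<nu>))"
    using L_supergradient[OF u] by blast
  have pos: "0 < L u x" by (rule L_pos[OF u])
  \<comment> \<open>The value 1/2 is the semiconcavity term \<open>(norm h)\<^sup>2 / 2\<close> at a
    unit vector.\<close>
  have small: "e \<bullet> h \<le> 1 / 2" if "h \<in> integer_lattice" "norm h = 1" for h
  proof -
    have "L u x * exp ((e \<bullet> h - 1 / 2) / (2 * \<nu>)) \<le> L u x"
      using e[of h] that bmpD(2)[OF plin_bmp[OF L_plin u(1)] that(1), of x] by simp
    then have "exp ((e \<bullet> h - 1 / 2) / (2 * \<nu>)) \<le> 1" using pos by simp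
    then show ?thesis using nu_pos by (simp add: divide_le_0_iff)
  qed
  have "\<bar>e $ i\<bar> \<le> 1 / 2" for i
    using small[OF axis_in_lattice[of i]] small[OF lattice_minus[OF axis_in_lattice[of i]]]
    by (simp add: inner_axis abs_le_iff)
  then have "(\<Sum>i\<in>UNIV. \<bar>e $ i\<bar>) \<le> (\<Sum>i\<in>(UNIV :: 'd set). 1 / 2)" by (intro sum_mono) auto
  then have ne: "norm e \<le> real CARD('d) / 2" using norm_le_l1_cart[of e] by simp
  define n where "n = norm (x - y)"
  have "- (e \<bullet> (y - x)) \<le> norm e * n"
    using Cauchy_Schwarz_ineq2[of e "y - x"] by (simp add: n_def norm_minus_commute)
  also have "\<dots> \<le> real CARD('d) / 2 * n" using ne by (intro mult_right_mono) (auto simp: n_def)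
  finally have "e \<bullet> (y - x) \<ge> - (real CARD('d) / 2 * n)" by simp
  \<comment> \<open>The restriction on the distance enters here: half of the constant
    \<open>CARD('d)\<close> comes from the supergradient, the other half absorbs the quadratic
    term.\<close>
  moreover have "n\<^sup>2 \<le> real CARD('d) * n"
    using d by (simp add: n_def power2_eq_square mult_right_mono)
  ultimately have "- (real CARD('d) * n) \<le> e \<bullet> (y - x) - (norm (y - x))\<^sup>2 / 2"
    by (simp add: n_def norm_minus_commute)
  then have "- (real CARD('d) * n) / (2 * \<nu>) \<le> (e \<bullet> (y - x) - (norm (y - x))\<^sup>2 / 2) / (2 * \<nu>)"
    using nu_pos by (intro divide_right_mono) auto
  then have "L u x * exp (- (real CARD('d) * n) / (2 * \<nu>)) \<le> L u (x + (y - x))"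
    using pos by (intro order_trans[OF _ e]) simp
  then have "L u x * exp (- (real CARD('d) * n) / (2 * \<nu>)) * exp (real CARD('d) * n / (2 * \<nu>))
     \<le> L u y * exp (real CARD('d) * n / (2 * \<nu>))" by (intro mult_right_mono) auto
  then show "L u x \<le> L u y * exp (real CARD('d) * norm (x - y) / (2 * \<nu>))"
    by (simp add: n_def mult.assoc exp_add[symmetric])
qed

text \<open>A lattice translate of \<open>y\<close> lies within \<open>CARD('d) / 2\<close> of
  \<open>x\<close>, so the Lipschitz bound controls the oscillation over the whole torus.\<close>

lemma slow_osc:
  assumes u: "slow u" "bmp u" "\<And>x. 0 < u x"
  shows "u x \<le> u y * exp ((real CARD('d))\<^sup>2 / (2 * \<nu>))"
proof -
  define k where "k = nearest (x - y)"
  have k: "k \<in> integer_lattice" by (simp add: k_def)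
  have "norm (x - (y + k)) \<le> real CARD('d)"
    using norm_cube_le[OF diff_nearest_in_cube[of "x - y"]] by (simp add: k_def algebra_simps)
  then have "u x \<le> u (y + k) * exp (real CARD('d) * norm (x - (y + k)) / (2 * \<nu>))"
    using u(1) by (simp add: slow_def)
  also have "u (y + k) = u y" using k u(2) by (simp add: bmpD)
  also have "exp (real CARD('d) * norm (x - (y + k)) / (2 * \<nu>)) \<le> exp ((real CARD('d))\<^sup>2 / (2 * \<nu>))"
    using \<open>norm (x - (y + k)) \<le> _\<close> nu_pos
    by (simp add: power2_eq_square divide_right_mono mult_left_mono)
  finally show ?thesis using u(3)[of y] by (simp add: mult_left_mono)
qed

lemma slow_cont:
  assumes u: "slow u" "\<And>x. 0 < u x" shows "continuous_on UNIV u"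
proof -
  have "(u \<longlongrightarrow> u x) (at x)" for x
  proof (rule tendsto_sandwich)
    let ?e = "\<lambda>y. exp (real CARD('d) * norm (x - y) / (2 * \<nu>))"
    have ev: "\<forall>\<^sub>F y in at x. norm (x - y) \<le> real CARD('d)"
      using eventually_at_ball[of "real CARD('d)" x UNIV]
      by (auto simp: dist_norm elim!: eventually_mono)
    show "\<forall>\<^sub>F y in at x. u x / ?e y \<le> u y"
      using ev by eventually_elim (use u(1) in \<open>simp add: slow_def divide_le_eq\<close>)
    show "\<forall>\<^sub>F y in at x. u y \<le> u x * ?e y"
      using ev by eventually_elim (use u(1) in \<open>simp add: slow_def norm_minus_commute\<close>)
    show "((\<lambda>y. u x / ?e y) \<longlongrightarrow> u x) (at x)" "((\<lambda>y. u x * ?e y) \<longlongrightarrow> u x) (at x)"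
      using nu_pos by (auto intro!: tendsto_eq_intros)
  qed
  then show ?thesis by (simp add: continuous_on_def)
qed

text \<open>On the ball of radius \<open>sqrt \<nu>\<close> the Gaussian exponent and
  \<open>F / (2 * \<nu>)\<close> are both bounded, and the volume of the ball cancels the power of
  \<nu> in the normalisation. Staying there therefore costs a fixed factor per kick, whatever \<nu>
  is.\<close>

lemma L_lower:
  assumes CF: "\<And>y. norm y \<le> sqrt \<nu> \<Longrightarrow> F y \<le> CF * (norm y)\<^sup>2" "0 \<le> CF"
    and f: "bmp f" "\<And>x. 0 \<le> f x" "\<And>x. norm x \<le> sqrt \<nu> \<Longrightarrow> c \<le> f x" "0 \<le> c"
    and x: "norm x \<le> sqrt \<nu>"
  shows "c * (unit_ball_vol (real CARD('d)) * exp (- 1 - CF / 2) / (4 * pi) powr (real CARD('d) / 2)) \<le> L f x"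
proof -
  define q where "q = exp (- 1 - CF / 2) / (4 * pi * \<nu>) powr (real CARD('d) / 2)"
  let ?B = "cball 0 (sqrt \<nu>) :: (real ^ 'd) set"
  have q: "q \<le> ker x y" if "y \<in> ?B" for y
  proof -
    have y: "norm y \<le> sqrt \<nu>" using that by simp
    have "norm (y - x) \<le> 2 * sqrt \<nu>" using norm_triangle_ineq4[of y x] x y by simp
    then have "(norm (y - x))\<^sup>2 \<le> (2 * sqrt \<nu>)\<^sup>2" by (intro power_mono) auto
    then have 1: "(norm (y - x))\<^sup>2 / (4 * \<nu>) \<le> 1" using nu_pos by (simp add: power_mult_distrib)
    have "(norm y)\<^sup>2 \<le> \<nu>" using power_mono[OF y, of 2] nu_pos by simp
    then have "CF * (norm y)\<^sup>2 \<le> CF * \<nu>" using CF(2) by (intro mult_left_mono)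
    then have "F y \<le> CF * \<nu>" using CF(1)[OF y] by simp
    then have 2: "F y / (2 * \<nu>) \<le> CF / 2" using nu_pos by (simp add: field_simps)
    have "exp (- 1 - CF / 2) \<le> exp (- (norm (y - x))\<^sup>2 / (4 * \<nu>)) * exp (- F y / (2 * \<nu>))"
      using 1 2 by (simp add: exp_add[symmetric])
    then show ?thesis
      unfolding q_def ker_def gauss_def by (simp add: divide_right_mono)
  qed
  have "c * (unit_ball_vol (real CARD('d)) * exp (- 1 - CF / 2) / (4 * pi) powr (real CARD('d) / 2))
      = (c * q) * measure lborel ?B"
  proof -
    have "sqrt \<nu> ^ CARD('d) = \<nu> powr (real CARD('d) / 2)"
      using nu_pos by (simp add: powr_half_sqrt[symmetric] powr_powr powr_realpow[symmetric])
    then show ?thesis using nu_pos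
      by (simp add: content_cball q_def powr_mult)
  qed
  also have "\<dots> = (\<integral>y. (c * q) * indicator ?B y \<partial>lborel)"
    by simp
  also have "\<dots> \<le> L f x"
    unfolding L_eq
  proof (rule integral_mono)
    show "integrable lborel (\<lambda>y. c * q * indicator ?B y)"
      by (intro integrable_mult_right integrable_real_indicator) (use emeasure_bounded_finite[of ?B] in auto)
    fix y
    show "c * q * indicator ?B y \<le> ker x y * f y"
    proof (cases "y \<in> ?B")
      case True
      have "c * q \<le> f y * ker x y"
        using q[OF True] f(3)[of y] f(2,4) True
        by (intro mult_mono) (auto simp: q_def)
      then show ?thesis using True by (simp add: mult.commute)
    qed (use f(2) ker_nonneg in auto)
  qed (rule L_integrable[OF f(1)])
  finally show ?thesis .
qed

text \<open>Either an endpoint is outside all wells and its half of the kick is small, or the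
  endpoints are in different wells and the step has length at least 1/2. Splitting the kick evenly
  between both ends makes the bound symmetric, and the kernel at time \<open>2 * \<nu>\<close> is
  left for integration.\<close>

lemma event_bound:
  assumes c: "\<And>z. (\<And>k. k \<in> integer_lattice \<Longrightarrow> z \<notin> ball k \<rho>) \<Longrightarrow> c \<le> F z" and \<rho>: "\<rho> \<le> 1 / 4"
    and ev: "same \<rho> x y = 0"
  shows "gauss \<nu> (y - x) * exp (- F x / (4 * \<nu>)) * exp (- F y / (4 * \<nu>))
     \<le> gauss_ratio * gauss (2 * \<nu>) (y - x) * exp (- min c (1 / 8) / (4 * \<nu>))"
proof -
  define e where "e = exp (- min c (1 / 8) / (4 * \<nu>))"
  have F1: "exp (- F z / (4 * \<nu>)) \<le> 1" for z using F_nonneg[of z] nu_pos by simp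
  have g: "0 \<le> gauss s (y - x)" if "s > 0" for s using gauss_pos[OF that, of "y - x"] by simp
  have Fe: "exp (- F z / (4 * \<nu>)) \<le> e" if "\<And>k. k \<in> integer_lattice \<Longrightarrow> z \<notin> ball k \<rho>" for z
    using c[OF that] nu_pos unfolding e_def by (simp add: divide_right_mono)
  consider (x) "\<And>k. k \<in> integer_lattice \<Longrightarrow> x \<notin> ball k \<rho>"
    | (y) "\<And>k. k \<in> integer_lattice \<Longrightarrow> y \<notin> ball k \<rho>"
    | (j) k l where "k \<in> integer_lattice" "l \<in> integer_lattice" "x \<in> ball k \<rho>" "y \<in> ball l \<rho>"
    by blast
  then show ?thesis
  proof cases
    case x
    have "gauss \<nu> (y - x) * exp (- F x / (4 * \<nu>)) * exp (- F y / (4 * \<nu>)) \<le>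
      (gauss_ratio * gauss (2 * \<nu>) (y - x)) * e * 1"
      using Fe[OF x] F1[of y] gauss_le_double[OF nu_pos, of "y - x"] g nu_pos gauss_ratio_ge1
      by (intro mult_mono) (auto simp: gauss_ratio_def e_def)
    then show ?thesis by (simp add: e_def)
  next
    case y
    have "gauss \<nu> (y - x) * exp (- F x / (4 * \<nu>)) * exp (- F y / (4 * \<nu>)) \<le>
      (gauss_ratio * gauss (2 * \<nu>) (y - x)) * 1 * e"
      using Fe[OF y] F1[of x] gauss_le_double[OF nu_pos, of "y - x"] g nu_pos gauss_ratio_ge1
      by (intro mult_mono) (auto simp: gauss_ratio_def e_def)
    then show ?thesis by (simp add: e_def)
  next
    case j
    then have "k \<noteq> l" using ev by (auto simp: same_def split: if_splits)
    then have "1 \<le> norm (l - k)" using j by (intro lattice_norm_ge1) (auto intro: lattice_diff)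
    also have "l - k = (y - x) + (x - k) + (l - y)" by simp
    also have "norm \<dots> \<le> norm (y - x) + norm (x - k) + norm (l - y)" by (intro norm_triangle_mono) auto
    finally have "1 / 2 \<le> norm (y - x)" using j \<rho> by (simp add: dist_norm norm_minus_commute)
    then have "(1 / 2)\<^sup>2 \<le> (norm (y - x))\<^sup>2" by (intro power_mono) auto
    \<comment> \<open>This is where the threshold 1/8 comes from:
      \<open>(1 / 32) / \<nu> = (1 / 8) / (4 * \<nu>)\<close>.\<close>
    then have "(1 / 32) / \<nu> \<le> ((norm (y - x))\<^sup>2 / 8) / \<nu>"
      using nu_pos by (intro divide_right_mono) (auto simp: power2_eq_square)
    moreover have "min c (1 / 8) / (4 * \<nu>) \<le> (1 / 8) / (4 * \<nu>)"
      using nu_pos by (intro divide_right_mono) auto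
    ultimately have "exp (- (norm (y - x))\<^sup>2 / (8 * \<nu>)) \<le> e"
      unfolding e_def by simp
    then have "gauss_ratio * exp (- (norm (y - x))\<^sup>2 / (8 * \<nu>)) * gauss (2 * \<nu>) (y - x) * 1 * 1
       \<le> gauss_ratio * e * gauss (2 * \<nu>) (y - x) * 1 * 1"
      using g nu_pos gauss_ratio_ge1 by (intro mult_right_mono mult_left_mono) auto
    moreover have "gauss \<nu> (y - x) * exp (- F x / (4 * \<nu>)) * exp (- F y / (4 * \<nu>)) \<le> gauss \<nu> (y - x) * 1 * 1"
      using F1[of y] F1[of x] g nu_pos by (intro mult_mono) auto
    ultimately show ?thesis using gauss_double[OF nu_pos, of "y - x"] by (simp add: gauss_ratio_def e_def mult_ac)
  qed
qed

text \<open>Conjugation by this function symmetrises the kernel, replacing the full kick at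
  \<open>y\<close> by half a kick at each end, as in \<open>event_bound\<close>.\<close>

definition kick_root :: "real ^ 'd \<Rightarrow> real" where "kick_root x = exp (F x / (4 * \<nu>))"

lemma bmp_exp_F: "bmp (\<lambda>x. exp (c * F x))"
  using F_cont F_per by (intro bmp_cont continuous_intros) (auto simp: periodic_def)

lemma bmp_kick_root: "bmp kick_root"
  using bmp_exp_F[of "1 / (4 * \<nu>)"] by (simp add: kick_root_def[abs_def])

lemma kick_root_ge1: "1 \<le> kick_root x" using F_nonneg[of x] nu_pos by (simp add: kick_root_def)

text \<open>After conjugation, excursions are so small that multiplying them by \<open>t\<close>
  still leaves the kernel below \<open>gauss_ratio\<close> times the heat kernel at time
  \<open>2 * \<nu>\<close>. So \<open>kick_root\<close> is a supersolution even for the operator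
  that rewards excursions.\<close>

lemma opr_kick_root_le:
  assumes c: "\<And>z. (\<And>k. k \<in> integer_lattice \<Longrightarrow> z \<notin> ball k \<rho>) \<Longrightarrow> c \<le> F z" and \<rho>: "\<rho> \<le> 1 / 4"
    and t: "0 \<le> t" "t \<le> exp (min c (1 / 8) / (4 * \<nu>))"
  shows "opr (\<lambda>x y. 1 * same \<rho> x y + t * (1 - same \<rho> x y)) kick_root x \<le> gauss_ratio * kick_root x"
proof -
  have "opr (\<lambda>x y. 1 * same \<rho> x y + t * (1 - same \<rho> x y)) kick_root x \<le> (\<integral>y. kick_root x * gauss_ratio * gauss (2 * \<nu>) (y - x) \<partial>lborel)"
    unfolding opr_def
  proof (rule integral_mono)
    show "integrable lborel (\<lambda>y. (1 * same \<rho> x y + t * (1 - same \<rho> x y)) * ker x y * kick_root y)"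
      using t by (intro opr_integrable weight_not_same bmp_kick_root) auto
    show "integrable lborel (\<lambda>y. kick_root x * gauss_ratio * gauss (2 * \<nu>) (y - x))" using nu_pos by simp
    fix y
    define g where "g = gauss \<nu> (y - x) * exp (- F x / (4 * \<nu>)) * exp (- F y / (4 * \<nu>))"
    have g2: "0 \<le> gauss (2 * \<nu>) (y - x)" using gauss_pos[of "2 * \<nu>" "y - x"] nu_pos by simp
    have g0: "0 \<le> g" using gauss_pos[OF nu_pos, of "y - x"] by (simp add: g_def)
    have "ker x y * kick_root y = gauss \<nu> (y - x) * (exp (- F y / (2 * \<nu>)) * exp (F y / (4 * \<nu>)))"
      by (simp add: ker_def kick_root_def)
    also have "exp (- F y / (2 * \<nu>)) * exp (F y / (4 * \<nu>)) = exp (- F y / (4 * \<nu>))"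
      unfolding exp_add[symmetric] using nu_pos by (simp add: field_simps)
    also have "gauss \<nu> (y - x) * exp (- F y / (4 * \<nu>)) = kick_root x * g"
      by (simp add: g_def kick_root_def exp_minus)
    finally have eq: "ker x y * kick_root y = kick_root x * g" .
    have "(1 * same \<rho> x y + t * (1 - same \<rho> x y)) * g \<le> gauss_ratio * gauss (2 * \<nu>) (y - x)"
    proof (cases "same \<rho> x y = 0")
      case True
      have "t * g \<le> exp (min c (1 / 8) / (4 * \<nu>)) * (gauss_ratio * gauss (2 * \<nu>) (y - x) * exp (- min c (1 / 8) / (4 * \<nu>)))"
        using event_bound[OF c \<rho> True] t g0 unfolding g_def[symmetric] by (intro mult_mono) auto
      also have "\<dots> = gauss_ratio * gauss (2 * \<nu>) (y - x)" by (simp add: exp_minus)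
      finally show ?thesis using True by simp
    next
      case False
      then have "same \<rho> x y = 1" using same_cases[of \<rho> x y] by auto
      moreover have "g \<le> gauss \<nu> (y - x) * 1 * 1"
        unfolding g_def using F_nonneg[of x] F_nonneg[of y] nu_pos gauss_pos[OF nu_pos, of "y - x"]
        by (intro mult_mono) auto
      ultimately show ?thesis using gauss_le_double[OF nu_pos, of "y - x"] by (simp add: gauss_ratio_def)
    qed
    then have "kick_root x * ((1 * same \<rho> x y + t * (1 - same \<rho> x y)) * g) \<le> kick_root x * (gauss_ratio * gauss (2 * \<nu>) (y - x))"
      using kick_root_ge1[of x] by (intro mult_left_mono) auto
    then show "(1 * same \<rho> x y + t * (1 - same \<rho> x y)) * ker x y * kick_root y \<le> kick_root x * gauss_ratio * gauss (2 * \<nu>) (y - x)"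
      by (simp only: mult.assoc eq mult.left_commute[of _ "kick_root x"])
  qed
  also have "\<dots> = gauss_ratio * kick_root x" using nu_pos by (simp add: integral_gauss_shift)
  finally show ?thesis .
qed

end

subsection \<open>Exchanging the tails of two paths\<close>

text \<open>The pair \<open>mix s x y\<close>, \<open>mix s y x\<close> has the midpoint of
  \<open>x\<close>, \<open>y\<close> and \<open>s\<close> times their difference:
  \<open>s = 1\<close> is the identity and \<open>s = -1\<close> the exchange of the two
  points.\<close>

definition mix :: "real \<Rightarrow> 'a::real_vector \<Rightarrow> 'a \<Rightarrow> 'a" where
  "mix s x y = ((1 + s) / 2) *\<^sub>R x + ((1 - s) / 2) *\<^sub>R y"

lemma mix_diff: "mix s x y = (1/2) *\<^sub>R (x + y) + (s / 2) *\<^sub>R (x - y)"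
  by (simp add: mix_def algebra_simps add_divide_distrib diff_divide_distrib)

lemma mix_in_convex: "convex U \<Longrightarrow> x \<in> U \<Longrightarrow> y \<in> U \<Longrightarrow> \<bar>s\<bar> \<le> 1 \<Longrightarrow> mix s x y \<in> U"
  unfolding mix_def by (rule convexD) (auto simp: field_simps)

lemma mix_measurable [measurable]:
  "(\<lambda>(x, y). mix s x y) \<in> borel_measurable (borel \<Otimes>\<^sub>M borel :: ((real ^ 'd) \<times> (real ^ 'd)) measure)"
  unfolding mix_def by measurable

lemma nn_integral_mean_difference:
  fixes H :: "'a::euclidean_space \<Rightarrow> 'a \<Rightarrow> ennreal"
  assumes [measurable]: "case_prod H \<in> borel_measurable (borel \<Otimes>\<^sub>M borel)"
  shows "(\<integral>\<^sup>+y. \<integral>\<^sup>+y'. H y y' \<partial>lborel \<partial>lborel) =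
    (\<integral>\<^sup>+e. \<integral>\<^sup>+m. H (m - (1/2) *\<^sub>R e) (m + (1/2) *\<^sub>R e) \<partial>lborel \<partial>lborel)"
proof -
  have "(\<integral>\<^sup>+y. \<integral>\<^sup>+y'. H y y' \<partial>lborel \<partial>lborel) = (\<integral>\<^sup>+y. \<integral>\<^sup>+e. H y (e + y) \<partial>lborel \<partial>lborel)"
    by (intro nn_integral_cong nn_integral_lborel_shift[symmetric]) measurable
  also have "\<dots> = (\<integral>\<^sup>+e. \<integral>\<^sup>+y. H y (e + y) \<partial>lborel \<partial>lborel)"
    by (rule lborel_pair.Fubini'[symmetric]) measurable
  also have "\<dots> = (\<integral>\<^sup>+e. \<integral>\<^sup>+m. H (m + (- (1/2)) *\<^sub>R e) (e + (m + (- (1/2)) *\<^sub>R e)) \<partial>lborel \<partial>lborel)"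
    by (intro nn_integral_cong nn_integral_lborel_shift[symmetric]) measurable
  also have "\<dots> = (\<integral>\<^sup>+e. \<integral>\<^sup>+m. H (m - (1/2) *\<^sub>R e) (m + (1/2) *\<^sub>R e) \<partial>lborel \<partial>lborel)"
  proof -
    have *: "e + (m - (1/2) *\<^sub>R e) = m + (1/2) *\<^sub>R e" for e m :: 'a
      using scaleR_add_left[of "1/2" "1/2" e] by (simp add: algebra_simps)
    show ?thesis by (simp add: *)
  qed
  finally show ?thesis .
qed

text \<open>In the coordinates midpoint and difference, mixing is the dilation of the difference by
  \<open>s\<close>, so its Jacobian is the power of \<open>\<bar>s\<bar>\<close> given by the
  dimension.\<close>

lemma nn_integral_mix:
  fixes \<Phi> :: "real ^ 'd \<Rightarrow> real ^ 'd \<Rightarrow> ennreal"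
  assumes [measurable]: "case_prod \<Phi> \<in> borel_measurable (borel \<Otimes>\<^sub>M borel)" and s: "s \<noteq> 0"
  shows "ennreal (\<bar>s\<bar> ^ CARD('d)) * (\<integral>\<^sup>+y. \<integral>\<^sup>+y'. \<Phi> (mix s y y') (mix s y' y) \<partial>lborel \<partial>lborel) =
    (\<integral>\<^sup>+y. \<integral>\<^sup>+y'. \<Phi> y y' \<partial>lborel \<partial>lborel)"
proof -
  let ?I = "\<lambda>e. \<integral>\<^sup>+m. \<Phi> (m - (1/2) *\<^sub>R e) (m + (1/2) *\<^sub>R e) \<partial>lborel"
  have "(\<integral>\<^sup>+y. \<integral>\<^sup>+y'. \<Phi> y y' \<partial>lborel \<partial>lborel) = (\<integral>\<^sup>+e. ?I e \<partial>lborel)"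
    by (rule nn_integral_mean_difference) measurable
  also have "\<dots> = ennreal (\<bar>s\<bar> ^ DIM(real ^ 'd)) * (\<integral>\<^sup>+e. ?I (0 + s *\<^sub>R e) \<partial>lborel)"
    by (rule nn_integral_lborel_affine[OF _ s]) measurable
  also have "(\<integral>\<^sup>+e. ?I (0 + s *\<^sub>R e) \<partial>lborel) =
     (\<integral>\<^sup>+e. \<integral>\<^sup>+m. \<Phi> (mix s (m - (1/2) *\<^sub>R e) (m + (1/2) *\<^sub>R e)) (mix s (m + (1/2) *\<^sub>R e) (m - (1/2) *\<^sub>R e)) \<partial>lborel \<partial>lborel)"
  proof -
    have "mix s (m - (1/2) *\<^sub>R e) (m + (1/2) *\<^sub>R e) = m - (s/2) *\<^sub>R e" for e m :: "real ^ 'd"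
      by (simp add: mix_diff vec_eq_iff field_simps)
    moreover have "mix s (m + (1/2) *\<^sub>R e) (m - (1/2) *\<^sub>R e) = m + (s/2) *\<^sub>R e" for e m :: "real ^ 'd"
      by (simp add: mix_diff vec_eq_iff field_simps)
    ultimately show ?thesis by simp
  qed
  also have "\<dots> = (\<integral>\<^sup>+y. \<integral>\<^sup>+y'. \<Phi> (mix s y y') (mix s y' y) \<partial>lborel \<partial>lborel)"
    by (rule nn_integral_mean_difference[symmetric]) measurable
  finally show ?thesis by simp
qed

text \<open>Here \<open>a\<close> and \<open>b\<close> are half-differences of a pair before and
  after one step, rescaled by neighbouring values of \<open>tanh\<close>. The kinetic energy may
  grow, but only by the amount that strong convexity gives back in \<open>F_mix\<close>; the
  assumption on \<open>\<tau>\<close> says that the rescaling changes slowly enough for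
  this.\<close>

lemma tanh_quadratic:
  fixes a b :: "'a::real_inner"
  assumes \<tau>: "(cosh \<tau>)\<^sup>2 \<le> 1 + \<kappa>"
  shows "(norm (tanh (\<alpha> + \<tau>) *\<^sub>R a - tanh \<alpha> *\<^sub>R b))\<^sup>2 \<le>
    (norm (a - b))\<^sup>2 + \<kappa> * (1 - (tanh \<alpha>)\<^sup>2) * (norm b)\<^sup>2"
proof -
  define c c' C where "c = cosh \<alpha>" "c' = cosh (\<alpha> + \<tau>)" "C = cosh \<tau>"
  define s s' where "s = tanh \<alpha>" "s' = tanh (\<alpha> + \<tau>)"
  note defs = c_c'_C_def s_s'_def
  have pos: "c > 0" "c' > 0" by (auto simp: defs)
  have "1 - (tanh z)\<^sup>2 = 1 / (cosh z)\<^sup>2" for z :: real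
  proof -
    have "1 - (tanh z)\<^sup>2 = ((cosh z)\<^sup>2 - (sinh z)\<^sup>2) / (cosh z)\<^sup>2"
      by (simp add: tanh_def power_divide diff_divide_distrib)
    then show ?thesis by (simp add: hyperbolic_pythagoras)
  qed
  then have 1: "1 - s\<^sup>2 = 1 / c\<^sup>2" "1 - s'\<^sup>2 = 1 / c'\<^sup>2" by (auto simp: defs)
  have "C = cosh ((\<alpha> + \<tau>) - \<alpha>)" by (simp add: defs)
  also have "\<dots> = c' * c - sinh (\<alpha> + \<tau>) * sinh \<alpha>" unfolding cosh_diff by (simp add: defs)
  finally have 2: "1 - s * s' = C / (c * c')"
    using pos by (simp add: defs tanh_def field_simps)
  define A B where "A = a \<bullet> a" "B = b \<bullet> b"
  have "(norm (a - b))\<^sup>2 + \<kappa> * (1 - s\<^sup>2) * (norm b)\<^sup>2 - (norm (s' *\<^sub>R a - s *\<^sub>R b))\<^sup>2 =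
     (1 - s'\<^sup>2) * A - 2 * (1 - s * s') * (a \<bullet> b) + (1 + \<kappa>) * (1 - s\<^sup>2) * B"
    unfolding power2_norm_eq_inner A_B_def
    by (simp add: inner_diff_left inner_diff_right inner_commute[of b a] power2_eq_square algebra_simps)
  \<comment> \<open>Completing the square in \<open>a\<close>; the addition theorem for
    \<open>cosh\<close> turns the cross term into exactly the one required.\<close>
  also have "\<dots> = (norm ((1 / c') *\<^sub>R a - (C / c) *\<^sub>R b))\<^sup>2 + (1 + \<kappa> - C\<^sup>2) / c\<^sup>2 * B"
    unfolding power2_norm_eq_inner A_B_def 1 2 using pos
    by (simp add: inner_diff_left inner_diff_right inner_commute[of b a] power2_eq_square field_simps)
  also have "\<dots> \<ge> 0" using \<tau> by (auto simp: defs A_B_def intro!: add_nonneg_nonneg mult_nonneg_nonneg divide_nonneg_nonneg)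
  finally show ?thesis by (simp add: defs)
qed

text \<open>With \<open>z = exp (- 2 * y)\<close> one has \<open>tanh y = (1 - z) / (1 + z)\<close>,
  and both factors are bounded below by exponentials linear in \<open>z\<close> as long as
  \<open>z\<close> stays away from 1. Products of such values then reduce to sums of
  \<open>z\<close>.\<close>

lemma tanh_ge_exp:
  fixes y \<tau> :: real
  assumes y: "\<tau> / 2 \<le> y" and \<tau>: "\<tau> > 0"
  shows "exp (- (1 + 1 / (1 - exp (- \<tau>))) * exp (- 2 * y)) \<le> tanh y"
proof -
  define z z0 where "z = exp (- 2 * y)" "z0 = exp (- \<tau>)"
  have z: "0 < z" "z \<le> z0" "z0 < 1" using assms by (auto simp: z_z0_def)
  have "1 / (1 - z) \<le> exp (z / (1 - z))"
    using exp_ge_add_one_self[of "z / (1 - z)"] z by (simp add: field_simps)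
  then have "exp (- (z / (1 - z))) \<le> 1 - z"
    using z by (simp add: exp_minus field_simps)
  moreover have "exp (- (z / (1 - z0))) \<le> exp (- (z / (1 - z)))"
    using z by (auto intro!: divide_left_mono)
  moreover have "exp (- z) \<le> 1 / (1 + z)"
    using exp_ge_add_one_self[of z] z by (simp add: exp_minus field_simps)
  ultimately have "exp (- (z / (1 - z0))) \<le> 1 - z" "exp (- z) \<le> 1 / (1 + z)"
    by linarith+
  then have "exp (- (z / (1 - z0))) * exp (- z) \<le> (1 - z) * (1 / (1 + z))"
    using z by (intro mult_mono) auto
  also have "\<dots> = tanh y" by (simp add: tanh_real_altdef z_z0_def)
  finally show ?thesis by (simp add: exp_add[symmetric] z_z0_def algebra_simps)
qed

text \<open>The deviation of the factors from 1 decays geometrically away from the centre, so the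
  product stays positive uniformly in its length. The shift by 1/2 keeps every node at distance at
  least \<open>\<tau> / 2\<close> from the zero of \<open>tanh\<close>.\<close>

lemma prod_tanh_bound:
  fixes \<tau> :: real
  assumes \<tau>: "\<tau> > 0"
  shows "\<exists>c>0. \<forall>J. c \<le> (\<Prod>i<2 * J + 1. \<bar>tanh ((real i - real J - 1/2) * \<tau>)\<bar>)"
proof -
  define K q where "K = 1 + 1 / (1 - exp (- \<tau>))" "q = exp (- 2 * \<tau>)"
  have q: "0 < q" "q < 1" and K: "K > 0" using \<tau> by (auto simp: K_q_def intro: add_pos_nonneg)
  have geo: "(\<Sum>i<n. q ^ i) \<le> 1 / (1 - q)" for n
    using q sum_gp_strict[of q n] by (simp add: divide_right_mono)
  have "exp (- K * (2 / (1 - q))) \<le> (\<Prod>i<2 * J + 1. \<bar>tanh ((real i - real J - 1/2) * \<tau>)\<bar>)" for J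
  proof -
    define e where "e i = exp (- 2 * \<bar>(real i - real J - 1/2) * \<tau>\<bar>)" for i
    \<comment> \<open>Negative nodes (\<open>i \<le> J\<close>) and positive nodes are separated;
      each half is dominated by the geometric series in \<open>q\<close> counted from the
      centre.\<close>
    have "(\<Sum>i<2 * J + 1. e i) = (\<Sum>i<J + 1. e i) + (\<Sum>i\<in>{J + 1..<J + 1 + J}. e i)"
      using sum.atLeastLessThan_concat[of 0 "J + 1" "J + 1 + J" e] by (simp add: lessThan_atLeast0 mult_2)
    also have "(\<Sum>i<J + 1. e i) \<le> (\<Sum>i<J + 1. q ^ (J + 1 - Suc i))"
    proof (rule sum_mono)
      fix i assume "i \<in> {..<J + 1}"
      then have i: "i \<le> J" by auto
      have "q ^ (J - i) = exp (- 2 * ((real J - real i) * \<tau>))"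
        using i by (simp add: K_q_def exp_of_nat_mult[symmetric] of_nat_diff algebra_simps)
      moreover have "(real J - real i) * \<tau> \<le> \<bar>(real i - real J - 1/2) * \<tau>\<bar>"
        using i \<tau> by (simp add: abs_mult mult_right_mono)
      ultimately show "e i \<le> q ^ (J + 1 - Suc i)" by (simp add: e_def)
    qed
    also have "\<dots> = (\<Sum>i<J + 1. q ^ i)" by (rule sum.nat_diff_reindex)
    also have "(\<Sum>i\<in>{J + 1..<J + 1 + J}. e i) = (\<Sum>i<J. e (i + (J + 1)))"
      using sum.shift_bounds_nat_ivl[of e 0 "J + 1" J] by (simp add: lessThan_atLeast0 add.commute)
    also have "\<dots> \<le> (\<Sum>i<J. q ^ i)"
    proof (rule sum_mono)
      fix i
      have "q ^ i = exp (- 2 * (real i * \<tau>))" by (simp add: K_q_def exp_of_nat_mult[symmetric] mult_ac)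
      moreover have "real i * \<tau> \<le> \<bar>(real (i + (J + 1)) - real J - 1/2) * \<tau>\<bar>"
        using \<tau> by (simp add: abs_mult mult_right_mono)
      ultimately show "e (i + (J + 1)) \<le> q ^ i" by (simp add: e_def)
    qed
    finally have "(\<Sum>i<2 * J + 1. e i) \<le> 2 / (1 - q)" using geo[of "J + 1"] geo[of J] by simp
    then have "K * (\<Sum>i<2 * J + 1. e i) \<le> K * (2 / (1 - q))" using K by (intro mult_left_mono) auto
    then have "exp (- K * (2 / (1 - q))) \<le> exp (\<Sum>i<2 * J + 1. - K * e i)"
      by (simp add: sum_distrib_left[symmetric] sum_negf)
    also have "\<dots> = (\<Prod>i<2 * J + 1. exp (- K * e i))" by (rule exp_sum) simp
    also have "\<dots> \<le> (\<Prod>i<2 * J + 1. \<bar>tanh ((real i - real J - 1/2) * \<tau>)\<bar>)"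
    proof (intro prod_mono conjI)
      fix i
      have "1 / 2 \<le> \<bar>real i - real J - 1/2\<bar>"
        by (cases "i \<le> J") (auto simp: not_le Suc_le_eq[symmetric] of_nat_le_iff[symmetric, where 'a=real] simp del: of_nat_le_iff)
      then have "\<tau> / 2 \<le> \<bar>(real i - real J - 1/2) * \<tau>\<bar>"
        using \<tau> by (simp add: abs_mult mult_right_mono)
      from tanh_ge_exp[OF this \<tau>] show "exp (- K * e i) \<le> \<bar>tanh ((real i - real J - 1/2) * \<tau>)\<bar>"
        by (simp only: tanh_real_abs e_def K_q_def)
    qed auto
    finally show ?thesis .
  qed
  then show ?thesis by (intro exI[of _ "exp (- K * (2 / (1 - q)))"]) auto
qed

section \<open>Pairs of paths confined to a strongly convex well\<close>

locale kicked_well = kicked F \<nu> for F :: "real ^ 'd \<Rightarrow> real" and \<nu> +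
  fixes r \<kappa> :: real
  assumes r: "0 < r" "r \<le> 1 / 4" and kappa: "0 < \<kappa>"
    and F_convex: "\<And>x y t. x \<in> ball 0 r \<Longrightarrow> y \<in> ball 0 r \<Longrightarrow> 0 \<le> t \<Longrightarrow> t \<le> 1 \<Longrightarrow>
      F ((1 - t) *\<^sub>R x + t *\<^sub>R y) \<le> (1 - t) * F x + t * F y - \<kappa> / 2 * (t * (1 - t)) * (norm (x - y))\<^sup>2"
begin

definition D :: "(real ^ 'd \<Rightarrow> real) \<Rightarrow> real ^ 'd \<Rightarrow> real" where "D = opr (same r)"

lemma D_plin: "plin D" unfolding D_def by (rule opr_plin[OF weight_same])
lemma Dn_plin: "plin (D ^^ n)" by (rule plin_funpow[OF D_plin])

text \<open>Sum of the two strong convexity inequalities at parameter \<open>(1 + s) / 2\<close>;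
  the linear parts add up to \<open>F y + F y'\<close>, and \<open>t * (1 - t)\<close> becomes
  \<open>(1 - s\<^sup>2) / 4\<close>.\<close>

lemma F_mix:
  assumes y: "y \<in> ball 0 r" "y' \<in> ball 0 r" and s: "\<bar>s\<bar> \<le> 1"
  shows "F (mix s y y') + F (mix s y' y) \<le> F y + F y' - \<kappa> * (1 - s\<^sup>2) * (norm ((1/2) *\<^sub>R (y - y')))\<^sup>2"
proof -
  have "F (mix s y y') \<le> (1 - (1 + s) / 2) * F y' + (1 + s) / 2 * F y - \<kappa> / 2 * ((1 + s) / 2 * (1 - (1 + s) / 2)) * (norm (y' - y))\<^sup>2"
    using F_convex[OF y(2,1), of "(1 + s) / 2"] s by (simp add: mix_def add.commute field_simps)
  moreover have "F (mix s y' y) \<le> (1 - (1 + s) / 2) * F y + (1 + s) / 2 * F y' - \<kappa> / 2 * ((1 + s) / 2 * (1 - (1 + s) / 2)) * (norm (y - y'))\<^sup>2"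
    using F_convex[OF y, of "(1 + s) / 2"] s by (simp add: mix_def add.commute field_simps)
  moreover have "norm ((1/2) *\<^sub>R (y - y')) = norm (y - y') / 2" by simp
  ultimately show ?thesis
    by (simp only: norm_minus_commute[of y' y]) (simp add: power2_eq_square field_simps)
qed

text \<open>By the parallelogram law mixing changes only the part of the kinetic energy that comes
  from the half-differences. Its possible increase from \<open>tanh_quadratic\<close> is cancelled
  by the gain in \<open>F_mix\<close>, so a mixed pair of steps is at least as likely as the
  original pair.\<close>

lemma ker_mix:
  assumes y: "y \<in> ball 0 r" "y' \<in> ball 0 r" and \<tau>: "(cosh \<tau>)\<^sup>2 \<le> 1 + \<kappa>"
    and s: "s = tanh \<alpha>" "s' = tanh (\<alpha> + \<tau>)"
  shows "ker x y * ker x' y' \<le> ker (mix s' x x') (mix s y y') * ker (mix s' x' x) (mix s y' y)"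
proof -
  define p a b where "p = (1/2) *\<^sub>R (y + y') - (1/2) *\<^sub>R (x + x')" "a = (1/2) *\<^sub>R (x - x')" "b = (1/2) *\<^sub>R (y - y')"
  have pa: "(norm (p + c))\<^sup>2 + (norm (p - c))\<^sup>2 = 2 * (norm p)\<^sup>2 + 2 * (norm c)\<^sup>2" for c
    unfolding power2_norm_eq_inner by (simp add: inner_add_left inner_add_right inner_diff_left inner_diff_right)
  have v: "y - x = p + (b - a)" "y' - x' = p - (b - a)"
    "mix s y y' - mix s' x x' = p + (s *\<^sub>R b - s' *\<^sub>R a)" "mix s y' y - mix s' x' x = p - (s *\<^sub>R b - s' *\<^sub>R a)"
    by (simp_all add: p_a_b_def mix_diff vec_eq_iff field_simps)
  have s1: "\<bar>s\<bar> \<le> 1" using tanh_real_lt_1[of \<alpha>] tanh_real_gt_neg1[of \<alpha>] unfolding s by linarith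
  have "(norm (s *\<^sub>R b - s' *\<^sub>R a))\<^sup>2 \<le> (norm (b - a))\<^sup>2 + \<kappa> * (1 - s\<^sup>2) * (norm b)\<^sup>2"
    using tanh_quadratic[OF \<tau>, of \<alpha> a b] by (simp add: s norm_minus_commute)
  then have "((norm (mix s y y' - mix s' x x'))\<^sup>2 + (norm (mix s y' y - mix s' x' x))\<^sup>2) + 2 * (F (mix s y y') + F (mix s y' y))
     \<le> ((norm (y - x))\<^sup>2 + (norm (y' - x'))\<^sup>2) + 2 * (F y + F y')"
    unfolding v pa using F_mix[OF y s1] by (simp add: p_a_b_def)
  then have le: "- (((norm (y - x))\<^sup>2 + (norm (y' - x'))\<^sup>2) + 2 * (F y + F y')) / (4 * \<nu>) \<le>
     - (((norm (mix s y y' - mix s' x x'))\<^sup>2 + (norm (mix s y' y - mix s' x' x))\<^sup>2) + 2 * (F (mix s y y') + F (mix s y' y))) / (4 * \<nu>)"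
    using nu_pos by (intro divide_right_mono) auto
  define w where "w = (4 * pi * \<nu>) powr (real CARD('d) / 2)"
  have w: "w > 0" using nu_pos by (simp add: w_def)
  have k: "ker x y * ker x' y' = exp (- (((norm (y - x))\<^sup>2 + (norm (y' - x'))\<^sup>2) + 2 * (F y + F y')) / (4 * \<nu>)) / w\<^sup>2" for x x' y y'
  proof -
    have "- (((norm (y - x))\<^sup>2 + (norm (y' - x'))\<^sup>2) + 2 * (F y + F y')) / (4 * \<nu>) =
       - (norm (y - x))\<^sup>2 / (4 * \<nu>) + (- F y / (2 * \<nu>)) + (- (norm (y' - x'))\<^sup>2 / (4 * \<nu>) + (- F y' / (2 * \<nu>)))"
      using nu_pos by (simp add: field_simps)
    then show ?thesis using w by (simp only: exp_add ker_def gauss_def w_def[symmetric]) (simp add: power2_eq_square)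
  qed
  show ?thesis unfolding k using le w by (intro divide_right_mono) auto
qed

text \<open>On the right-hand side \<open>f\<close> and \<open>g\<close> have changed places. One
  kick advances the mixing parameter from \<open>\<alpha>\<close> to
  \<open>\<alpha> + \<tau>\<close> and costs only the Jacobian of mixing the integration variables,
  so the bound can be iterated.\<close>

lemma swap_step:
  assumes f: "bmp f" "\<And>x. 0 \<le> f x" and g: "bmp g" "\<And>x. 0 \<le> g x"
    and s: "s = tanh \<alpha>" "s' = tanh (\<alpha> + \<tau>)" "s \<noteq> 0" and \<tau>: "(cosh \<tau>)\<^sup>2 \<le> 1 + \<kappa>" and C: "0 \<le> C"
    and IH: "\<And>y y'. y \<in> ball 0 r \<Longrightarrow> y' \<in> ball 0 r \<Longrightarrow> f y * g y' \<le> C * (g (mix s y y') * f (mix s y' y))"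
    and x: "x \<in> ball 0 r" "x' \<in> ball 0 r"
  shows "D f x * D g x' \<le> C / \<bar>s\<bar> ^ CARD('d) * (D g (mix s' x x') * D f (mix s' x' x))"
proof -
  let ?U = "ball 0 r :: (real ^ 'd) set"
  have s1: "\<bar>s\<bar> \<le> 1" "\<bar>s'\<bar> \<le> 1" unfolding s
    using tanh_real_lt_1[of \<alpha>] tanh_real_gt_neg1[of \<alpha>] tanh_real_lt_1[of "\<alpha> + \<tau>"] tanh_real_gt_neg1[of "\<alpha> + \<tau>"]
    by linarith+
  define \<xi> \<xi>' where "\<xi> = mix s' x x'" "\<xi>' = mix s' x' x"
  have \<xi>: "\<xi> \<in> ?U" "\<xi>' \<in> ?U" unfolding \<xi>_\<xi>'_def
    using mix_in_convex[OF convex_ball x s1(2)] mix_in_convex[OF convex_ball x(2,1) s1(2)] by simp_all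
  define h where "h z u y = ennreal (indicator ?U y * ker z y * u y)" for z y :: "real ^ 'd" and u
  have D: "ennreal (D u z) = (\<integral>\<^sup>+y. h z u y \<partial>lborel)" if "bmp u" "\<And>x. 0 \<le> u x" "z \<in> ?U" for u z
    unfolding D_def h_def ennreal_opr[OF weight_same that(1,2)] same_center[OF that(3) r(2)] ..
  have hm: "h z u \<in> borel_measurable borel" if "bmp u" for z u
  proof -
    have [measurable]: "?U \<in> sets borel" by (rule borel_open) simp
    note [measurable] = bmpD(1)[OF that]
    show ?thesis unfolding h_def ker_def by measurable
  qed
  note [measurable] = hm[OF f(1)] hm[OF g(1)]
  \<comment> \<open>The integrand after the exchange. It carries the indicator of the ball in both
    variables, and mixing maps the ball into itself, so the change of variables takes place on the
    whole space without loss.\<close>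
  define \<Phi> where "\<Phi> y y' = h \<xi> g y * h \<xi>' f y'" for y y'
  have "ennreal (D f x * D g x') = ennreal (D f x) * ennreal (D g x')"
    using plin_pos[OF D_plin f] plin_pos[OF D_plin g] by (simp add: ennreal_mult)
  also have "\<dots> = (\<integral>\<^sup>+y. \<integral>\<^sup>+y'. h x f y * h x' g y' \<partial>lborel \<partial>lborel)"
    by (simp add: D[OF f x(1)] D[OF g x(2)] nn_integral_multc nn_integral_cmult)
  also have "\<dots> \<le> (\<integral>\<^sup>+y. \<integral>\<^sup>+y'. ennreal C * \<Phi> (mix s y y') (mix s y' y) \<partial>lborel \<partial>lborel)"
  proof (intro nn_integral_mono)
    fix y y' :: "real ^ 'd"
    show "h x f y * h x' g y' \<le> ennreal C * \<Phi> (mix s y y') (mix s y' y)"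
    proof (cases "y \<in> ?U \<and> y' \<in> ?U")
      case True
      then have y: "y \<in> ?U" "y' \<in> ?U" by auto
      have z: "mix s y y' \<in> ?U" "mix s y' y \<in> ?U" using mix_in_convex[OF convex_ball y s1(1)] mix_in_convex[OF convex_ball y(2,1) s1(1)] by simp_all
      have "(ker x y * ker x' y') * (f y * g y') \<le>
         (ker \<xi> (mix s y y') * ker \<xi>' (mix s y' y)) * (C * (g (mix s y y') * f (mix s y' y)))"
        unfolding \<xi>_\<xi>'_def using ker_nonneg f(2) g(2)
        by (intro mult_mono[OF ker_mix[OF y \<tau> s(1,2)] IH[OF y]]) auto
      then show ?thesis
        using y z C f(2) g(2) ker_nonneg unfolding h_def \<Phi>_def
        by (simp add: ennreal_mult[symmetric] ennreal_leI mult_ac del: mem_ball)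
    qed (auto simp: h_def indicator_def)
  qed
  also have "\<dots> = ennreal C * (\<integral>\<^sup>+y. \<integral>\<^sup>+y'. \<Phi> (mix s y y') (mix s y' y) \<partial>lborel \<partial>lborel)"
    unfolding \<Phi>_def by (simp add: nn_integral_cmult)
  finally have "ennreal (D f x * D g x') \<le>
     ennreal C * (\<integral>\<^sup>+y. \<integral>\<^sup>+y'. \<Phi> (mix s y y') (mix s y' y) \<partial>lborel \<partial>lborel)" .
  then have "ennreal (\<bar>s\<bar> ^ CARD('d)) * ennreal (D f x * D g x') \<le>
     ennreal (\<bar>s\<bar> ^ CARD('d)) * (ennreal C * (\<integral>\<^sup>+y. \<integral>\<^sup>+y'. \<Phi> (mix s y y') (mix s y' y) \<partial>lborel \<partial>lborel))"
    by (rule mult_left_mono) simp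
  then have "ennreal (\<bar>s\<bar> ^ CARD('d)) * ennreal (D f x * D g x') \<le>
     ennreal C * (ennreal (\<bar>s\<bar> ^ CARD('d)) * (\<integral>\<^sup>+y. \<integral>\<^sup>+y'. \<Phi> (mix s y y') (mix s y' y) \<partial>lborel \<partial>lborel))"
    by (simp only: mult.left_commute)
  also have "ennreal (\<bar>s\<bar> ^ CARD('d)) * (\<integral>\<^sup>+y. \<integral>\<^sup>+y'. \<Phi> (mix s y y') (mix s y' y) \<partial>lborel \<partial>lborel) =
     (\<integral>\<^sup>+y. \<integral>\<^sup>+y'. \<Phi> y y' \<partial>lborel \<partial>lborel)"
    by (rule nn_integral_mix[OF _ s(3)]) (simp add: \<Phi>_def)
  also have "\<dots> = ennreal (D g \<xi>) * ennreal (D f \<xi>')"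
    by (simp add: \<Phi>_def D[OF f \<xi>(2)] D[OF g \<xi>(1)] nn_integral_multc nn_integral_cmult)
  finally have "\<bar>s\<bar> ^ CARD('d) * (D f x * D g x') \<le> C * (D g \<xi> * D f \<xi>')"
    using C plin_pos[OF D_plin f] plin_pos[OF D_plin g]
    by (simp add: ennreal_mult[symmetric] ennreal_le_iff)
  then show ?thesis using s(3) by (simp add: \<xi>_\<xi>'_def field_simps)
qed


definition E :: "(real ^ 'd \<Rightarrow> real) \<Rightarrow> real ^ 'd \<Rightarrow> real" where
  "E = opr (\<lambda>x y. 1 - same r x y)"

lemma weight_E: "weight (\<lambda>x y. 1 - same r x y)"
  using weight_not_same[of 1 0 r] by simp

lemma E_plin: "plin E" unfolding E_def by (rule opr_plin[OF weight_E])

lemma L_split: "bmp f \<Longrightarrow> L f x = D f x + E f x"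
  using opr_weight_lin[OF weight_same[of r] weight_E, where a=1 and b=1] by (simp add: L_def D_def E_def)

lemma D_le_L: "bmp f \<Longrightarrow> (\<And>x. 0 \<le> f x) \<Longrightarrow> D f x \<le> L f x"
  using L_split plin_pos[OF E_plin] by simp

lemma Dn_le_Ln: "bmp f \<Longrightarrow> (\<And>x. 0 \<le> f x) \<Longrightarrow> (D ^^ n) f x \<le> (L ^^ n) f x"
proof (induction n arbitrary: x)
  case (Suc n)
  have "D ((D ^^ n) f) x \<le> D ((L ^^ n) f) x"
    using Suc by (intro plin_mono[OF D_plin]) (auto intro: plin_bmp[OF Dn_plin] plin_bmp[OF Ln_plin])
  also have "\<dots> \<le> L ((L ^^ n) f) x"
    using Suc by (intro D_le_L) (auto intro: plin_bmp[OF Ln_plin] plin_pos[OF Ln_plin])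
  finally show ?case by simp
qed simp

lemma Ln_slow: "bmp u \<Longrightarrow> (\<And>x. 0 < u x) \<Longrightarrow> slow u \<Longrightarrow> slow ((L ^^ n) u)"
  by (cases n) (auto intro!: L_slow plin_bmp[OF Ln_plin] Ln_pos)

text \<open>The mixing parameter runs from \<open>- \<sigma>\<close> to \<open>\<sigma>\<close>,
  almost a full exchange at the data and almost none at the start. Each of the four evaluations
  misses its target by at most \<open>(1 - \<sigma>) * r\<close>, at the cost of one factor
  \<open>g\<close>; this gives \<open>g ^ 4\<close> in total.\<close>

lemma window_well:
  assumes A: "bmp A" "\<And>x. 0 < A x" "slow A" and B: "bmp B" "\<And>x. 0 < B x" "slow B"
    and \<tau>: "0 < \<tau>" "(cosh \<tau>)\<^sup>2 \<le> 1 + \<kappa>"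
    and c: "0 < c" "c \<le> (\<Prod>i<2 * J + 1. \<bar>tanh ((real i - real J - 1/2) * \<tau>)\<bar>)"
    and x: "x \<in> ball 0 r" "x' \<in> ball 0 r"
  defines "N \<equiv> 2 * J + 1" and "\<sigma> \<equiv> tanh ((real J + 1/2) * \<tau>)"
  shows "(D ^^ N) A x * (D ^^ N) B x' \<le>
    exp (2 * real CARD('d) * r * (1 - \<sigma>) / \<nu>) / c ^ CARD('d) * ((L ^^ N) B x * (L ^^ N) A x')"
proof -
  let ?d = "real CARD('d)"
  define \<alpha> where "\<alpha> i = (real i - real J - 1/2) * \<tau>" for i
  define s where "s i = tanh (\<alpha> i)" for i
  define g where "g = exp (?d * ((1 - \<sigma>) * r) / (2 * \<nu>))"
  have \<sigma>: "0 \<le> \<sigma>" "\<sigma> \<le> 1" using \<tau> tanh_real_lt_1[of "(real J + 1/2) * \<tau>"] by (auto simp: \<sigma>_def)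
  have g: "g \<ge> 1" using \<sigma> r nu_pos by (simp add: g_def)
  \<comment> \<open>The odd length \<open>N = 2 * J + 1\<close> makes the two ends symmetric
    although no node is at 0. The last parameter \<open>s N\<close> acts on the fixed points
    \<open>x\<close>, \<open>x'\<close> and contributes no Jacobian.\<close>
  have s0: "s 0 = - \<sigma>" "s N = \<sigma>"
  proof -
    have "\<alpha> 0 = - ((real J + 1/2) * \<tau>)" "\<alpha> N = (real J + 1/2) * \<tau>"
      by (auto simp: \<alpha>_def N_def algebra_simps)
    then show "s 0 = - \<sigma>" "s N = \<sigma>" by (simp_all only: s_def \<sigma>_def tanh_minus)
  qed
  have s_nz: "s i \<noteq> 0" for i
  proof -
    have "real i - real J - 1/2 \<noteq> 0"
    proof
      assume "real i - real J - 1/2 = 0"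
      then have "real (2 * i) = real (2 * J + 1)" by simp
      then have "2 * i = 2 * J + 1" by (rule of_nat_eq_iff[THEN iffD1])
      then show False by presburger
    qed
    then show ?thesis using \<tau> by (simp add: s_def \<alpha>_def)
  qed
  have d1: "1 \<le> ?d" by simp
  have near: "u z \<le> u w * g" if u: "slow u" "\<And>x. 0 < u x" and zw: "norm (z - w) \<le> (1 - \<sigma>) * r" for u z w
  proof -
    have "(1 - \<sigma>) * r \<le> 1 * r" using \<sigma> r by (intro mult_right_mono) auto
    then have "norm (z - w) \<le> ?d" using zw r d1 by linarith
    then have "u z \<le> u w * exp (?d * norm (z - w) / (2 * \<nu>))" using u(1) by (simp add: slow_def)
    also have "\<dots> \<le> u w * g"
      using zw u(2)[of w] nu_pos by (simp add: g_def divide_right_mono)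
    finally show ?thesis .
  qed
  have diam: "norm (y - y') \<le> 2 * r" if "y \<in> ball 0 r" "y' \<in> ball 0 r" for y y' :: "real ^ 'd"
    using norm_triangle_ineq4[of y y'] that by simp
  have mix_near: "norm (y - mix \<sigma> y y') \<le> (1 - \<sigma>) * r" if "y \<in> ball 0 r" "y' \<in> ball 0 r" for y y' :: "real ^ 'd"
  proof -
    have "y - mix \<sigma> y y' = ((1 - \<sigma>) / 2) *\<^sub>R (y - y')" by (simp add: mix_diff vec_eq_iff field_simps)
    then have "norm (y - mix \<sigma> y y') = (1 - \<sigma>) / 2 * norm (y - y')" using \<sigma> by simp
    also have "\<dots> \<le> (1 - \<sigma>) / 2 * (2 * r)" using diam[OF that] \<sigma> by (intro mult_left_mono) auto
    finally show ?thesis by simp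
  qed
  have mix_swap: "mix (- \<sigma>) y y' = mix \<sigma> y' y" for y y' :: "real ^ 'd" by (simp add: mix_def add.commute)
  have main: "(D ^^ j) A y * (D ^^ j) B y' \<le>
      g\<^sup>2 / (\<Prod>i<j. \<bar>s i\<bar> ^ CARD('d)) * ((D ^^ j) B (mix (s j) y y') * (D ^^ j) A (mix (s j) y' y))"
    if "y \<in> ball 0 r" "y' \<in> ball 0 r" for j y y'
    using that
  proof (induction j arbitrary: y y')
    case 0
    have "A y * B y' \<le> (A (mix \<sigma> y y') * g) * (B (mix \<sigma> y' y) * g)"
      using near[OF A(3,2) mix_near[OF 0]] near[OF B(3,2) mix_near[OF 0(2,1)]] A(2) B(2) g
      by (intro mult_mono mult_nonneg_nonneg) (auto intro: less_imp_le)
    then show ?case by (simp add: s0 mix_swap power2_eq_square mult_ac)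
  next
    case (Suc j)
    have nonneg: "0 \<le> (D ^^ j) A z" "0 \<le> (D ^^ j) B z" for z
      using A B by (auto intro!: plin_pos[OF Dn_plin] intro: less_imp_le)
    have "s (Suc j) = tanh (\<alpha> j + \<tau>)" by (simp add: s_def \<alpha>_def algebra_simps)
    then have "D ((D ^^ j) A) y * D ((D ^^ j) B) y' \<le>
      (g\<^sup>2 / (\<Prod>i<j. \<bar>s i\<bar> ^ CARD('d))) / \<bar>s j\<bar> ^ CARD('d) *
      (D ((D ^^ j) B) (mix (s (Suc j)) y y') * D ((D ^^ j) A) (mix (s (Suc j)) y' y))"
      using Suc s_nz \<tau>(2) g nonneg
      by (intro swap_step[where \<alpha>="\<alpha> j" and s="s j" and \<tau>=\<tau>])
        (auto intro!: plin_bmp[OF Dn_plin] A B prod_nonneg divide_nonneg_nonneg simp: s_def)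
    then show ?case by simp
  qed
  have pos: "0 < (L ^^ N) A z" "0 < (L ^^ N) B z" for z using A B by (auto intro: Ln_pos)
  have "(D ^^ N) A x * (D ^^ N) B x' \<le>
      g\<^sup>2 / (\<Prod>i<N. \<bar>s i\<bar> ^ CARD('d)) * ((D ^^ N) B (mix \<sigma> x x') * (D ^^ N) A (mix \<sigma> x' x))"
    using main[OF x, of N] by (simp add: s0)
  \<comment> \<open>The restriction to the well is dropped on the right before moving the evaluation
    points, because \<open>slow\<close> is available for powers of \<open>L\<close> but not for
    powers of \<open>D\<close>.\<close>
  also have "\<dots> \<le> g\<^sup>2 / c ^ CARD('d) * (((L ^^ N) B x * g) * ((L ^^ N) A x' * g))"
  proof (intro mult_mono mult_nonneg_nonneg divide_left_mono)
    have "c ^ CARD('d) \<le> (\<Prod>i<N. \<bar>s i\<bar>) ^ CARD('d)"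
      using c by (intro power_mono) (auto simp: N_def s_def \<alpha>_def)
    then show "c ^ CARD('d) \<le> (\<Prod>i<N. \<bar>s i\<bar> ^ CARD('d))" by (simp add: prod_power_distrib)
    show "0 < (\<Prod>i<N. \<bar>s i\<bar> ^ CARD('d)) * c ^ CARD('d)"
      using c s_nz by (auto intro!: mult_pos_pos prod_pos)
    have "(D ^^ N) B (mix \<sigma> x x') \<le> (L ^^ N) B (mix \<sigma> x x')"
      using B by (intro Dn_le_Ln) (auto intro: less_imp_le)
    also have "\<dots> \<le> (L ^^ N) B x * g"
      using mix_near[OF x] B by (intro near Ln_slow Ln_pos) (auto simp: norm_minus_commute)
    finally show "(D ^^ N) B (mix \<sigma> x x') \<le> (L ^^ N) B x * g" .
    have "(D ^^ N) A (mix \<sigma> x' x) \<le> (L ^^ N) A (mix \<sigma> x' x)"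
      using A by (intro Dn_le_Ln) (auto intro: less_imp_le)
    also have "\<dots> \<le> (L ^^ N) A x' * g"
      using mix_near[OF x(2,1)] A by (intro near Ln_slow Ln_pos) (auto simp: norm_minus_commute)
    finally show "(D ^^ N) A (mix \<sigma> x' x) \<le> (L ^^ N) A x' * g" .
  qed (use A B g c pos in \<open>auto intro!: plin_pos[OF Dn_plin] divide_nonneg_nonneg prod_nonneg intro: less_imp_le\<close>)
  also have "\<dots> = g ^ 4 / c ^ CARD('d) * ((L ^^ N) B x * (L ^^ N) A x')"
    by (simp add: power2_eq_square power4_eq_xxxx)
  also have "g ^ 4 = exp (2 * ?d * r * (1 - \<sigma>) / \<nu>)"
    unfolding g_def exp_of_nat_mult[symmetric] using nu_pos by (simp add: field_simps)
  finally show ?thesis .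
qed

text \<open>Each path is translated into the well at 0 by its own lattice vector, which changes
  nothing since all functions involved are periodic. So the two paths need not be in wells around
  the same lattice point.\<close>

lemma window:
  assumes A: "bmp A" "\<And>x. 0 < A x" "slow A" and B: "bmp B" "\<And>x. 0 < B x" "slow B"
    and \<tau>: "0 < \<tau>" "(cosh \<tau>)\<^sup>2 \<le> 1 + \<kappa>"
    and c: "0 < c" "c \<le> (\<Prod>i<2 * J + 1. \<bar>tanh ((real i - real J - 1/2) * \<tau>)\<bar>)"
  defines "N \<equiv> 2 * J + 1" and "\<sigma> \<equiv> tanh ((real J + 1/2) * \<tau>)"
  shows "(D ^^ N) A x * (D ^^ N) B x' \<le>
    exp (2 * real CARD('d) * r * (1 - \<sigma>) / \<nu>) / c ^ CARD('d) * ((L ^^ N) B x * (L ^^ N) A x')"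
proof -
  have pos: "0 < (L ^^ N) A z" "0 < (L ^^ N) B z" for z using A B by (auto intro: Ln_pos)
  \<comment> \<open>At least one application of \<open>D\<close> is needed for this, and
    \<open>N\<close> is odd, hence positive.\<close>
  have zero: "(D ^^ N) u z = 0" if "\<And>k. k \<in> integer_lattice \<Longrightarrow> z \<notin> ball k r" for u z
  proof -
    have "same r z y = 0" for y using that by (auto simp: same_def)
    then have "D f z = 0" for f by (simp add: D_def opr_def)
    then show ?thesis by (simp add: N_def)
  qed
  have rhs: "0 \<le> exp (2 * real CARD('d) * r * (1 - \<sigma>) / \<nu>) / c ^ CARD('d) * ((L ^^ N) B x * (L ^^ N) A x')"
    using pos[of x'] pos[of x] c by (auto intro!: mult_nonneg_nonneg divide_nonneg_nonneg intro: less_imp_le)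
  show ?thesis
  proof (cases "\<exists>k l. k \<in> integer_lattice \<and> l \<in> integer_lattice \<and> x \<in> ball k r \<and> x' \<in> ball l r")
    case True
    then obtain k l where k: "k \<in> integer_lattice" "x \<in> ball k r" and l: "l \<in> integer_lattice" "x' \<in> ball l r" by blast
    have per: "f (z - m) = f z" if "bmp f" "m \<in> integer_lattice" for f and z m :: "real ^ 'd"
      using bmpD(2)[OF that(1) lattice_minus[OF that(2)], of z] by simp
    have x: "x - k \<in> ball 0 r" "x' - l \<in> ball 0 r" using k l by (auto simp: dist_norm norm_minus_commute)
    note per = per[OF plin_bmp[OF Dn_plin A(1)] k(1)] per[OF plin_bmp[OF Dn_plin B(1)] l(1)]
        per[OF plin_bmp[OF Ln_plin B(1)] k(1)] per[OF plin_bmp[OF Ln_plin A(1)] l(1)]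
    show ?thesis
      using window_well[OF A B \<tau> c x] unfolding N_def \<sigma>_def per .
  next
    case False
    then have "(D ^^ N) A x = 0 \<or> (D ^^ N) B x' = 0" using zero[of x A] zero[of x' B] by blast
    then show ?thesis using rhs by auto
  qed
qed

end

subsection \<open>The cross ratio estimate\<close>

text \<open>The parameters are meant to be fixed by \<open>F\<close> alone before \<nu> is chosen,
  so constants built from them are uniform in \<nu>. In \<open>a_lower\<close> the number
  \<open>a\<close> stands for the least weight kept per kick near the minimum.\<close>

locale kicked_estimates = kicked_well F \<nu> r \<kappa>
  for F :: "real ^ 'd \<Rightarrow> real" and \<nu> r \<kappa> +
  fixes a c1 FM :: real
  assumes a: "0 < a" "a \<le> 1"
    and a_lower: "\<And>f c x. bmp f \<Longrightarrow> (\<And>x. 0 \<le> f x) \<Longrightarrow> 0 \<le> c \<Longrightarrow>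
      (\<And>x. norm x \<le> sqrt \<nu> \<Longrightarrow> c \<le> f x) \<Longrightarrow> norm x \<le> sqrt \<nu> \<Longrightarrow> c * a \<le> L f x"
    and c1: "0 < c1" "\<And>z. (\<And>k. k \<in> integer_lattice \<Longrightarrow> z \<notin> ball k r) \<Longrightarrow> c1 \<le> F z"
    and FM: "\<And>x. F x \<le> FM"
begin

definition penalty :: real where "penalty = exp (min c1 (1 / 8) / (4 * \<nu>))"

text \<open>Tilted operator for a Chernoff-type bound: every excursion is counted with the factor
  \<open>penalty\<close>, the largest that \<open>opr_kick_root_le\<close> tolerates.\<close>

definition Lt :: "(real ^ 'd \<Rightarrow> real) \<Rightarrow> real ^ 'd \<Rightarrow> real" where
  "Lt = opr (\<lambda>x y. 1 * same r x y + penalty * (1 - same r x y))"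

lemma penalty_ge1: "1 \<le> penalty" using c1 nu_pos by (simp add: penalty_def)

lemma Lt_plin: "plin Lt" unfolding Lt_def using penalty_ge1 by (intro opr_plin weight_not_same) auto
lemma Ltn_plin: "plin (Lt ^^ n)" by (rule plin_funpow[OF Lt_plin])

lemma Lt_split: "bmp f \<Longrightarrow> Lt f x = D f x + penalty * E f x"
  using opr_weight_lin[OF weight_same[of r] weight_E, where a=1 and b=penalty] by (simp add: Lt_def D_def E_def)

lemma Lt_kick_root: "(Lt ^^ n) kick_root x \<le> gauss_ratio ^ n * kick_root x"
proof (induction n arbitrary: x)
  case (Suc n)
  have "Lt ((Lt ^^ n) kick_root) x \<le> Lt (\<lambda>x. gauss_ratio ^ n * kick_root x) x"
    using Suc by (intro plin_mono[OF Lt_plin] plin_bmp[OF Ltn_plin] bmp_scale bmp_kick_root)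
  also have "\<dots> = gauss_ratio ^ n * Lt kick_root x" by (simp add: plin_scale[OF Lt_plin bmp_kick_root])
  also have "\<dots> \<le> gauss_ratio ^ n * (gauss_ratio * kick_root x)"
    using opr_kick_root_le[OF c1(2) r(2), of penalty x] penalty_ge1 gauss_ratio_ge1
    by (intro mult_left_mono) (auto simp: Lt_def penalty_def)
  finally show ?case by (simp add: mult_ac)
qed simp

lemma Ln_le_Ltn: "bmp f \<Longrightarrow> (\<And>x. 0 \<le> f x) \<Longrightarrow> (L ^^ n) f x \<le> (Lt ^^ n) f x"
proof (induction n arbitrary: x)
  case (Suc n)
  have b: "bmp ((Lt ^^ n) f)" using Suc by (intro plin_bmp[OF Ltn_plin])
  have "L ((L ^^ n) f) x \<le> L ((Lt ^^ n) f) x"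
    using Suc b by (intro plin_mono[OF L_plin]) (auto intro: plin_bmp[OF Ln_plin])
  also have "\<dots> = D ((Lt ^^ n) f) x + 1 * E ((Lt ^^ n) f) x" using L_split[OF b] by simp
  also have "\<dots> \<le> Lt ((Lt ^^ n) f) x"
    unfolding Lt_split[OF b] using Suc penalty_ge1 b
    by (intro add_left_mono mult_right_mono plin_pos[OF E_plin]) (auto intro: plin_pos[OF Ltn_plin])
  finally show ?case by simp
qed simp

text \<open>The contribution of paths with at least one excursion in \<open>n\<close> kicks.\<close>

definition Rn :: "nat \<Rightarrow> (real ^ 'd \<Rightarrow> real) \<Rightarrow> real ^ 'd \<Rightarrow> real" where
  "Rn n f x = (L ^^ n) f x - (D ^^ n) f x"

lemma Rn_plin: "plin (Rn n)"
  unfolding plin_def Rn_def[abs_def]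
  using Dn_le_Ln
  by (auto intro!: bmp_diff plin_bmp[OF Ln_plin] plin_bmp[OF Dn_plin]
      simp: plin_lin[OF Ln_plin] plin_lin[OF Dn_plin] algebra_simps)

text \<open>The Markov inequality for the tilted operator: a path with at least one excursion
  carries at least one factor \<open>penalty\<close> in \<open>Lt\<close>.\<close>

lemma Rn_le: "bmp f \<Longrightarrow> (\<And>x. 0 \<le> f x) \<Longrightarrow> penalty * Rn n f x \<le> (Lt ^^ n) f x - (D ^^ n) f x"
proof (induction n arbitrary: x)
  case (Suc n)
  note bm = plin_bmp[OF Ln_plin Suc.prems(1), of n] plin_bmp[OF Dn_plin Suc.prems(1), of n]
    plin_bmp[OF Ltn_plin Suc.prems(1), of n]
  have "D (\<lambda>x. penalty * ((L ^^ n) f x - (D ^^ n) f x)) x = penalty * (D ((L ^^ n) f) x - D ((D ^^ n) f) x)"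
    unfolding plin_scale[OF D_plin bmp_diff[OF bm(1,2)], of penalty] plin_diff[OF D_plin bm(1,2)] ..
  \<comment> \<open>Either the outermost kick is an excursion and the rest is arbitrary, or it is
    not and an excursion occurs later.\<close>
  then have "penalty * Rn (Suc n) f x = penalty * E ((L ^^ n) f) x + D (\<lambda>x. penalty * ((L ^^ n) f x - (D ^^ n) f x)) x"
    using bm by (simp add: Rn_def L_split algebra_simps)
  also have "\<dots> \<le> penalty * E ((Lt ^^ n) f) x + D (\<lambda>x. (Lt ^^ n) f x - (D ^^ n) f x) x"
  proof (intro add_mono mult_left_mono)
    show "E ((L ^^ n) f) x \<le> E ((Lt ^^ n) f) x"
      using Suc.prems by (intro plin_mono[OF E_plin] bm Ln_le_Ltn)
    show "D (\<lambda>x. penalty * ((L ^^ n) f x - (D ^^ n) f x)) x \<le> D (\<lambda>x. (Lt ^^ n) f x - (D ^^ n) f x) x"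
      using Suc by (intro plin_mono[OF D_plin] bmp_scale bmp_diff bm) (auto simp: Rn_def)
  qed (use penalty_ge1 in auto)
  also have "\<dots> = (Lt ^^ Suc n) f x - (D ^^ Suc n) f x"
    using bm by (simp add: Lt_split plin_diff[OF D_plin])
  finally show ?case .
qed (simp add: Rn_def)

lemma Ln_kick_root: "(L ^^ n) kick_root x \<le> gauss_ratio ^ n * kick_root x"
  using Ln_le_Ltn[of kick_root n x] Lt_kick_root[of n x] kick_root_ge1 bmp_kick_root by (auto intro: order_trans less_imp_le simp: order_trans[OF zero_le_one])

lemma Rn_kick_root: "Rn n kick_root x \<le> gauss_ratio ^ n * kick_root x / penalty"
proof -
  have kr0: "0 \<le> kick_root x" for x using kick_root_ge1[of x] by linarith
  have "penalty * Rn n kick_root x \<le> gauss_ratio ^ n * kick_root x"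
    using Rn_le[OF bmp_kick_root kr0, of n x] Lt_kick_root[of n x] plin_pos[OF Dn_plin bmp_kick_root kr0, of n x] by linarith
  then show ?thesis using penalty_ge1 by (simp add: field_simps)
qed

definition nice :: "(real ^ 'd \<Rightarrow> real) \<Rightarrow> bool" where
  "nice u \<longleftrightarrow> bmp u \<and> (\<forall>x. 0 < u x) \<and> slow u"

lemma niceD: "nice u \<Longrightarrow> bmp u" "nice u \<Longrightarrow> 0 < u x" "nice u \<Longrightarrow> slow u"
  by (auto simp: nice_def)

lemma nice_Ln: "nice u \<Longrightarrow> nice ((L ^^ n) u)"
  by (auto simp: nice_def intro: plin_bmp[OF Ln_plin] Ln_pos Ln_slow)

lemma nice_L: "bmp u \<Longrightarrow> (\<And>x. 0 < u x) \<Longrightarrow> nice (L u)"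
  by (auto simp: nice_def intro: plin_bmp[OF L_plin] L_pos L_slow)

text \<open>Among \<open>m\<close> successive blocks of \<open>N\<close> kicks, either some block keeps both paths in one well,
  where tails can be exchanged at cost \<open>\<Gamma>\<close>, or each block contains an excursion,
  which is penalised by a factor \<open>1 / penalty\<close>.\<close>

lemma blocks:
  assumes win: "\<And>A B x x'. nice A \<Longrightarrow> nice B \<Longrightarrow>
      (D ^^ N) A x * (D ^^ N) B x' \<le> \<Gamma> * ((L ^^ N) B x * (L ^^ N) A x')"
    and \<Gamma>: "0 \<le> \<Gamma>" and u: "nice u" and v: "nice v"
    and uv: "\<And>x. u x \<le> su" "\<And>x. v x \<le> sv"
  shows "(L ^^ (N * m)) u x * (L ^^ (N * m)) v y \<le>
    real m * \<Gamma> * ((L ^^ (N * m)) v x * (L ^^ (N * m)) u y)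
    + su * sv * (2 * gauss_ratio ^ (2 * N) / penalty) ^ m * (kick_root x * kick_root y)"
proof (induction m arbitrary: x y)
  case 0
  have "0 \<le> su" "0 \<le> sv" using uv(1)[of x] uv(2)[of x] niceD(2)[OF u, of x] niceD(2)[OF v, of x] by linarith+
  have "u x * v y * 1 \<le> su * sv * (kick_root x * kick_root y)"
    using uv niceD(2)[OF u] niceD(2)[OF v] \<open>0 \<le> su\<close> \<open>0 \<le> sv\<close> mult_mono[OF kick_root_ge1[of x] kick_root_ge1[of y]] kick_root_ge1[of x]
    by (intro mult_mono) (auto intro: less_imp_le)
  then show ?case by simp
next
  case (Suc m)
  define A B where "A = (L ^^ (N * m)) u" "B = (L ^^ (N * m)) v"
  define c e where "c = real m * \<Gamma>" "e = su * sv * (2 * gauss_ratio ^ (2 * N) / penalty) ^ m"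
  have "0 \<le> su" "0 \<le> sv" using uv(1)[of x] uv(2)[of x] niceD(2)[OF u, of x] niceD(2)[OF v, of x] by linarith+
  then have e0: "0 \<le> e" using penalty_ge1 gauss_ratio_ge1 by (auto simp: c_e_def intro!: mult_nonneg_nonneg)
  have c0: "0 \<le> c" using \<Gamma> by (simp add: c_e_def)
  have AB: "nice A" "nice B" unfolding A_B_def by (auto intro: nice_Ln u v)
  note bm = niceD(1)[OF AB(1)] niceD(1)[OF AB(2)]
  have pw: "(L ^^ (N * Suc m)) u = (L ^^ N) A" "(L ^^ (N * Suc m)) v = (L ^^ N) B"
    unfolding A_B_def by (simp_all add: funpow_add)
  have kr0: "0 \<le> kick_root x" for x using kick_root_ge1[of x] by linarith
  have pos: "0 \<le> (L ^^ N) A z" "0 \<le> (L ^^ N) B z" "0 \<le> (D ^^ N) A z" "0 \<le> (D ^^ N) B z" "0 \<le> Rn N A z" "0 \<le> Rn N B z" for z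
    using niceD(2)[OF AB(1)] niceD(2)[OF AB(2)]
    by (auto intro!: plin_pos[OF Ln_plin] plin_pos[OF Dn_plin] plin_pos[OF Rn_plin] bm intro: less_imp_le)
  have IH: "A x * B y \<le> c * (B x * A y) + e * (kick_root x * kick_root y)" for x y
    using Suc by (simp add: A_B_def c_e_def)
  have 1: "Rn N A x * (L ^^ N) B y \<le> c * (Rn N B x * (L ^^ N) A y) + e * (Rn N kick_root x * (L ^^ N) kick_root y)"
    by (intro plin_tensor[OF Rn_plin Ln_plin] bm bmp_kick_root IH)
  have 2: "(D ^^ N) A x * Rn N B y \<le> c * ((D ^^ N) B x * Rn N A y) + e * ((D ^^ N) kick_root x * Rn N kick_root y)"
    by (intro plin_tensor[OF Dn_plin Rn_plin] bm bmp_kick_root IH)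
  have "Rn N kick_root x * (L ^^ N) kick_root y \<le> (gauss_ratio ^ N * kick_root x / penalty) * (gauss_ratio ^ N * kick_root y)"
    using Rn_kick_root[of N x] Ln_kick_root[of N y] gauss_ratio_ge1 penalty_ge1 kr0
    by (intro mult_mono) (auto intro!: plin_pos[OF Ln_plin] bmp_kick_root)
  moreover have "(D ^^ N) kick_root x * Rn N kick_root y \<le> (gauss_ratio ^ N * kick_root x) * (gauss_ratio ^ N * kick_root y / penalty)"
    using Rn_kick_root[of N y] order_trans[OF Dn_le_Ln[OF bmp_kick_root kr0] Ln_kick_root, of N x] gauss_ratio_ge1 penalty_ge1 kr0
    by (intro mult_mono) (auto intro!: plin_pos[OF Rn_plin] bmp_kick_root)
  ultimately have ef: "Rn N kick_root x * (L ^^ N) kick_root y + (D ^^ N) kick_root x * Rn N kick_root y \<le> 2 * gauss_ratio ^ (2 * N) / penalty * (kick_root x * kick_root y)"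
    unfolding mult_2 power_add by (simp add: field_simps)
  \<comment> \<open>The two excursion events are disjoint, so their weights recombine to at most the
    full product. This makes the coefficient grow additively, by \<open>\<Gamma>\<close> per block,
    and not geometrically.\<close>
  have "Rn N B x * (L ^^ N) A y + (D ^^ N) B x * Rn N A y \<le> Rn N B x * (L ^^ N) A y + (D ^^ N) B x * (L ^^ N) A y"
    using pos by (intro add_left_mono mult_left_mono) (auto simp: Rn_def)
  also have "\<dots> = (L ^^ N) B x * (L ^^ N) A y" by (simp add: Rn_def algebra_simps)
  finally have cf: "Rn N B x * (L ^^ N) A y + (D ^^ N) B x * Rn N A y \<le> (L ^^ N) B x * (L ^^ N) A y" .
  \<comment> \<open>Three disjoint cases: no excursion at all, one of the first path, or one of the
    second path only.\<close>
  have "(L ^^ N) A x * (L ^^ N) B y = (D ^^ N) A x * (D ^^ N) B y + Rn N A x * (L ^^ N) B y + (D ^^ N) A x * Rn N B y"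
    by (simp add: Rn_def algebra_simps)
  also have "\<dots> \<le> \<Gamma> * ((L ^^ N) B x * (L ^^ N) A y)
      + c * (Rn N B x * (L ^^ N) A y + (D ^^ N) B x * Rn N A y)
      + e * (Rn N kick_root x * (L ^^ N) kick_root y + (D ^^ N) kick_root x * Rn N kick_root y)"
    using win[OF AB, of x y] 1 2 by (simp add: algebra_simps)
  also have "\<dots> \<le> \<Gamma> * ((L ^^ N) B x * (L ^^ N) A y) + c * ((L ^^ N) B x * (L ^^ N) A y)
      + e * (2 * gauss_ratio ^ (2 * N) / penalty * (kick_root x * kick_root y))"
    using cf ef c0 e0 by (intro add_mono mult_left_mono order_refl)
  finally show ?case unfolding pw by (simp add: c_e_def algebra_simps)
qed

text \<open>A path may move to the minimum, stay within \<open>sqrt \<nu>\<close> of it and leave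
  again. The two moves are paid by the a priori oscillation, once at either end; the stay costs
  \<open>a\<close> per kick.\<close>

lemma nice_lower:
  assumes u: "nice u"
  shows "a ^ n * u 0 * exp (- 2 * (real CARD('d))\<^sup>2 / (2 * \<nu>)) \<le> (L ^^ n) u x"
proof -
  define q where "q = exp (- (real CARD('d))\<^sup>2 / (2 * \<nu>))"
  have osc: "v y * q \<le> v x" if "nice v" for v x y
    using slow_osc[OF niceD(3)[OF that] niceD(1)[OF that] niceD(2)[OF that], of y x]
    by (simp add: q_def exp_minus field_simps)
  have "(u 0 * q) * a ^ n \<le> (L ^^ n) u x" if "norm x \<le> sqrt \<nu>" for x
    using that
  proof (induction n arbitrary: x)
    case 0 then show ?case using osc[OF u] by simp
  next
    case (Suc n)
    have "(u 0 * q * a ^ n) * a \<le> L ((L ^^ n) u) x"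
      using Suc niceD(2)[OF u, of 0] a niceD(2)[OF nice_Ln[OF u]]
      by (intro a_lower) (auto intro: less_imp_le niceD(1)[OF nice_Ln[OF u]] simp: q_def)
    then show ?case by (simp add: mult_ac)
  qed
  from this[of 0] have "(u 0 * q * a ^ n) * q \<le> (L ^^ n) u 0 * q"
    using nu_pos by (intro mult_right_mono) (auto simp: q_def)
  also have "\<dots> \<le> (L ^^ n) u x" by (rule osc[OF nice_Ln[OF u]])
  also have "(u 0 * q * a ^ n) * q = a ^ n * u 0 * (q * q)" by simp
  also have "q * q = exp (- 2 * (real CARD('d))\<^sup>2 / (2 * \<nu>))"
    unfolding q_def exp_add[symmetric] using nu_pos by (simp add: field_simps)
  finally show ?thesis .
qed

text \<open>The assumption on \<open>m\<close> makes \<open>m\<close> excursions cheaper than all a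
  priori losses together, so the error term of \<open>blocks\<close> is at most half of the
  left-hand side and can be absorbed. This accounts for the factor 2.\<close>

lemma cross_ratio_blocks:
  assumes win: "\<And>A B x x'. nice A \<Longrightarrow> nice B \<Longrightarrow>
      (D ^^ N) A x * (D ^^ N) B x' \<le> \<Gamma> * ((L ^^ N) B x * (L ^^ N) A x')"
    and \<Gamma>: "0 \<le> \<Gamma>" and u: "nice u" and v: "nice v"
    and m: "3 * (real CARD('d))\<^sup>2 + FM / 2 + 1 \<le> real m * min c1 (1 / 8) / 4"
    and n: "2 * 2 ^ m * (gauss_ratio / a) ^ (2 * N * m) \<le> exp (1 / \<nu>)"
  shows "(L ^^ (N * m)) u x * (L ^^ (N * m)) v y \<le>
    2 * real m * \<Gamma> * ((L ^^ (N * m)) v x * (L ^^ (N * m)) u y)"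
proof -
  define d2 where "d2 = (real CARD('d))\<^sup>2"
  define q where "q = exp (d2 / (2 * \<nu>))"
  have q: "q > 0" by (simp add: q_def)
  define w where "w = gauss_ratio ^ (2 * N * m)"
  define ta where "ta = a ^ (N * m)"
  have pos: "0 < u 0" "0 < v 0" "0 < ta" "0 < w" using niceD(2) u v a gauss_ratio_ge1 by (auto simp: ta_def w_def)
  have sup: "z x \<le> z 0 * q" if "nice z" for z x
    using slow_osc[OF niceD(3)[OF that] niceD(1)[OF that] niceD(2)[OF that], of x 0] by (simp add: q_def d2_def)
  have low: "ta * z 0 / q\<^sup>2 \<le> (L ^^ (N * m)) z x" if "nice z" for z x
    using nice_lower[OF that, of "N * m" x] unfolding d2_def[symmetric] ta_def[symmetric] q_def
    by (simp add: exp_minus exp_of_nat_mult[symmetric] field_simps)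
  have fb: "kick_root x \<le> exp (FM / (4 * \<nu>))" for x using FM[of x] nu_pos by (simp add: kick_root_def divide_right_mono)
  have "kick_root x * kick_root y \<le> exp (FM / (4 * \<nu>)) * exp (FM / (4 * \<nu>))"
    using fb kick_root_ge1[of y] by (intro mult_mono) auto
  also have "\<dots> = exp (FM / 2 / \<nu>)" unfolding exp_add[symmetric] using nu_pos by (simp add: field_simps)
  finally have fxy: "kick_root x * kick_root y \<le> exp (FM / 2 / \<nu>)" .
  \<comment> \<open>The power 6 collects two factors \<open>q\<close> from the upper bounds on
    \<open>u\<close>, \<open>v\<close> and four from the lower bounds on their images; it is the
    term \<open>3 * (real CARD('d))\<^sup>2\<close> in the choice of \<open>m\<close>. The summand 1
    there pays for the prefactors through \<open>n\<close>.\<close>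
  have key: "2 * (2 ^ m * w) * q ^ 6 * exp (FM / 2 / \<nu>) \<le> ta\<^sup>2 * penalty ^ m"
  proof -
    have "2 * 2 ^ m * w = ta\<^sup>2 * (2 * 2 ^ m * (gauss_ratio / a) ^ (2 * N * m))"
      using a by (simp add: w_def ta_def power_divide power_mult[symmetric] power_mult_distrib mult_ac)
    also have "\<dots> \<le> ta\<^sup>2 * exp (1 / \<nu>)" using n by (intro mult_left_mono) auto
    finally have "2 * 2 ^ m * w * (q ^ 6 * exp (FM / 2 / \<nu>)) \<le> ta\<^sup>2 * exp (1 / \<nu>) * (q ^ 6 * exp (FM / 2 / \<nu>))"
      using q by (intro mult_right_mono) auto
    also have "\<dots> = ta\<^sup>2 * exp ((3 * d2 + FM / 2 + 1) / \<nu>)"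
      unfolding q_def exp_of_nat_mult[symmetric] using nu_pos
      by (simp add: mult_exp_exp add_divide_distrib algebra_simps)
    also have "\<dots> \<le> ta\<^sup>2 * exp ((real m * min c1 (1 / 8) / 4) / \<nu>)"
      using divide_right_mono[OF m less_imp_le[OF nu_pos]] unfolding d2_def
      by (intro mult_left_mono) (simp_all only: exp_le_cancel_iff zero_le_power2)
    also have "exp ((real m * min c1 (1 / 8) / 4) / \<nu>) = penalty ^ m"
      unfolding penalty_def exp_of_nat_mult[symmetric] by (simp add: mult_ac)
    finally show ?thesis by (simp add: mult_ac)
  qed
  have "(u 0 * q) * (v 0 * q) * (2 * gauss_ratio ^ (2 * N) / penalty) ^ m * (kick_root x * kick_root y) \<le>
      (u 0 * q) * (v 0 * q) * (2 * gauss_ratio ^ (2 * N) / penalty) ^ m * exp (FM / 2 / \<nu>)"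
    using fxy pos q gauss_ratio_ge1 penalty_ge1 by (intro mult_left_mono) auto
  also have pm: "(2 * gauss_ratio ^ (2 * N) / penalty) ^ m = 2 ^ m * w / penalty ^ m"
    by (simp add: w_def power_divide power_mult_distrib power_mult[symmetric])
  also have "(u 0 * q) * (v 0 * q) * (2 ^ m * w / penalty ^ m) * exp (FM / 2 / \<nu>)
      = (u 0 * v 0 / (2 * q ^ 4 * penalty ^ m)) * (2 * (2 ^ m * w) * q ^ 6 * exp (FM / 2 / \<nu>))"
    using q penalty_ge1 by (simp add: field_simps power_numeral_reduce)
  also have "\<dots> \<le> (u 0 * v 0 / (2 * q ^ 4 * penalty ^ m)) * (ta\<^sup>2 * penalty ^ m)"
    using key pos q penalty_ge1 by (intro mult_left_mono) auto
  also have "\<dots> = ((ta * u 0 / q\<^sup>2) * (ta * v 0 / q\<^sup>2)) / 2"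
    using q penalty_ge1 by (simp add: field_simps power_numeral_reduce)
  also have "\<dots> \<le> (L ^^ (N * m)) u x * (L ^^ (N * m)) v y / 2"
    using low[OF u, of x] low[OF v, of y] pos q niceD(2)[OF nice_Ln[OF u], of "N * m" x]
    by (intro divide_right_mono mult_mono) auto
  finally have "(u 0 * q) * (v 0 * q) * (2 * gauss_ratio ^ (2 * N) / penalty) ^ m * (kick_root x * kick_root y)
     \<le> (L ^^ (N * m)) u x * (L ^^ (N * m)) v y / 2" by (simp only: pm)
  with blocks[OF win \<Gamma> u v sup[OF u] sup[OF v], of m x y] show ?thesis by simp
qed

text \<open>The time is cut into \<open>m\<close> blocks of odd length close to
  \<open>n / m\<close>. The defect \<open>1 - \<sigma>\<close> of the exchange is exponentially
  small in the block length, hence the rate \<open>\<tau> / m\<close>. Of the two terms in the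
  exponent, the first comes from this defect and the second only covers times too short for a
  block.\<close>

lemma cross_ratio:
  assumes \<tau>: "0 < \<tau>" "(cosh \<tau>)\<^sup>2 \<le> 1 + \<kappa>"
    and c: "0 < c" "\<And>J. c \<le> (\<Prod>i<2 * J + 1. \<bar>tanh ((real i - real J - 1/2) * \<tau>)\<bar>)"
    and m: "3 * (real CARD('d))\<^sup>2 + FM / 2 + 1 \<le> real m * min c1 (1 / 8) / 4"
    and n: "2 * 2 ^ m * (gauss_ratio / a) ^ (2 * n) \<le> exp (1 / \<nu>)"
    and u: "nice u" and v: "nice v"
  shows "(L ^^ n) u x * (L ^^ n) v y \<le>
     (2 * real m / c ^ CARD('d)) * exp ((8 * real CARD('d) * r * exp (2 * \<tau>) + 2 * (real CARD('d))\<^sup>2 * exp \<tau>)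
       * exp (- (\<tau> / real m) * real n) / (2 * \<nu>)) * ((L ^^ n) v x * (L ^^ n) u y)"
proof -
  let ?d = "real CARD('d)"
  define B where "B = 8 * ?d * r * exp (2 * \<tau>) + 2 * ?d\<^sup>2 * exp \<tau>"
  have FM0: "0 \<le> FM" using FM[of 0] F_nonneg[of 0] by linarith
  have m0: "m > 0"
  proof (rule ccontr)
    assume "\<not> m > 0"
    then have "3 * ?d\<^sup>2 + FM / 2 + 1 \<le> 0" using m by simp
    then show False using FM0 zero_le_power2[of ?d] by linarith
  qed
  have c_le1: "c \<le> 1" using c(2)[of 0] tanh_real_lt_1[of "\<tau> / 2"] tanh_real_gt_neg1[of "\<tau> / 2"] by simp
  then have cd: "c ^ CARD('d) \<le> 1" "0 < c ^ CARD('d)" using c(1) by (auto simp: power_le_one)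
  have K1: "1 \<le> 2 * real m / c ^ CARD('d)" using m0 cd by (simp add: field_simps)
  have posL: "0 < (L ^^ k) w z" if "nice w" for k w z using niceD(2)[OF nice_Ln[OF that]] .
  define X where "X = (L ^^ n) v x * (L ^^ n) u y"
  have X: "0 \<le> X" using posL[OF u] posL[OF v] by (simp add: X_def less_imp_le)
  show ?thesis
  proof (cases "n < m")
    case True
    have "(L ^^ n) u x * (L ^^ n) v y \<le>
        ((L ^^ n) u y * exp (?d\<^sup>2 / (2 * \<nu>))) * ((L ^^ n) v x * exp (?d\<^sup>2 / (2 * \<nu>)))"
      using nice_Ln[OF u, of n] nice_Ln[OF v, of n] posL[OF u] posL[OF v]
      by (intro mult_mono slow_osc) (auto simp: nice_def intro: less_imp_le mult_nonneg_nonneg)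
    also have "\<dots> = exp (2 * ?d\<^sup>2 / (2 * \<nu>)) * X"
      by (simp add: X_def mult_exp_exp field_simps)
    also have "\<dots> \<le> exp (B * exp (- (\<tau> / real m) * real n) / (2 * \<nu>)) * X"
    proof -
      \<comment> \<open>For \<open>n < m\<close> the decay factor is still at least
        \<open>exp (- \<tau>)\<close>, so the a priori oscillation bound is enough.\<close>
      have "\<tau> / real m * real n \<le> \<tau>" using True m0 \<tau> by (simp add: field_simps)
      then have "exp (- \<tau>) \<le> exp (- (\<tau> / real m) * real n)" by simp
      then have "B * exp (- \<tau>) \<le> B * exp (- (\<tau> / real m) * real n)"
        using r by (intro mult_left_mono) (auto simp: B_def)
      moreover have "2 * ?d\<^sup>2 \<le> B * exp (- \<tau>)"
        using r by (simp add: B_def distrib_right mult.assoc mult_exp_exp)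
      ultimately have "2 * ?d\<^sup>2 / (2 * \<nu>) \<le> B * exp (- (\<tau> / real m) * real n) / (2 * \<nu>)"
        using nu_pos by (intro divide_right_mono) auto
      then show ?thesis using X by (intro mult_right_mono) auto
    qed
    also have "\<dots> = 1 * (exp (B * exp (- (\<tau> / real m) * real n) / (2 * \<nu>)) * X)" by simp
    also have "\<dots> \<le> (2 * real m / c ^ CARD('d)) * (exp (B * exp (- (\<tau> / real m) * real n) / (2 * \<nu>)) * X)"
      using K1 X by (intro mult_right_mono) auto
    finally show ?thesis by (simp add: X_def B_def)
  next
    case False
    \<comment> \<open>Makes \<open>N = 2 * J + 1\<close> the largest odd number not exceeding
      \<open>n div m\<close>. The loss by rounding is at most two kicks per block, which is the
      source of \<open>exp (2 * \<tau>)\<close>.\<close>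
    define J where "J = (n div m - 1) div 2"
    define N where "N = 2 * J + 1"
    have q1: "n div m \<ge> 1" using False m0 by (simp add: div_greater_zero_iff Suc_le_eq)
    have Nle: "N \<le> n div m" "n div m \<le> N + 1" using q1 by (auto simp: N_def J_def)
    have Nm: "N * m \<le> n" using Nle(1) m0 by (simp add: less_eq_div_iff_mult_less_eq)
    have "n \<le> (n div m) * m + m" using m0
      by (metis add_le_mono div_mult_mod_eq le_refl less_imp_le mod_less_divisor)
    also have "\<dots> \<le> (N + 2) * m" 
      using mult_le_mono1[of "n div m + 1" "N + 2" m] Nle(2) by (simp add: add_mult_distrib)
    finally have "real n \<le> (real N + 2) * real m" by (metis of_nat_add of_nat_le_iff of_nat_mult of_nat_numeral)
    then have nN: "\<tau> / real m * real n \<le> \<tau> * (real N + 2)"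
      using mult_left_mono[OF \<open>real n \<le> _\<close> less_imp_le[OF \<tau>(1)]] m0 by (simp add: field_simps)
    define \<sigma> where "\<sigma> = tanh ((real J + 1/2) * \<tau>)"
    define \<Gamma> where "\<Gamma> = exp (2 * ?d * r * (1 - \<sigma>) / \<nu>) / c ^ CARD('d)"
    have "1 - \<sigma> = 2 * exp (- (real N * \<tau>)) / (1 + exp (- (real N * \<tau>)))"
      unfolding \<sigma>_def tanh_real_altdef N_def
      by (simp add: field_simps add_pos_pos[THEN less_imp_neq, symmetric])
    also have "\<dots> \<le> 2 * exp (- (real N * \<tau>)) / 1" by (intro divide_left_mono) (auto intro: add_pos_pos)
    also have "exp (- (real N * \<tau>)) \<le> exp (2 * \<tau>) * exp (- (\<tau> / real m) * real n)"
      using nN by (simp add: mult_exp_exp algebra_simps)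
    finally have "1 - \<sigma> \<le> 2 * (exp (2 * \<tau>) * exp (- (\<tau> / real m) * real n))" by simp
    then have "4 * ?d * r * (1 - \<sigma>) \<le> 4 * ?d * r * (2 * (exp (2 * \<tau>) * exp (- (\<tau> / real m) * real n)))"
      using r by (intro mult_left_mono) auto
    also have "\<dots> \<le> B * exp (- (\<tau> / real m) * real n)" by (simp add: B_def algebra_simps)
    finally have "4 * ?d * r * (1 - \<sigma>) / (2 * \<nu>) \<le> B * exp (- (\<tau> / real m) * real n) / (2 * \<nu>)"
      using nu_pos by (intro divide_right_mono) auto
    moreover have "4 * ?d * r * (1 - \<sigma>) / (2 * \<nu>) = 2 * ?d * r * (1 - \<sigma>) / \<nu>" using nu_pos by simp
    ultimately have \<Gamma>_le: "\<Gamma> \<le> exp (B * exp (- (\<tau> / real m) * real n) / (2 * \<nu>)) / c ^ CARD('d)"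
      unfolding \<Gamma>_def using cd by (intro divide_right_mono) auto
    have \<Gamma>0: "0 \<le> \<Gamma>" using cd by (simp add: \<Gamma>_def)
    have ba: "1 \<le> gauss_ratio / a" using a gauss_ratio_ge1 by (simp add: field_simps)
    have "2 * 2 ^ m * (gauss_ratio / a) ^ (2 * N * m) \<le> 2 * 2 ^ m * (gauss_ratio / a) ^ (2 * n)"
      using Nm ba by (intro mult_left_mono power_increasing) auto
    with n have n': "2 * 2 ^ m * (gauss_ratio / a) ^ (2 * N * m) \<le> exp (1 / \<nu>)" by linarith
    \<comment> \<open>The kicks that do not fill a block are absorbed into the data.\<close>
    define u' v' where "u' = (L ^^ (n - N * m)) u" "v' = (L ^^ (n - N * m)) v"
    have pw: "(L ^^ n) w = (L ^^ (N * m)) ((L ^^ (n - N * m)) w)" for w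
      using Nm funpow_add[of "N * m" "n - N * m" L] by simp
    have "(L ^^ (N * m)) u' x * (L ^^ (N * m)) v' y \<le>
        2 * real m * \<Gamma> * ((L ^^ (N * m)) v' x * (L ^^ (N * m)) u' y)"
    proof (rule cross_ratio_blocks[OF _ \<Gamma>0 _ _ m n'])
      fix A B x x' assume AB: "nice A" "nice B"
      show "(D ^^ N) A x * (D ^^ N) B x' \<le> \<Gamma> * ((L ^^ N) B x * (L ^^ N) A x')"
        unfolding N_def \<Gamma>_def \<sigma>_def
        by (rule window[OF _ _ _ _ _ _ \<tau> c]) (use AB in \<open>auto simp: nice_def\<close>)
    qed (auto simp: u'_v'_def intro: nice_Ln u v)
    then have "(L ^^ n) u x * (L ^^ n) v y \<le> (2 * real m * \<Gamma>) * X"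
      by (simp add: X_def pw u'_v'_def)
    also have "\<dots> \<le> (2 * real m * (exp (B * exp (- (\<tau> / real m) * real n) / (2 * \<nu>)) / c ^ CARD('d))) * X"
      using \<Gamma>_le X by (intro mult_right_mono mult_left_mono) auto
    finally show ?thesis by (simp add: X_def B_def)
  qed
qed

end

subsection \<open>Spectral gap\<close>

lemma nn_integral_cube_sum:
  "(\<integral>\<^sup>+k. indicator cube (x - k) \<partial>count_space integer_lattice) = 1"
proof -
  have "(\<integral>\<^sup>+k. indicator cube (x - k) \<partial>count_space integer_lattice) =
     (\<integral>\<^sup>+k. indicator {nearest x} k \<partial>count_space integer_lattice)"
    by (intro nn_integral_cong) (auto simp: indicator_def cube_shift_iff)
  then show ?thesis by (simp add: nn_integral_indicator)
qed

lemma nn_integral_cube_sum':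
  "(\<integral>\<^sup>+k. indicator cube (x + k) \<partial>count_space integer_lattice) = 1"
proof -
  have "x + k \<in> cube \<longleftrightarrow> k = - nearest x" if "k \<in> integer_lattice" for k
    using cube_shift_iff[OF lattice_minus[OF that], of x] unfolding equation_minus_iff[of k] by (simp add: eq_commute)
  then have "(\<integral>\<^sup>+k. indicator cube (x + k) \<partial>count_space integer_lattice) =
     (\<integral>\<^sup>+k. indicator {- nearest x} k \<partial>count_space integer_lattice)"
    by (intro nn_integral_cong) (auto simp: indicator_def)
  then show ?thesis using lattice_minus[OF nearest_in_lattice[of x]] by (simp add: nn_integral_indicator)
qed

text \<open>The free variable is distributed over the translates of the cube, and on each translate
  both variables are shifted back together. For a kernel invariant under simultaneous shifts this
  interchanges the restricted and the free variable.\<close>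

lemma mass_transport:
  fixes \<Phi> :: "real ^ 'd \<Rightarrow> real ^ 'd \<Rightarrow> ennreal"
  assumes [measurable]: "case_prod \<Phi> \<in> borel_measurable (borel \<Otimes>\<^sub>M borel)"
    and inv: "\<And>k x y. k \<in> integer_lattice \<Longrightarrow> \<Phi> (x + k) (y + k) = \<Phi> x y"
  shows "(\<integral>\<^sup>+x. indicator cube x * (\<integral>\<^sup>+y. \<Phi> x y \<partial>lborel) \<partial>lborel) =
    (\<integral>\<^sup>+y. indicator cube y * (\<integral>\<^sup>+x. \<Phi> x y \<partial>lborel) \<partial>lborel)"
proof -
  let ?C = "count_space (integer_lattice :: (real ^ 'd) set)"
  have "(\<integral>\<^sup>+x. indicator cube x * (\<integral>\<^sup>+y. \<Phi> x y \<partial>lborel) \<partial>lborel) =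
     (\<integral>\<^sup>+x. \<integral>\<^sup>+y. \<integral>\<^sup>+k. indicator cube (y - k) * (indicator cube x * \<Phi> x y) \<partial>?C \<partial>lborel \<partial>lborel)"
    by (simp add: nn_integral_multc nn_integral_cube_sum nn_integral_cmult)
  also have "\<dots> = (\<integral>\<^sup>+x. \<integral>\<^sup>+k. \<integral>\<^sup>+y. indicator cube (y - k) * (indicator cube x * \<Phi> x y) \<partial>lborel \<partial>?C \<partial>lborel)"
    by (rule nn_integral_cong, rule nn_integral_count_space_nn_integral[OF countable_lattice]) measurable
  also have "\<dots> = (\<integral>\<^sup>+k. \<integral>\<^sup>+x. \<integral>\<^sup>+y. indicator cube (y - k) * (indicator cube x * \<Phi> x y) \<partial>lborel \<partial>lborel \<partial>?C)"
    by (rule nn_integral_count_space_nn_integral[OF countable_lattice]) measurable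
  also have "\<dots> = (\<integral>\<^sup>+k. \<integral>\<^sup>+x. \<integral>\<^sup>+y. indicator cube (x + k) * (indicator cube y * \<Phi> x y) \<partial>lborel \<partial>lborel \<partial>?C)"
  proof (rule nn_integral_cong)
    fix k assume "k \<in> space ?C"
    then have k: "k \<in> integer_lattice" by simp
    have "(\<integral>\<^sup>+x. \<integral>\<^sup>+y. indicator cube (y - k) * (indicator cube x * \<Phi> x y) \<partial>lborel \<partial>lborel) =
       (\<integral>\<^sup>+x. \<integral>\<^sup>+y. indicator cube (y + k - k) * (indicator cube x * \<Phi> x (y + k)) \<partial>lborel \<partial>lborel)"
      by (intro nn_integral_cong nn_integral_lborel_shift[symmetric]) measurable
    also have "\<dots> = (\<integral>\<^sup>+x. \<integral>\<^sup>+y. indicator cube (y + k - k) * (indicator cube (x + k) * \<Phi> (x + k) (y + k)) \<partial>lborel \<partial>lborel)"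
      by (intro nn_integral_lborel_shift[symmetric]) measurable
    finally show "(\<integral>\<^sup>+x. \<integral>\<^sup>+y. indicator cube (y - k) * (indicator cube x * \<Phi> x y) \<partial>lborel \<partial>lborel) =
      (\<integral>\<^sup>+x. \<integral>\<^sup>+y. indicator cube (x + k) * (indicator cube y * \<Phi> x y) \<partial>lborel \<partial>lborel)"
      by (simp add: inv[OF k] mult.left_commute)
  qed
  also have "\<dots> = (\<integral>\<^sup>+x. \<integral>\<^sup>+k. \<integral>\<^sup>+y. indicator cube (x + k) * (indicator cube y * \<Phi> x y) \<partial>lborel \<partial>?C \<partial>lborel)"
    by (rule nn_integral_count_space_nn_integral[OF countable_lattice, symmetric]) measurable
  also have "\<dots> = (\<integral>\<^sup>+x. \<integral>\<^sup>+k. indicator cube (x + k) * (\<integral>\<^sup>+y. indicator cube y * \<Phi> x y \<partial>lborel) \<partial>?C \<partial>lborel)"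
    by (simp add: nn_integral_cmult)
  also have "\<dots> = (\<integral>\<^sup>+x. \<integral>\<^sup>+y. indicator cube y * \<Phi> x y \<partial>lborel \<partial>lborel)"
    by (simp add: nn_integral_multc nn_integral_cube_sum')
  also have "\<dots> = (\<integral>\<^sup>+y. \<integral>\<^sup>+x. indicator cube y * \<Phi> x y \<partial>lborel \<partial>lborel)"
    by (rule lborel_pair.Fubini'[symmetric]) measurable
  also have "\<dots> = (\<integral>\<^sup>+y. indicator cube y * (\<integral>\<^sup>+x. \<Phi> x y \<partial>lborel) \<partial>lborel)"
    by (simp add: nn_integral_cmult)
  finally show ?thesis .
qed

lemma emeasure_cube_finite: "emeasure lborel (cube :: (real ^ 'd) set) < \<infinity>"
proof (rule emeasure_bounded_finite)
  show "bounded (cube :: (real ^ 'd) set)"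
    unfolding bounded_iff using norm_cube_le by blast
qed

lemma integrable_cube:
  assumes "bmp f" shows "integrable lborel (\<lambda>x. indicator cube x * f x)"
proof -
  obtain C where C: "\<And>x. \<bar>f x\<bar> \<le> C" using assms by (auto simp: bmp_def)
  note [measurable] = bmpD(1)[OF assms]
  show ?thesis
  proof (rule Bochner_Integration.integrable_bound)
    show "integrable lborel (\<lambda>x. indicator cube x * C)"
      using emeasure_cube_finite by (intro integrable_mult_left integrable_real_indicator) auto
    have "0 \<le> C" using C[of 0] by linarith
    then show "AE x in lborel. norm (indicator cube x * f x) \<le> norm (indicator cube x * C)"
      using C by (intro AE_I2) (auto simp: indicator_def)
  qed measurable
qed

section \<open>Symmetry of the operator on the torus\<close>

context kicked
begin

definition ip :: "(real ^ 'd \<Rightarrow> real) \<Rightarrow> (real ^ 'd \<Rightarrow> real) \<Rightarrow> real" where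
  "ip f g = (\<integral>x. indicator cube x * (exp (- F x / (2 * \<nu>)) * (f x * g x)) \<partial>lborel)"

lemma bmp_density: "bmp (\<lambda>x. exp (- F x / (2 * \<nu>)))"
  using bmp_exp_F[of "- 1 / (2 * \<nu>)"] by simp

lemma ip_integrable:
  "bmp f \<Longrightarrow> bmp g \<Longrightarrow> integrable lborel (\<lambda>x. indicator cube x * (exp (- F x / (2 * \<nu>)) * (f x * g x)))"
  by (intro integrable_cube bmp_mult bmp_density)

lemma ip_commute: "ip f g = ip g f" by (simp add: ip_def mult.commute)

lemma ip_lin_right:
  assumes "bmp f" "bmp g" "bmp h"
  shows "ip f (\<lambda>x. a * g x + b * h x) = a * ip f g + b * ip f h"
proof -
  have "ip f (\<lambda>x. a * g x + b * h x) = (\<integral>x. a * (indicator cube x * (exp (- F x / (2 * \<nu>)) * (f x * g x)))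
     + b * (indicator cube x * (exp (- F x / (2 * \<nu>)) * (f x * h x))) \<partial>lborel)"
    unfolding ip_def by (intro Bochner_Integration.integral_cong) (auto simp: algebra_simps)
  then show ?thesis unfolding ip_def
    using ip_integrable[OF assms(1,2)] ip_integrable[OF assms(1,3)] by simp
qed

lemma ip_lin_left:
  "bmp f \<Longrightarrow> bmp g \<Longrightarrow> bmp h \<Longrightarrow> ip (\<lambda>x. a * g x + b * h x) f = a * ip g f + b * ip h f"
  using ip_lin_right[of f g h a b] by (simp only: ip_commute[of _ f])

lemma ip_mono:
  assumes "bmp f" "bmp g" "bmp f'" "bmp g'" "\<And>x. x \<in> cube \<Longrightarrow> f x * g x \<le> f' x * g' x"
  shows "ip f g \<le> ip f' g'"
  unfolding ip_def using assms
  by (intro integral_mono ip_integrable) (auto simp: indicator_def)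

lemma ip_nonneg: "(\<And>x. 0 \<le> f x * g x) \<Longrightarrow> 0 \<le> ip f g"
  unfolding ip_def by (intro integral_nonneg_AE) auto

lemma ip_pos:
  assumes f: "bmp f" "\<And>x. 0 < f x" shows "0 < ip f f"
proof -
  have "ip f f \<noteq> 0"
  proof
    assume "ip f f = 0"
    then have "AE x in lborel. indicator cube x * (exp (- F x / (2 * \<nu>)) * (f x * f x)) = 0"
      unfolding ip_def using ip_integrable[OF f(1) f(1)]
      by (subst (asm) integral_nonneg_eq_0_iff_AE) auto
    then have "AE x in lborel. x \<notin> (cube :: (real ^ 'd) set)"
      by eventually_elim (use f(2) in \<open>auto simp: indicator_def less_imp_neq[symmetric]\<close>)
    then have "emeasure lborel (cube :: (real ^ 'd) set) = 0"
      by (subst (asm) AE_iff_measurable[OF _ refl]) auto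
    moreover have "emeasure lborel (ball 0 (1/2) :: (real ^ 'd) set) \<le> emeasure lborel (cube :: (real ^ 'd) set)"
    proof (rule emeasure_mono)
      show "ball 0 (1/2) \<subseteq> (cube :: (real ^ 'd) set)"
      proof
        fix x :: "real ^ 'd" assume x: "x \<in> ball 0 (1/2)"
        have *: "\<bar>x $ i\<bar> < 1/2" for i using component_le_norm_cart[of x i] x by (simp only: mem_ball_0)
        then have "- 1/2 \<le> x $ i \<and> x $ i < 1/2" for i using *[of i] by linarith
        then show "x \<in> cube" unfolding cube_def by blast
      qed
    qed simp
    moreover have "emeasure lborel (ball 0 (1/2) :: (real ^ 'd) set) > 0"
      by (simp add: emeasure_ball)
    ultimately show False by simp
  qed
  moreover have "0 \<le> ip f f" by (rule ip_nonneg) simp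
  ultimately show ?thesis by linarith
qed

text \<open>The density multiplied by the kernel is symmetric, with a full kick at both ends, and
  mass transport exchanges the variable in the cube with the free one. Nonnegative functions allow
  this to be done with extended nonnegative integrals.\<close>

lemma ip_L_commute_nonneg:
  assumes f: "bmp f" "\<And>x. 0 \<le> f x" and g: "bmp g" "\<And>x. 0 \<le> g x"
  shows "ip f (L g) = ip g (L f)"
proof -
  define \<Phi> where "\<Phi> f g x y = ennreal (exp (- F x / (2 * \<nu>)) * f x * (ker x y * g y))" for f g and x y :: "real ^ 'd"
  have \<Phi>: "ennreal (ip f (L g)) = (\<integral>\<^sup>+x. indicator cube x * (\<integral>\<^sup>+y. \<Phi> f g x y \<partial>lborel) \<partial>lborel)"
    if f: "bmp f" "\<And>x. 0 \<le> f x" and g: "bmp g" "\<And>x. 0 \<le> g x" for f g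
  proof -
    note [measurable] = bmpD(1)[OF f(1)] bmpD(1)[OF g(1)]
    have k: "(\<lambda>y. ker x y) \<in> borel_measurable borel" for x unfolding ker_def by measurable
    note [measurable] = k
    have "ennreal (ip f (L g)) = (\<integral>\<^sup>+x. ennreal (indicator cube x * (exp (- F x / (2 * \<nu>)) * (f x * L g x))) \<partial>lborel)"
      unfolding ip_def using f(2) plin_pos[OF L_plin g]
      by (intro nn_integral_eq_integral[symmetric] ip_integrable f plin_bmp[OF L_plin] g) auto
    also have "\<dots> = (\<integral>\<^sup>+x. indicator cube x * (\<integral>\<^sup>+y. \<Phi> f g x y \<partial>lborel) \<partial>lborel)"
    proof (intro nn_integral_cong)
      fix x
      have "ennreal (indicator cube x * (exp (- F x / (2 * \<nu>)) * (f x * L g x))) =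
        indicator cube x * (ennreal (exp (- F x / (2 * \<nu>)) * f x) * ennreal (L g x))"
        using f(2) plin_pos[OF L_plin g, of x] by (simp add: ennreal_mult[symmetric] indicator_def)
      also have "ennreal (L g x) = (\<integral>\<^sup>+y. ennreal (ker x y * g y) \<partial>lborel)"
        using ennreal_opr[OF weight_const[of 1] g, of x] by (simp add: L_def)
      also have "ennreal (exp (- F x / (2 * \<nu>)) * f x) * \<dots> = (\<integral>\<^sup>+y. \<Phi> f g x y \<partial>lborel)"
        unfolding \<Phi>_def using f(2)[of x] g(2) ker_nonneg
        by (subst nn_integral_cmult[symmetric]) (auto simp: ennreal_mult[symmetric])
      finally show "ennreal (indicator cube x * (exp (- F x / (2 * \<nu>)) * (f x * L g x))) = indicator cube x * (\<integral>\<^sup>+y. \<Phi> f g x y \<partial>lborel)" .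
    qed
    finally show ?thesis .
  qed
  note [measurable] = bmpD(1)[OF f(1)] bmpD(1)[OF g(1)]
  have "ennreal (ip f (L g)) = (\<integral>\<^sup>+y. indicator cube y * (\<integral>\<^sup>+x. \<Phi> f g x y \<partial>lborel) \<partial>lborel)"
    unfolding \<Phi>[OF f g]
  proof (rule mass_transport)
    show "case_prod (\<Phi> f g) \<in> borel_measurable (borel \<Otimes>\<^sub>M borel)" unfolding \<Phi>_def by measurable
    fix k x y :: "real ^ 'd" assume k: "k \<in> integer_lattice"
    then show "\<Phi> f g (x + k) (y + k) = \<Phi> f g x y"
      using F_per by (simp add: \<Phi>_def ker_shift periodic_def bmpD(2)[OF f(1)] bmpD(2)[OF g(1)])
  qed
  also have "(\<lambda>x y. \<Phi> f g x y) = (\<lambda>x y. \<Phi> g f y x)"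
    by (simp add: fun_eq_iff \<Phi>_def ker_def gauss_minus[of \<nu> "_" "_"] mult_ac)
  finally have "ennreal (ip f (L g)) = ennreal (ip g (L f))" unfolding \<Phi>[OF g f] by simp
  moreover have "0 \<le> ip f (L g)" "0 \<le> ip g (L f)"
    using f g by (auto intro!: ip_nonneg mult_nonneg_nonneg plin_pos[OF L_plin])
  ultimately show ?thesis by simp
qed

text \<open>Adding constants makes both functions nonnegative, and bilinearity removes them
  again.\<close>

lemma ip_L_commute:
  assumes f: "bmp f" and g: "bmp g"
  shows "ip f (L g) = ip g (L f)"
proof -
  obtain C1 C2 where C: "\<And>x. \<bar>f x\<bar> \<le> C1" "\<And>x. \<bar>g x\<bar> \<le> C2" using f g by (auto simp: bmp_def)
  define f1 g1 where "f1 x = 1 * f x + C1 * 1" "g1 x = 1 * g x + C2 * 1" for x :: "real ^ 'd"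
  have nn: "0 \<le> f1 x" "0 \<le> g1 x" for x
    using C(1)[of x] C(2)[of x] by (auto simp: f1_g1_def abs_le_iff)
  have b1: "bmp f1" "bmp g1" unfolding f1_g1_def by (intro bmp_lin f g bmp_const)+
  have C0: "0 \<le> C1" "0 \<le> C2" using C(1)[of 0] C(2)[of 0] by linarith+
  have fe: "f = (\<lambda>x. 1 * f1 x + (- C1) * 1)" "g = (\<lambda>x. 1 * g1 x + (- C2) * 1)"
    by (auto simp: f1_g1_def)
  note bL = plin_bmp[OF L_plin]
  have one: "bmp (\<lambda>_ :: real ^ 'd. 1 :: real)" by simp
  have ex: "ip (\<lambda>x. 1 * p x + (- P) * 1) (L (\<lambda>x. 1 * q x + (- Q) * 1)) =
     ip p (L q) - Q * ip p (L (\<lambda>_. 1)) - P * ip (\<lambda>_. 1) (L q) + P * Q * ip (\<lambda>_. 1) (L (\<lambda>_. 1))"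
    if "bmp p" "bmp q" for p q P Q
  proof -
    note bp = bmp_lin[OF that(1) one, of 1 "- P"]
    have "ip (\<lambda>x. 1 * p x + (- P) * 1) (L (\<lambda>x. 1 * q x + (- Q) * 1)) =
      1 * ip (\<lambda>x. 1 * p x + (- P) * 1) (L q) + (- Q) * ip (\<lambda>x. 1 * p x + (- P) * 1) (L (\<lambda>_. 1))"
      unfolding plin_lin[OF L_plin that(2) one] by (rule ip_lin_right[OF bp bL[OF that(2)] bL[OF one]])
    also have "\<dots> = 1 * (1 * ip p (L q) + (- P) * ip (\<lambda>_. 1) (L q))
      + (- Q) * (1 * ip p (L (\<lambda>_. 1)) + (- P) * ip (\<lambda>_. 1) (L (\<lambda>_. 1)))"
      by (simp only: ip_lin_left[OF bL[OF that(2)] that(1) one] ip_lin_left[OF bL[OF one] that(1) one])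
    finally show ?thesis by (simp add: algebra_simps)
  qed
  note e1 = ex[OF b1, of C1 C2, folded fe] and e2 = ex[OF b1(2,1), of C2 C1, folded fe]
  note c = ip_L_commute_nonneg[OF b1(1) nn(1) b1(2) nn(2)]
    ip_L_commute_nonneg[OF b1(1) nn(1) one zero_le_one] ip_L_commute_nonneg[OF b1(2) nn(2) one zero_le_one]
  show ?thesis unfolding e1 e2 c by (simp add: algebra_simps)
qed


lemma cube_ball:
  assumes x: "x \<in> cube" "x \<in> ball k s" and k: "k \<in> integer_lattice" and s: "s \<le> 1 / 4" shows "k = 0"
proof -
  have "k $ i = 0" for i
  proof -
    have "\<bar>x $ i - k $ i\<bar> < 1 / 4" using component_le_norm_cart[of "x - k" i] x s
      by (simp add: dist_norm norm_minus_commute)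
    moreover have "- 1/2 \<le> x $ i \<and> x $ i < 1/2" using x(1) unfolding cube_def by blast
    ultimately have "\<bar>k $ i\<bar> < 1" by linarith
    then show ?thesis using k by (auto simp: integer_lattice_def dest: Ints_nonzero_abs_less1)
  qed
  then show ?thesis by (simp add: vec_eq_iff)
qed

definition well :: "real \<Rightarrow> real ^ 'd \<Rightarrow> real" where "well s x = same s x x"

lemma bmp_well: "bmp (well s)"
proof -
  have "(\<lambda>x. (\<lambda>(x, y). same s x y) (x, x)) \<in> borel_measurable borel"
    by (rule measurable_compose[OF _ same_measurable]) measurable
  then show ?thesis
    using same_shift by (auto simp: bmp_def well_def[abs_def] periodic_def same_nonneg same_le1 intro!: exI[of _ 1])
qed

lemma well_cube: "x \<in> cube \<Longrightarrow> s \<le> 1 / 4 \<Longrightarrow> well s x = indicator (ball 0 s) x"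
proof -
  assume x: "x \<in> cube" "s \<le> 1 / 4"
  have "(\<exists>k\<in>integer_lattice. x \<in> ball k s \<and> x \<in> ball k s) \<longleftrightarrow> x \<in> ball 0 s"
    using cube_ball[OF x(1) _ _ x(2)] zero_in_lattice by blast
  then show ?thesis unfolding well_def same_def indicator_def by simp
qed

lemma well_ball_cube: "x \<in> ball 0 s \<Longrightarrow> s \<le> 1 / 4 \<Longrightarrow> x \<in> (cube :: (real ^ 'd) set)"
proof -
  assume x: "x \<in> ball 0 s" "s \<le> 1 / 4"
  have "- 1/2 \<le> x $ i \<and> x $ i < 1/2" for i
    using component_le_norm_cart[of x i] x unfolding mem_ball_0 by linarith
  then show ?thesis unfolding cube_def by blast
qed

lemma ip_well:
  assumes s: "s \<le> 1 / 4"
  shows "ip f (well s) = (\<integral>x. indicator (ball 0 s) x * exp (- F x / (2 * \<nu>)) * f x \<partial>lborel)"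
  unfolding ip_def
proof (intro Bochner_Integration.integral_cong refl)
  fix x :: "real ^ 'd"
  show "indicator cube x * (exp (- F x / (2 * \<nu>)) * (f x * well s x)) =
    indicator (ball 0 s) x * exp (- F x / (2 * \<nu>)) * f x"
    using well_cube[OF _ s, of x] well_ball_cube[OF _ s, of x] by (auto simp: indicator_def)
qed

lemma ip_abs:
  assumes "bmp f" "bmp g" "bmp h" "\<And>x. x \<in> cube \<Longrightarrow> \<bar>g x\<bar> \<le> h x"
  shows "\<bar>ip f g\<bar> \<le> ip (\<lambda>x. \<bar>f x\<bar>) h"
proof -
  have *: "\<bar>f x * g x\<bar> \<le> \<bar>f x\<bar> * h x" if "x \<in> cube" for x
    unfolding abs_mult using assms(4)[OF that] by (intro mult_left_mono) auto
  have "ip f g \<le> ip (\<lambda>x. \<bar>f x\<bar>) h"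
    using * by (intro ip_mono assms bmp_abs) (auto simp: abs_le_iff)
  moreover have "ip f (\<lambda>x. - 1 * g x) \<le> ip (\<lambda>x. \<bar>f x\<bar>) h"
    using * by (intro ip_mono assms bmp_abs bmp_scale) (auto simp: abs_le_iff)
  moreover have "ip f (\<lambda>x. - 1 * g x + 0 * g x) = - 1 * ip f g + 0 * ip f g"
    by (rule ip_lin_right) (rule assms)+
  ultimately show ?thesis by (simp add: abs_le_iff)
qed

end

text \<open>Conservation of mass by the heat flow on the torus, read off from the symmetry of the
  operator with zero kick potential and the invariance of constants.\<close>

lemma integral_cube_gauss:
  assumes g: "bmp (g :: real ^ 'd \<Rightarrow> real)" "\<And>x. 0 \<le> g x" and s: "s > 0"
  shows "(\<integral>x. indicator cube x * (\<integral>y. gauss s (y - x) * g y \<partial>lborel) \<partial>lborel) = (\<integral>x. indicator cube x * g x \<partial>lborel)"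
proof -
  interpret H: kicked "\<lambda>_ :: real ^ 'd. 0 :: real" s
    using s by unfold_locales (auto simp: periodic_def)
  have Lg: "H.L g x = (\<integral>y. gauss s (y - x) * g y \<partial>lborel)" for g x by (simp add: H.L_eq H.ker_def)
  have one: "H.L (\<lambda>_. 1) = (\<lambda>_. 1)" using s by (simp add: fun_eq_iff Lg integral_gauss_shift)
  have "H.ip (\<lambda>_. 1) (H.L g) = H.ip g (H.L (\<lambda>_. 1))"
    by (rule H.ip_L_commute[OF bmp_const g(1)])
  then show ?thesis unfolding one H.ip_def Lg by simp
qed

section \<open>A positive eigenfunction and the top of the spectrum\<close>

locale kicked_eigen = kicked F \<nu> for F :: "real ^ 'd \<Rightarrow> real" and \<nu> +
  fixes w :: "real ^ 'd \<Rightarrow> real" and \<rho> :: real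
  assumes w: "bmp w" "\<And>x. 0 < w x" and eigen: "\<And>x. L w x = \<rho> * w x" and rho: "0 < \<rho>"
begin

lemma L_w: "L w = (\<lambda>x. \<rho> * w x)" using eigen by blast

lemma w_slow: "slow w"
proof -
  have "slow (L w)" by (rule L_slow[OF w])
  then show ?thesis using rho unfolding L_w slow_def by (simp add: mult.assoc)
qed

lemma bmp_inverse_w: "bmp (\<lambda>x. 1 / w x)"
proof -
  have "1 / w x \<le> exp ((real CARD('d))\<^sup>2 / (2 * \<nu>)) / w 0" for x
    using slow_osc[OF w_slow w, of 0 x] w(2)[of x] w(2)[of 0] by (simp add: field_simps)
  then show ?thesis using w bmpD[OF w(1)] less_imp_le[OF w(2)]
    by (auto simp: bmp_def periodic_def)
qed

text \<open>Schur test with weight \<open>w\<close>: the product \<open>g x * g y\<close> is split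
  by the arithmetic-geometric mean inequality with the ratio \<open>w y / w x\<close>, so that each
  half integrates through the eigenvalue equation.\<close>

lemma form_le:
  assumes g: "bmp g" "\<And>x. 0 \<le> g x"
  shows "ip g (L g) \<le> \<rho> * ip g g"
proof -
  define p where "p x = g x * g x * (1 / w x)" for x
  have p: "bmp p" unfolding p_def by (intro bmp_mult g bmp_inverse_w)
  note bL = plin_bmp[OF L_plin]
  have pw: "g x * L g x \<le> 1/2 * (\<rho> * (g x * g x)) + 1/2 * (w x * L p x)" for x
  proof -
    have "L (\<lambda>y. g x * g y) x \<le> L (\<lambda>y. (g x * g x / w x / 2) * w y + (w x / 2) * p y) x"
    proof (intro plin_mono[OF L_plin] bmp_scale bmp_lin g w p)
      fix y
      have "0 \<le> (g x * w y - g y * w x)\<^sup>2 / (2 * w x * w y)" using w(2)[of x] w(2)[of y] by simp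
      also have "\<dots> = (g x * g x / w x / 2) * w y + (w x / 2) * p y - g x * g y"
        unfolding p_def using w(2)[of x] w(2)[of y] by (simp add: power2_eq_square field_simps)
      finally show "g x * g y \<le> (g x * g x / w x / 2) * w y + (w x / 2) * p y" by simp
    qed
    then show ?thesis
      unfolding plin_scale[OF L_plin g(1)] plin_lin[OF L_plin w(1) p] eigen using w(2)[of x] by (simp add: mult_ac)
  qed
  have "ip g (L g) = ip (\<lambda>_. 1) (\<lambda>x. g x * L g x)" by (simp add: ip_def)
  also have "\<dots> \<le> ip (\<lambda>_. 1) (\<lambda>x. 1/2 * (\<rho> * (g x * g x)) + 1/2 * (w x * L p x))"
    using pw by (intro ip_mono bmp_const bmp_mult g bL p bmp_lin bmp_scale w) auto
  also have "\<dots> = 1/2 * ip (\<lambda>_. 1) (\<lambda>x. \<rho> * (g x * g x)) + 1/2 * ip (\<lambda>_. 1) (\<lambda>x. w x * L p x)"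
    by (intro ip_lin_right bmp_const bmp_mult bmp_scale g bL p w)
  also have "ip (\<lambda>_. 1) (\<lambda>x. w x * L p x) = ip p (L w)"
    using ip_L_commute[OF w(1) p] by (simp add: ip_def)
  also have "ip p (L w) = ip (\<lambda>_. 1) (\<lambda>x. \<rho> * (g x * g x))"
    unfolding L_w ip_def p_def using w(2)
    by (intro Bochner_Integration.integral_cong) (auto simp: less_imp_neq[symmetric])
  also have "ip (\<lambda>_. 1) (\<lambda>x. \<rho> * (g x * g x)) = ip (\<lambda>_. 1) (\<lambda>x. \<rho> * (g x * g x) + 0 * 1)" by simp
  also have "\<dots> = \<rho> * ip (\<lambda>_. 1) (\<lambda>x. g x * g x) + 0 * ip (\<lambda>_. 1) (\<lambda>_. 1)"
    by (intro ip_lin_right bmp_const bmp_mult g)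
  also have "ip (\<lambda>_. 1) (\<lambda>x. g x * g x) = ip g g" by (simp add: ip_def)
  finally show ?thesis by simp
qed

end

section \<open>The gap below the top eigenvalue by a rank one subtraction\<close>

locale kicked_gap = kicked_eigen F \<nu> w \<rho> for F :: "real ^ 'd \<Rightarrow> real" and \<nu> w \<rho> +
  fixes s c \<beta> C1 :: real
  assumes s: "0 < s" "s \<le> 1 / 4"
    and beta: "0 < \<beta>" "\<beta> \<le> C1" "\<And>x y. x \<in> ball 0 s \<Longrightarrow> y \<in> ball 0 s \<Longrightarrow> \<beta> \<le> gauss \<nu> (y - x :: real ^ 'd)"
    and C1: "\<And>z. gauss \<nu> (z :: real ^ 'd) \<le> C1"
    and far: "\<And>z. (\<And>k. k \<in> integer_lattice \<Longrightarrow> z \<notin> ball k s) \<Longrightarrow> c \<le> F z"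
    and small: "gauss_ratio * exp (- min c (1 / 8) / (4 * \<nu>)) \<le> \<rho> / 2"
begin

definition J :: "(real ^ 'd \<Rightarrow> real) \<Rightarrow> real" where "J f = ip f (well s)"

definition \<theta> :: real where "\<theta> = 1 - \<beta> / C1 / 2"

lemma theta: "1 / 2 \<le> \<theta>" "\<theta> < 1"
  using beta by (auto simp: \<theta>_def field_simps)

lemma J_lin: "bmp f \<Longrightarrow> bmp g \<Longrightarrow> J (\<lambda>x. a * f x + b * g x) = a * J f + b * J g"
  unfolding J_def by (intro ip_lin_left bmp_well)

lemma J_int: "J f = (\<integral>y. indicator (ball 0 s) y * exp (- F y / (2 * \<nu>)) * f y \<partial>lborel)"
  unfolding J_def by (rule ip_well[OF s(2)])

lemma J_integrable: "bmp f \<Longrightarrow> integrable lborel (\<lambda>y. indicator (ball 0 s) y * exp (- F y / (2 * \<nu>)) * f y)"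
proof -
  assume f: "bmp f"
  have "(\<lambda>y. indicator (ball 0 s) y * exp (- F y / (2 * \<nu>)) * f y) =
     (\<lambda>x. indicator cube x * (exp (- F x / (2 * \<nu>)) * (f x * well s x)))"
    using well_cube[OF _ s(2)] well_ball_cube[OF _ s(2)] by (auto simp: fun_eq_iff indicator_def)
  then show ?thesis using ip_integrable[OF f bmp_well] by simp
qed

definition q' :: "(real ^ 'd \<Rightarrow> real) \<Rightarrow> real" where "q' f = ip f (L f) - \<beta> * (J f)\<^sup>2"

text \<open>By the choice of \<open>\<beta>\<close> the subtraction leaves a nonnegative kernel
  \<open>k\<close>, so passing to absolute values can only increase the form. This reduces two-sided
  bounds to nonnegative functions.\<close>

lemma q'_abs:
  assumes f: "bmp f" shows "\<bar>q' f\<bar> \<le> q' (\<lambda>x. \<bar>f x\<bar>)"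
proof -
  have q': "q' f = ip f (\<lambda>x. 1 * L f x + (- \<beta> * J f) * well s x)" if "bmp f" for f
    unfolding ip_lin_right[OF that plin_bmp[OF L_plin that] bmp_well] q'_def J_def
    by (simp add: power2_eq_square)
  note fa = bmp_abs[OF f]
  have "\<bar>ip f (\<lambda>x. 1 * L f x + (- \<beta> * J f) * well s x)\<bar> \<le>
    ip (\<lambda>x. \<bar>f x\<bar>) (\<lambda>x. 1 * L (\<lambda>x. \<bar>f x\<bar>) x + (- \<beta> * J (\<lambda>x. \<bar>f x\<bar>)) * well s x)"
  proof (rule ip_abs)
    fix x :: "real ^ 'd" assume x: "x \<in> cube"
    define k where "k y = ker x y - \<beta> * well s x * (indicator (ball 0 s) y * exp (- F y / (2 * \<nu>)))" for y
    have k0: "0 \<le> k y" for y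
    proof (cases "x \<in> ball 0 s \<and> y \<in> ball 0 s")
      case True
      then have "\<beta> * exp (- F y / (2 * \<nu>)) \<le> ker x y"
        unfolding ker_def using beta(3) by (intro mult_right_mono) auto
      then show ?thesis using True well_cube[OF x s(2)] by (simp add: k_def)
    next
      case False
      then show ?thesis using well_cube[OF x s(2)] ker_nonneg[of x y] by (auto simp: k_def indicator_def)
    qed
    have eq: "1 * L g x + (- \<beta> * J g) * well s x = (\<integral>y. k y * g y \<partial>lborel)"
      and int: "integrable lborel (\<lambda>y. k y * g y)" if g: "bmp g" for g
    proof -
      have e: "k y * g y = ker x y * g y - \<beta> * well s x * (indicator (ball 0 s) y * exp (- F y / (2 * \<nu>)) * g y)" for y
        by (simp add: k_def algebra_simps)
      show "integrable lborel (\<lambda>y. k y * g y)" unfolding e using L_integrable[OF g] J_integrable[OF g]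
        by (intro Bochner_Integration.integrable_diff integrable_mult_right) auto
      show "1 * L g x + (- \<beta> * J g) * well s x = (\<integral>y. k y * g y \<partial>lborel)"
        unfolding e J_int L_eq using L_integrable[OF g, of x] J_integrable[OF g] by simp
    qed
    have "\<bar>\<integral>y. k y * f y \<partial>lborel\<bar> \<le> (\<integral>y. \<bar>k y * f y\<bar> \<partial>lborel)" by (rule integral_abs_bound)
    also have "\<dots> = (\<integral>y. k y * \<bar>f y\<bar> \<partial>lborel)" using k0 by (simp add: abs_mult)
    finally show "\<bar>1 * L f x + (- \<beta> * J f) * well s x\<bar> \<le>
       1 * L (\<lambda>x. \<bar>f x\<bar>) x + (- \<beta> * J (\<lambda>x. \<bar>f x\<bar>)) * well s x"
      unfolding eq[OF f] eq[OF fa] .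
  qed (intro bmp_lin plin_bmp[OF L_plin] f fa bmp_well)+
  then show ?thesis unfolding q'[OF f] q'[OF fa] .
qed

lemma near_part:
  assumes g: "bmp g" "\<And>x. 0 \<le> g x"
  shows "ip g (opr (same s) g) \<le> C1 * (J g)\<^sup>2"
proof -
  have Jg: "0 \<le> J g" unfolding J_def using g(2) same_nonneg by (intro ip_nonneg mult_nonneg_nonneg) (auto simp: well_def)
  have "ip g (opr (same s) g) \<le> ip g (\<lambda>x. (C1 * J g) * well s x + 0 * well s x)"
  proof (intro ip_mono g opr_bmp weight_same bmp_lin bmp_well mult_left_mono)
    fix x :: "real ^ 'd" assume x: "x \<in> cube"
    show "opr (same s) g x \<le> (C1 * J g) * well s x + 0 * well s x"
    proof (cases "x \<in> ball 0 s")
      case True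
      have "opr (same s) g x = (\<integral>y. indicator (ball 0 s) y * ker x y * g y \<partial>lborel)"
        unfolding opr_def using same_center[OF True s(2)] by simp
      also have "\<dots> \<le> (\<integral>y. C1 * (indicator (ball 0 s) y * exp (- F y / (2 * \<nu>)) * g y) \<partial>lborel)"
      proof (rule integral_mono)
        show "integrable lborel (\<lambda>y. indicator (ball 0 s) y * ker x y * g y)"
          using opr_integrable[OF weight_same[of s] g(1), of x] same_center[OF True s(2)] by simp
        show "integrable lborel (\<lambda>y. C1 * (indicator (ball 0 s) y * exp (- F y / (2 * \<nu>)) * g y))"
          using J_integrable[OF g(1)] by simp
        fix y
        have "ker x y \<le> C1 * exp (- F y / (2 * \<nu>))" unfolding ker_def by (intro mult_right_mono C1) auto
        then have "ker x y * g y \<le> C1 * exp (- F y / (2 * \<nu>)) * g y" by (intro mult_right_mono g)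
        then show "indicator (ball 0 s) y * ker x y * g y \<le> C1 * (indicator (ball 0 s) y * exp (- F y / (2 * \<nu>)) * g y)"
          by (auto simp: indicator_def)
      qed
      also have "\<dots> = C1 * J g" unfolding J_int by simp
      finally show ?thesis using True well_cube[OF x s(2)] by simp
    next
      case False
      have "x \<notin> ball k s" if "k \<in> integer_lattice" for k using cube_ball[OF x _ that s(2)] False by blast
      then have "same s x y = 0" for y by (simp add: same_def)
      then show ?thesis using well_cube[OF x s(2)] False by (simp add: opr_def)
    qed
  qed
  also have "\<dots> = (C1 * J g) * J g + 0 * J g" unfolding J_def by (intro ip_lin_right g bmp_well)
  finally show ?thesis by (simp add: power2_eq_square mult_ac)
qed

text \<open>Off the small wells the symmetrised kernel is at most \<open>\<eta>\<close> times the
  heat kernel at time \<open>2 * \<nu>\<close>. The arithmetic-geometric mean inequality and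
  conservation of mass bound the form of that kernel by the norm, leaving
  \<open>\<eta> \<le> \<rho> / 2\<close>.\<close>

lemma far_part:
  assumes g: "bmp g" "\<And>x. 0 \<le> g x"
  shows "ip g (opr (\<lambda>x y. 1 - same s x y) g) \<le> \<rho> / 2 * ip g g"
proof -
  define \<eta> where "\<eta> = gauss_ratio * exp (- min c (1 / 8) / (4 * \<nu>))"
  have \<eta>: "0 \<le> \<eta>" "\<eta> \<le> \<rho> / 2" using small gauss_ratio_ge1 by (auto simp: \<eta>_def)
  define G where "G x = exp (- F x / (2 * \<nu>)) * (g x * g x)" for x
  have G: "bmp G" "\<And>x. 0 \<le> G x" unfolding G_def by (intro bmp_mult bmp_density g) simp
  have we: "weight (\<lambda>x y. 1 - same s x y)" using weight_not_same[of 1 0 s] by simp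
  have nu2: "2 * \<nu> > 0" using nu_pos by simp
  interpret H: kicked "\<lambda>_ :: real ^ 'd. 0 :: real" "2 * \<nu>"
    using nu_pos by unfold_locales (auto simp: periodic_def)
  have Hint: "integrable lborel (\<lambda>y. gauss (2 * \<nu>) (y - x) * G y)" for x
    using H.L_integrable[OF G(1), of x] by (simp add: H.ker_def)
  have HL: "H.L G x = (\<integral>y. gauss (2 * \<nu>) (y - x) * G y \<partial>lborel)" for x by (simp add: H.L_eq H.ker_def)
  have pw: "exp (- F x / (2 * \<nu>)) * (g x * opr (\<lambda>x y. 1 - same s x y) g x) \<le> \<eta> / 2 * (G x + H.L G x)" for x
  proof -
    have "exp (- F x / (2 * \<nu>)) * (g x * opr (\<lambda>x y. 1 - same s x y) g x) =
      (\<integral>y. exp (- F x / (2 * \<nu>)) * g x * ((1 - same s x y) * ker x y * g y) \<partial>lborel)"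
      unfolding opr_def by simp
    also have "\<dots> \<le> (\<integral>y. \<eta> / 2 * (gauss (2 * \<nu>) (y - x) * G x + gauss (2 * \<nu>) (y - x) * G y) \<partial>lborel)"
    proof (rule integral_mono)
      show "integrable lborel (\<lambda>y. exp (- F x / (2 * \<nu>)) * g x * ((1 - same s x y) * ker x y * g y))"
        using opr_integrable[OF we g(1), of x] by simp
      show "integrable lborel (\<lambda>y. \<eta> / 2 * (gauss (2 * \<nu>) (y - x) * G x + gauss (2 * \<nu>) (y - x) * G y))"
        using Hint[of x] nu2 by simp
      fix y
      define h where "h z = exp (- F z / (4 * \<nu>)) * g z" for z
      have e2: "exp (- F z / (2 * \<nu>)) = exp (- F z / (4 * \<nu>)) * exp (- F z / (4 * \<nu>))" for z
        unfolding exp_add[symmetric] using nu_pos by (simp add: field_simps)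
      have hG: "h z * h z = G z" for z unfolding h_def G_def e2 by (simp add: mult_ac)
      have h0: "0 \<le> h z" for z using g by (simp add: h_def)
      have g2: "0 \<le> gauss (2 * \<nu>) (y - x)" using gauss_pos[OF nu2, of "y - x"] by simp
      define P where "P = gauss \<nu> (y - x) * exp (- F x / (4 * \<nu>)) * exp (- F y / (4 * \<nu>))"
      have "exp (- F x / (2 * \<nu>)) * g x * ((1 - same s x y) * ker x y * g y) = (1 - same s x y) * P * (h x * h y)"
        unfolding ker_def P_def h_def e2 by (simp add: mult_ac)
      also have "\<dots> \<le> \<eta> * gauss (2 * \<nu>) (y - x) * (h x * h y)"
      proof (intro mult_right_mono mult_nonneg_nonneg h0)
        show "(1 - same s x y) * P \<le> \<eta> * gauss (2 * \<nu>) (y - x)"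
        proof (cases "same s x y = 0")
          case True
          then show ?thesis using event_bound[OF far s(2) True] by (simp add: P_def \<eta>_def mult_ac)
        next
          case False
          then have "same s x y = 1" using same_cases[of s x y] by auto
          then show ?thesis using \<eta> g2 by simp
        qed
      qed
      also have "\<dots> \<le> \<eta> * gauss (2 * \<nu>) (y - x) * ((G x + G y) / 2)"
      proof (intro mult_left_mono mult_nonneg_nonneg \<eta> g2)
        have "0 \<le> (h x - h y)\<^sup>2" by simp
        then show "h x * h y \<le> (G x + G y) / 2" by (simp add: hG[symmetric] power2_eq_square algebra_simps)
      qed
      finally show "exp (- F x / (2 * \<nu>)) * g x * ((1 - same s x y) * ker x y * g y)
         \<le> \<eta> / 2 * (gauss (2 * \<nu>) (y - x) * G x + gauss (2 * \<nu>) (y - x) * G y)"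
        by (simp add: algebra_simps)
    qed
    also have "\<dots> = \<eta> / 2 * (G x + H.L G x)"
      using Hint[of x] nu2 by (simp add: HL integral_gauss_shift)
    finally show ?thesis .
  qed
  have iG: "integrable lborel (\<lambda>x. indicator cube x * G x)" "integrable lborel (\<lambda>x. indicator cube x * H.L G x)"
    using integrable_cube[OF G(1)] integrable_cube[OF plin_bmp[OF H.L_plin G(1)]] by auto
  have "ip g (opr (\<lambda>x y. 1 - same s x y) g) \<le> (\<integral>x. \<eta> / 2 * (indicator cube x * G x + indicator cube x * H.L G x) \<partial>lborel)"
    unfolding ip_def
  proof (rule integral_mono)
    fix x show "indicator cube x * (exp (- F x / (2 * \<nu>)) * (g x * opr (\<lambda>x y. 1 - same s x y) g x))
      \<le> \<eta> / 2 * (indicator cube x * G x + indicator cube x * H.L G x)"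
      using pw[of x] by (auto simp: indicator_def)
  next
    show "integrable lborel (\<lambda>x. indicator cube x * (exp (- F x / (2 * \<nu>)) * (g x * opr (\<lambda>x y. 1 - same s x y) g x)))"
      by (rule ip_integrable[OF g(1) opr_bmp[OF we g(1)]])
  qed (use iG in auto)
  also have "\<dots> = \<eta> / 2 * ((\<integral>x. indicator cube x * G x \<partial>lborel) + (\<integral>x. indicator cube x * H.L G x \<partial>lborel))"
    using iG by simp
  also have "(\<integral>x. indicator cube x * H.L G x \<partial>lborel) = (\<integral>x. indicator cube x * G x \<partial>lborel)"
    unfolding HL by (rule integral_cube_gauss[OF G nu2])
  also have "(\<integral>x. indicator cube x * G x \<partial>lborel) = ip g g" by (simp add: ip_def G_def)
  also have "\<eta> / 2 * (ip g g + ip g g) \<le> \<rho> / 2 * ip g g"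
    using mult_right_mono[OF \<eta>(2) ip_nonneg[of g g]] by simp
  finally show ?thesis .
qed

text \<open>The subtraction removes at least the share \<open>\<beta> / C1\<close> of the part
  inside the small wells. The convex combination, with weights \<open>1 - \<beta> / C1\<close> and
  \<open>\<beta> / C1\<close>, of the bound \<open>\<rho>\<close> for the full form and
  \<open>\<rho> / 2\<close> for the far part is exactly \<open>\<theta> * \<rho>\<close>.\<close>

lemma q'_le:
  assumes g: "bmp g" "\<And>x. 0 \<le> g x"
  shows "q' g \<le> \<theta> * \<rho> * ip g g"
proof -
  define I where "I = ip g g"
  have I0: "0 \<le> I" unfolding I_def by (rule ip_nonneg) simp
  have we: "weight (\<lambda>x y. 1 - same s x y)" using weight_not_same[of 1 0 s] by simp
  have "L g = (\<lambda>x. 1 * opr (same s) g x + 1 * opr (\<lambda>x y. 1 - same s x y) g x)"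
    using opr_weight_lin[OF weight_same[of s] we g(1), where a=1 and b=1] by (simp add: L_def fun_eq_iff)
  then have "ip g (L g) = 1 * ip g (opr (same s) g) + 1 * ip g (opr (\<lambda>x y. 1 - same s x y) g)"
    by (simp only:) (intro ip_lin_right opr_bmp we weight_same g)
  then have "ip g (L g) \<le> C1 * (J g)\<^sup>2 + \<rho> / 2 * I"
    using near_part[OF g] far_part[OF g] by (simp add: I_def)
  then have 1: "\<beta> / C1 * (ip g (L g) - \<rho> / 2 * I) \<le> \<beta> / C1 * (C1 * (J g)\<^sup>2)"
    using beta by (intro mult_left_mono) auto
  have 2: "(1 - \<beta> / C1) * ip g (L g) \<le> (1 - \<beta> / C1) * (\<rho> * I)"
    using form_le[OF g] beta unfolding I_def by (intro mult_left_mono) auto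
  have "q' g = ip g (L g) - \<beta> / C1 * (C1 * (J g)\<^sup>2)" using beta by (simp add: q'_def)
  also have "\<dots> \<le> (1 - \<beta> / C1) * ip g (L g) + \<beta> / C1 * (\<rho> / 2 * I)"
    using 1 by (simp add: algebra_simps)
  also have "\<dots> \<le> (1 - \<beta> / C1) * (\<rho> * I) + \<beta> / C1 * (\<rho> / 2 * I)" using 2 by simp
  also have "\<dots> = \<theta> * \<rho> * I" by (simp add: \<theta>_def algebra_simps)
  finally show ?thesis by (simp add: I_def)
qed

lemma q'_bound:
  assumes f: "bmp f" shows "\<bar>q' f\<bar> \<le> \<theta> * \<rho> * ip f f"
proof -
  have "q' (\<lambda>x. \<bar>f x\<bar>) \<le> \<theta> * \<rho> * ip (\<lambda>x. \<bar>f x\<bar>) (\<lambda>x. \<bar>f x\<bar>)" by (intro q'_le bmp_abs f) simp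
  also have "ip (\<lambda>x. \<bar>f x\<bar>) (\<lambda>x. \<bar>f x\<bar>) = ip f f" by (simp add: ip_def)
  finally show ?thesis using q'_abs[OF f] by simp
qed

text \<open>Orthogonality to \<open>w\<close> is not the same as vanishing mean over the well, so a
  multiple of \<open>w\<close> is added to kill \<open>J\<close>. The added part contributes with
  factor \<open>\<rho>\<close> on the left and only \<open>\<theta> * \<rho>\<close> on the right,
  which is favourable. From below, the subtracted square already has the right sign.\<close>

lemma form_perp:
  assumes f: "bmp f" "ip f w = 0"
  shows "\<bar>ip f (L f)\<bar> \<le> \<theta> * \<rho> * ip f f"
proof -
  note bL = plin_bmp[OF L_plin]
  have "- ip f (L f) \<le> - q' f" using beta by (simp add: q'_def)
  then have lower: "- ip f (L f) \<le> \<theta> * \<rho> * ip f f" using q'_bound[OF f(1)] by linarith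
  have Jw: "0 < J w"
  proof -
    have "J w \<noteq> 0"
    proof
      assume "J w = 0"
      then have "AE y in lborel. indicator (ball 0 s) y * exp (- F y / (2 * \<nu>)) * w y = 0"
        unfolding J_int using J_integrable[OF w(1)] w(2)
        by (subst (asm) integral_nonneg_eq_0_iff_AE)
          (auto intro!: AE_I2 mult_nonneg_nonneg simp: less_imp_le)
      then have "AE x in lborel. x \<notin> (ball 0 s :: (real ^ 'd) set)"
        by eventually_elim (use w(2) in \<open>auto simp: indicator_def less_imp_neq[symmetric]\<close>)
      then have "emeasure lborel (ball 0 s :: (real ^ 'd) set) = 0"
        by (subst (asm) AE_iff_measurable[where N="ball 0 s"]) auto
      then show False using s(1) unit_ball_vol_pos[of "real CARD('d)"] by (simp add: emeasure_ball)
    qed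
    moreover have "0 \<le> J w" unfolding J_def using w(2) same_nonneg
      by (intro ip_nonneg mult_nonneg_nonneg) (auto simp: well_def intro: less_imp_le)
    ultimately show ?thesis by linarith
  qed
  define t where "t = - J f / J w"
  define g where "g x = 1 * f x + t * w x" for x
  have g: "bmp g" unfolding g_def by (intro bmp_lin f w)
  have "J g = 1 * J f + t * J w" unfolding g_def by (intro J_lin f w)
  then have Jg: "J g = 0" using Jw by (simp add: t_def)
  have gx: "ip g h = 1 * ip f h + t * ip w h" if "bmp h" for h unfolding g_def by (intro ip_lin_left f w that)
  have Lg: "L g = (\<lambda>x. 1 * L f x + t * L w x)" unfolding g_def by (intro plin_lin[OF L_plin] f w)
  have wf: "ip w f = 0" using f(2) by (simp add: ip_commute)
  have w_scale: "ip h (L w) = \<rho> * ip h w" if "bmp h" for h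
    using ip_lin_right[OF that w(1) w(1), of \<rho> 0] by (simp add: L_w)
  have wLf: "ip w (L f) = 0" using ip_L_commute[OF w(1) f(1)] w_scale[OF f(1)] f(2) by simp
  have gLg: "ip g (L g) = ip f (L f) + t\<^sup>2 * \<rho> * ip w w"
  proof -
    have "ip g (L g) = 1 * ip g (L f) + t * ip g (L w)" unfolding Lg by (intro ip_lin_right g bL f w)
    also have "ip g (L f) = ip f (L f)" using gx[OF bL[OF f(1)]] wLf by simp
    also have "ip g (L w) = t * (\<rho> * ip w w)"
      using gx[OF bL[OF w(1)]] w_scale[OF f(1)] w_scale[OF w(1)] f(2) by simp
    finally show ?thesis by (simp add: power2_eq_square)
  qed
  have gg: "ip g g = ip f f + t\<^sup>2 * ip w w"
  proof -
    have "ip g g = ip f g + t * ip w g" using gx[OF g] by simp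
    also have "ip f g = ip f f" using gx[OF f(1)] wf by (simp add: ip_commute[of f g])
    also have "ip w g = t * ip w w" using gx[OF w(1)] f(2) by (simp add: ip_commute[of w g])
    finally show ?thesis by (simp add: power2_eq_square)
  qed
  have "ip f (L f) + t\<^sup>2 * \<rho> * ip w w \<le> \<theta> * \<rho> * (ip f f + t\<^sup>2 * ip w w)"
    using q'_bound[OF g] Jg gLg gg by (simp add: q'_def)
  then have "ip f (L f) \<le> \<theta> * \<rho> * ip f f - (1 - \<theta>) * (t\<^sup>2 * (\<rho> * ip w w))"
    by (simp add: algebra_simps)
  also have "\<dots> \<le> \<theta> * \<rho> * ip f f"
    using theta rho ip_pos[OF w] by simp
  finally show ?thesis using lower by (simp add: abs_le_iff)
qed

lemma L_perp: "bmp f \<Longrightarrow> ip f w = 0 \<Longrightarrow> ip (L f) w = 0"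
proof -
  assume f: "bmp f" "ip f w = 0"
  have "ip (L f) w = ip f (L w)" using ip_L_commute[OF w(1) f(1)] by (simp add: ip_commute)
  also have "\<dots> = \<rho> * ip f w" using ip_lin_right[OF f(1) w(1) w(1), of \<rho> 0] by (simp add: L_w)
  finally show ?thesis using f by simp
qed

text \<open>From the quadratic form to the norm by polarisation: the form bound is applied to
  \<open>k * f + h\<close> and \<open>k * f - h\<close> with \<open>h = L f\<close>. The difference
  of the forms is \<open>4 * k * ip h h\<close>, since symmetry gives
  \<open>ip f (L h) = ip h h\<close>.\<close>

lemma gap:
  assumes f: "bmp f" "ip f w = 0"
  shows "ip (L f) (L f) \<le> (\<theta> * \<rho>)\<^sup>2 * ip f f"
proof -
  note bL = plin_bmp[OF L_plin]
  define h where "h = L f"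
  have h: "bmp h" "ip h w = 0" unfolding h_def using L_perp[OF f] bL[OF f(1)] by auto
  define k where "k = \<theta> * \<rho>"
  have k: "k > 0" using theta rho by (simp add: k_def)
  define S where "S = ip h h"
  have hf: "ip f (L h) = S" "ip h (L f) = S"
    using ip_L_commute[OF f(1) h(1)] by (simp_all add: S_def h_def)
  have both: "ip (\<lambda>x. k * f x + b * h x) (L (\<lambda>x. k * f x + b * h x)) = k\<^sup>2 * ip f (L f) + 2 * k * b * S + b\<^sup>2 * ip h (L h)"
    "ip (\<lambda>x. k * f x + b * h x) (\<lambda>x. k * f x + b * h x) = k\<^sup>2 * ip f f + 2 * k * b * ip f h + b\<^sup>2 * S"
    "ip (\<lambda>x. k * f x + b * h x) w = 0" for b
  proof -
    note p = bmp_lin[OF f(1) h(1), of k b]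
    show "ip (\<lambda>x. k * f x + b * h x) (L (\<lambda>x. k * f x + b * h x)) = k\<^sup>2 * ip f (L f) + 2 * k * b * S + b\<^sup>2 * ip h (L h)"
      unfolding plin_lin[OF L_plin f(1) h(1)] ip_lin_right[OF p bL[OF f(1)] bL[OF h(1)]]
        ip_lin_left[OF bL[OF f(1)] f(1) h(1)] ip_lin_left[OF bL[OF h(1)] f(1) h(1)]
      by (simp add: hf power2_eq_square algebra_simps)
    show "ip (\<lambda>x. k * f x + b * h x) (\<lambda>x. k * f x + b * h x) = k\<^sup>2 * ip f f + 2 * k * b * ip f h + b\<^sup>2 * S"
      unfolding ip_lin_right[OF p f(1) h(1)] ip_lin_left[OF f(1) f(1) h(1)] ip_lin_left[OF h(1) f(1) h(1)]
      by (simp add: S_def ip_commute[of h f] power2_eq_square algebra_simps)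
    show "ip (\<lambda>x. k * f x + b * h x) w = 0" unfolding ip_lin_left[OF w(1) f(1) h(1)] using f h by simp
  qed
  have "\<bar>k\<^sup>2 * ip f (L f) + 2 * k * b * S + b\<^sup>2 * ip h (L h)\<bar> \<le> k * (k\<^sup>2 * ip f f + 2 * k * b * ip f h + b\<^sup>2 * S)" for b
    using form_perp[OF bmp_lin[OF f(1) h(1), of k b] both(3)[of b], folded k_def] unfolding both .
  note bound = this
  define X Y where "X = k\<^sup>2 * ip f (L f) + ip h (L h)" "Y = k * (k\<^sup>2 * ip f f)"
  have "X + 2 * k * S \<le> Y + k * (2 * k * ip f h) + k * S"
    using order_trans[OF abs_ge_self bound[of 1]] by (simp add: X_Y_def algebra_simps)
  moreover have "2 * k * S - X \<le> Y - k * (2 * k * ip f h) + k * S"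
    using order_trans[OF abs_ge_minus_self bound[of "-1"]] by (simp add: X_Y_def algebra_simps)
  ultimately have "4 * k * S \<le> 2 * k * (k\<^sup>2 * ip f f) + 2 * k * S"
    unfolding X_Y_def(2) by linarith
  then have "k * S \<le> k * (k\<^sup>2 * ip f f)" by (simp add: mult.commute)
  then have "S \<le> k\<^sup>2 * ip f f" using k by simp
  then show ?thesis by (simp add: S_def h_def k_def)
qed

lemma gap_power:
  assumes f: "bmp f" "ip f w = 0"
  shows "ip ((L ^^ n) f) w = 0" "ip ((L ^^ n) f) ((L ^^ n) f) \<le> (\<theta> * \<rho>) ^ (2 * n) * ip f f"
proof -
  have "ip ((L ^^ n) f) w = 0 \<and> ip ((L ^^ n) f) ((L ^^ n) f) \<le> (\<theta> * \<rho>) ^ (2 * n) * ip f f"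
  proof (induction n)
    case (Suc n)
    have b: "bmp ((L ^^ n) f)" by (rule plin_bmp[OF Ln_plin f(1)])
    have "ip (L ((L ^^ n) f)) (L ((L ^^ n) f)) \<le> (\<theta> * \<rho>)\<^sup>2 * ip ((L ^^ n) f) ((L ^^ n) f)"
      using gap[OF b] Suc by simp
    also have "\<dots> \<le> (\<theta> * \<rho>)\<^sup>2 * ((\<theta> * \<rho>) ^ (2 * n) * ip f f)" using Suc by (intro mult_left_mono) auto
    finally show ?case using L_perp[OF b] Suc by (simp add: power2_eq_square mult_ac)
  qed (use f in simp)
  then show "ip ((L ^^ n) f) w = 0" "ip ((L ^^ n) f) ((L ^^ n) f) \<le> (\<theta> * \<rho>) ^ (2 * n) * ip f f" by auto
qed

end

subsection \<open>Existence of the stationary solution\<close>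

context kicked
begin

definition osc_ratio :: real where "osc_ratio = exp (- (real CARD('d))\<^sup>2 / (2 * \<nu>))"

lemma osc_ratio: "0 < osc_ratio" "osc_ratio < 1" using nu_pos by (auto simp: osc_ratio_def)

lemma slow_osc': "slow u \<Longrightarrow> bmp u \<Longrightarrow> (\<And>x. 0 < u x) \<Longrightarrow> osc_ratio * u y \<le> u x"
  using slow_osc[of u y x] by (simp add: osc_ratio_def exp_minus field_simps)

text \<open>A Harnack inequality after one kick. The regularity estimate requires strict positivity,
  so a small constant is added and then removed.\<close>

lemma L_osc:
  assumes f: "bmp f" "\<And>x. 0 \<le> f x" shows "osc_ratio * L f y \<le> L f x"
proof (rule field_le_epsilon)
  fix e :: real assume e: "e > 0"
  have b: "bmp (\<lambda>x. 1 * f x + e * 1)" by (intro bmp_lin f bmp_const)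
  have p: "0 < 1 * f x + e * 1" for x using f(2)[of x] e by (simp add: add_nonneg_pos)
  have "osc_ratio * L (\<lambda>x. 1 * f x + e * 1) y \<le> L (\<lambda>x. 1 * f x + e * 1) x"
    by (intro slow_osc' L_slow plin_bmp[OF L_plin] L_pos b p)
  moreover have "0 \<le> osc_ratio * (e * L (\<lambda>_. 1) y)"
    using osc_ratio e plin_pos[OF L_plin bmp_const[of 1], of y] by (intro mult_nonneg_nonneg) auto
  moreover have "e * L (\<lambda>_. 1) x \<le> e * 1" using L_one_le[of x] e by (intro mult_left_mono) auto
  ultimately show "osc_ratio * L f y \<le> L f x + e"
    unfolding plin_lin[OF L_plin f(1) bmp_const] by (simp add: algebra_simps)
qed

text \<open>Contraction of positive operators in the manner of Birkhoff and Hopf: by the Harnack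
  inequality for \<open>u - m * v\<close> and for \<open>v\<close>, the smallest excess of the new
  quotient over \<open>m\<close> is at least \<open>osc_ratio\<^sup>2\<close> times the
  largest.\<close>

lemma ratio_contraction:
  assumes u: "bmp u" and v: "bmp v" "\<And>x. 0 < v x" and b: "\<And>x. m * v x \<le> u x" "\<And>x. u x \<le> M * v x"
  shows "\<exists>m' M'. m \<le> m' \<and> M' - m' \<le> (1 - osc_ratio\<^sup>2) * (M - m) \<and> (\<forall>x. m' * L v x \<le> L u x \<and> L u x \<le> M' * L v x)"
proof -
  have Lv: "0 < L v x" for x by (rule L_pos[OF v])
  define f where "f x = 1 * u x + (- m) * v x" for x
  have f: "bmp f" "\<And>x. 0 \<le> f x" unfolding f_def using b(1) by (auto intro!: bmp_lin[of u v 1 "- m", simplified] u v)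
  have Lf: "L f x = L u x - m * L v x" for x
    unfolding f_def plin_lin[OF L_plin u v(1)] by simp
  define r where "r x = L f x / L v x" for x
  have Lf0: "0 \<le> L f x" for x by (rule plin_pos[OF L_plin f])
  have r0: "0 \<le> r x" for x using Lv[of x] Lf0[of x] by (simp add: r_def)
  have rM: "r x \<le> M - m" for x
  proof -
    have "L f x \<le> L (\<lambda>x. (M - m) * v x) x"
      using b(2) by (intro plin_mono[OF L_plin] f bmp_scale v) (simp add: f_def algebra_simps)
    then show ?thesis using Lv[of x] by (simp add: r_def plin_scale[OF L_plin v(1)] divide_le_eq)
  qed
  have rr: "osc_ratio\<^sup>2 * r y \<le> r x" for x y
  proof -
    have "(osc_ratio * L f y) * (osc_ratio * L v x) \<le> L f x * L v y"
      using L_osc[OF f, of y x] L_osc[OF v(1) less_imp_le[OF v(2)], of x y] osc_ratio Lf0 Lv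
      by (intro mult_mono mult_nonneg_nonneg) (auto intro: less_imp_le)
    then show ?thesis using Lv[of x] Lv[of y] by (simp add: r_def field_simps power2_eq_square)
  qed
  define S where "S = (SUP x. r x)"
  have bdd: "bdd_above (range r)" using rM by (auto simp: bdd_above_def)
  have S: "r x \<le> S" for x unfolding S_def by (rule cSUP_upper[OF _ bdd]) simp
  have SM: "S \<le> M - m" unfolding S_def by (rule cSUP_least) (use rM in auto)
  have S0: "0 \<le> S" using r0[of 0] S[of 0] by linarith
  have Sq: "osc_ratio\<^sup>2 * S \<le> r x" for x
  proof -
    have "S \<le> r x / osc_ratio\<^sup>2" unfolding S_def
      by (rule cSUP_least) (use rr[of _ x] osc_ratio in \<open>auto simp: field_simps\<close>)
    then show ?thesis using osc_ratio by (simp add: field_simps)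
  qed
  have rx: "L u x = (m + r x) * L v x" for x using Lf[of x] Lv[of x] by (simp add: r_def field_simps)
  show ?thesis
  proof (intro exI conjI allI)
    show "m \<le> m + osc_ratio\<^sup>2 * S" using S0 by simp
    show "(m + S) - (m + osc_ratio\<^sup>2 * S) \<le> (1 - osc_ratio\<^sup>2) * (M - m)"
    proof -
      have "osc_ratio\<^sup>2 \<le> 1" using osc_ratio by (simp add: power_le_one)
      then have "(1 - osc_ratio\<^sup>2) * S \<le> (1 - osc_ratio\<^sup>2) * (M - m)" using SM by (intro mult_left_mono) auto
      then show ?thesis by (simp add: algebra_simps)
    qed
    fix x show "(m + osc_ratio\<^sup>2 * S) * L v x \<le> L u x" "L u x \<le> (m + S) * L v x"
      unfolding rx using Sq[of x] S[of x] Lv[of x] by (auto intro!: mult_right_mono)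
  qed
qed

text \<open>Power iteration from the constant 1, normalised at the origin. The quotients of
  successive iterates flatten out geometrically, so the logarithms of the normalised iterates form a
  convergent series, and dominated convergence passes to the limit in the integral.\<close>

lemma eigenfunction_exists:
  "\<exists>w \<rho>. bmp w \<and> (\<forall>x. 0 < w x) \<and> 0 < \<rho> \<and> (\<forall>x. L w x = \<rho> * w x)"
proof -
  define one where "one = (\<lambda>_ :: real ^ 'd. 1 :: real)"
  have one: "bmp one" "\<And>x. 0 < one x" by (auto simp: one_def)
  define U where "U n = (L ^^ n) one" for n
  have U: "bmp (U n)" "0 < U n x" for n x
    unfolding U_def by (auto intro!: plin_bmp[OF Ln_plin] Ln_pos one)
  have US: "U (Suc n) = L (U n)" for n by (simp add: U_def)
  define m0 where "m0 = osc_ratio * L one 0"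
  have m0: "0 < m0" using osc_ratio L_pos[OF one, of 0] by (simp add: m0_def)
  define k where "k = 1 - osc_ratio\<^sup>2"
  have k: "0 \<le> k" "k < 1" using osc_ratio by (auto simp: k_def power_le_one)
  define r where "r n x = U (Suc n) x / U n x" for n x
  have bounds: "\<exists>m M. m0 \<le> m \<and> M - m \<le> k ^ n * (1 - m0) \<and> (\<forall>x. m * U n x \<le> U (Suc n) x \<and> U (Suc n) x \<le> M * U n x)" for n
  proof (induction n)
    case 0
    have "m0 \<le> L one x" for x unfolding m0_def by (rule L_osc) (use one in \<open>auto intro: less_imp_le\<close>)
    moreover have "L one x \<le> 1" for x using L_one_le by (simp add: one_def)
    ultimately show ?case by (intro exI[of _ m0] exI[of _ 1]) (auto simp: US U_def one_def)
  next
    case (Suc n)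
    then obtain m M where mM: "m0 \<le> m" "M - m \<le> k ^ n * (1 - m0)"
      "\<And>x. m * U n x \<le> U (Suc n) x" "\<And>x. U (Suc n) x \<le> M * U n x" by blast
    obtain m' M' where *: "m \<le> m'" "M' - m' \<le> k * (M - m)" "\<forall>x. m' * L (U n) x \<le> L (U (Suc n)) x \<and> L (U (Suc n)) x \<le> M' * L (U n) x"
      using ratio_contraction[OF U(1) U(1,2) mM(3,4)] unfolding k_def by blast
    have "M' - m' \<le> k * (k ^ n * (1 - m0))"
      using *(2) mult_left_mono[OF mM(2) k(1)] by linarith
    then show ?case using * mM(1) by (intro exI[of _ m'] exI[of _ M']) (auto simp: US)
  qed
  have r_pos: "0 < r n x" for n x using U(2) by (simp add: r_def)
  have dist: "\<bar>ln (r n x) - ln (r n y)\<bar> \<le> k ^ n * ((1 - m0) / m0)" for n x y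
  proof -
    obtain m M where mM: "m0 \<le> m" "M - m \<le> k ^ n * (1 - m0)"
      "\<And>x. m * U n x \<le> U (Suc n) x" "\<And>x. U (Suc n) x \<le> M * U n x" using bounds[of n] by blast
    have rb: "m \<le> r n x" "r n x \<le> M" for x
      using mM(3,4)[of x] U(2)[of n x] by (auto simp: r_def field_simps)
    have "ln (r n x) - ln (r n y) \<le> k ^ n * ((1 - m0) / m0)" for x y
    proof -
      have "ln (r n x) - ln (r n y) = ln (r n x / r n y)"
        using r_pos[of n x] r_pos[of n y] by (simp add: ln_div)
      also have "\<dots> \<le> r n x / r n y - 1" using r_pos by (intro ln_le_minus_one) simp
      also have "\<dots> = (r n x - r n y) / r n y" using r_pos[of n y] by (simp add: field_simps)
      also have "\<dots> \<le> (k ^ n * (1 - m0)) / m0"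
      proof (rule frac_le)
        have "m \<le> M" using rb[of x] by linarith
        then show "0 \<le> k ^ n * (1 - m0)" using mM(2) by linarith
        show "r n x - r n y \<le> k ^ n * (1 - m0)" using rb(2)[of x] rb(1)[of y] mM(2) by linarith
      qed (use m0 mM(1) rb(1)[of y] in auto)
      finally show ?thesis by simp
    qed
    from this[of x y] this[of y x] show ?thesis by (simp add: abs_le_iff)
  qed
  define S where "S n x = U n x / U n 0" for n x
  have S_pos: "0 < S n x" for n x using U(2) by (simp add: S_def)
  have lnS: "ln (S n x) = (\<Sum>i<n. ln (r i x) - ln (r i 0))" for n x
  proof (induction n)
    case 0 then show ?case by (simp add: S_def U_def one_def)
  next
    case (Suc n)
    have "S (Suc n) x = S n x * (r n x / r n 0)"
      using U(2)[of n x] U(2)[of n 0] by (simp add: S_def r_def)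
    then have "ln (S (Suc n) x) = ln (S n x) + (ln (r n x) - ln (r n 0))"
      using S_pos[of n x] r_pos[of n x] r_pos[of n 0] by (simp add: ln_mult ln_div)
    then show ?case using Suc by simp
  qed
  have "summable (\<lambda>n. ln (r n x) - ln (r n 0))" for x
  proof (rule summable_comparison_test')
    show "summable (\<lambda>n. k ^ n * ((1 - m0) / m0))"
      by (intro summable_mult2 summable_geometric) (use k in simp)
    show "norm (ln (r n x) - ln (r n 0)) \<le> k ^ n * ((1 - m0) / m0)" for n
      using dist[of n x 0] by simp
  qed
  then have lim: "(\<lambda>n. ln (S n x)) \<longlonglongrightarrow> (\<Sum>n. ln (r n x) - ln (r n 0))" for x
    unfolding lnS by (rule summable_LIMSEQ)
  define w where "w x = exp (\<Sum>n. ln (r n x) - ln (r n 0))" for x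
  have limS: "(\<lambda>n. S n x) \<longlonglongrightarrow> w x" for x
    using tendsto_exp[OF lim[of x]] S_pos by (simp add: w_def)
  have S_le: "S n x \<le> 1 / osc_ratio" for n x
  proof (cases n)
    case 0 then show ?thesis using osc_ratio by (simp add: S_def U_def one_def)
  next
    case (Suc n')
    have "osc_ratio * U n x \<le> U n 0" unfolding Suc US by (rule L_osc) (use U in \<open>auto intro: less_imp_le\<close>)
    then show ?thesis using U(2)[of n 0] osc_ratio by (simp add: S_def field_simps)
  qed
  have bS: "bmp (S n)" for n using bmp_scale[OF U(1), of "1 / U n 0" n] by (simp add: S_def[abs_def])
  have w: "bmp w" "\<And>x. 0 < w x"
  proof -
    note [measurable] = bmpD(1)[OF bS]
    have "w \<in> borel_measurable borel" by (rule borel_measurable_LIMSEQ_real[OF limS]) measurable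
    moreover have "periodic w"
      unfolding periodic_def
    proof (intro allI ballI)
      fix x k :: "real ^ 'd" assume "k \<in> integer_lattice"
      then have "(\<lambda>n. S n (x + k)) = (\<lambda>n. S n x)" using bmpD(2)[OF bS] by simp
      then show "w (x + k) = w x" using limS[of x] limS[of "x + k"] LIMSEQ_unique by simp
    qed
    moreover have "\<bar>w x\<bar> \<le> 1 / osc_ratio" for x
      using LIMSEQ_le_const2[OF limS, of x "1 / osc_ratio"] S_le by (auto simp: w_def)
    ultimately show "bmp w" by (auto simp: bmp_def)
    show "0 < w x" for x by (simp add: w_def)
  qed
  have limL: "(\<lambda>n. L (S n) x) \<longlonglongrightarrow> L w x" for x
    unfolding L_eq
  proof (rule integral_dominated_convergence)
    show "integrable lborel (\<lambda>y. ker x y * (1 / osc_ratio))" using L_integrable[OF bmp_const] .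
    show "AE y in lborel. (\<lambda>n. ker x y * S n y) \<longlonglongrightarrow> ker x y * w y"
      by (intro AE_I2 tendsto_mult_left limS)
    show "AE y in lborel. norm (ker x y * S n y) \<le> ker x y * (1 / osc_ratio)" for n
    proof (rule AE_I2)
      fix y show "norm (ker x y * S n y) \<le> ker x y * (1 / osc_ratio)"
        using mult_left_mono[OF S_le[of n y] ker_nonneg[of x y]] S_pos[of n y] ker_nonneg[of x y] by (simp add: abs_mult)
    qed
  qed (use borel_measurable_integrable[OF L_integrable] w(1) bS in auto)
  \<comment> \<open>In the limit this becomes the eigenvalue equation, with eigenvalue
    \<open>L w 0\<close> because \<open>w\<close> is normalised at 0.\<close>
  have LS: "L (S n) x = S (Suc n) x * L (S n) 0" for n x
  proof -
    have "L (S n) z = U (Suc n) z / U n 0" for z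
      using plin_scale[OF L_plin U(1), of "1 / U n 0" n] by (simp add: S_def[abs_def] US)
    then show ?thesis using U(2)[of "Suc n" 0] by (simp add: S_def)
  qed
  have "L w x = L w 0 * w x" for x
  proof -
    have "(\<lambda>n. S (Suc n) x * L (S n) 0) \<longlonglongrightarrow> w x * L w 0"
      by (intro tendsto_mult LIMSEQ_Suc[OF limS] limL)
    moreover have "(\<lambda>n. S (Suc n) x * L (S n) 0) = (\<lambda>n. L (S n) x)"
      by (rule ext) (rule LS[symmetric])
    ultimately have "w x * L w 0 = L w x" using limL[of x] by (metis LIMSEQ_unique)
    then show ?thesis by (simp only: mult.commute)
  qed
  then show ?thesis using w L_pos[OF w, of 0] by blast
qed

lemma stationary_exists: "\<exists>\<psi>. stationary_solution \<nu> F \<psi>"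
proof -
  obtain w \<rho> where w: "bmp w" "\<And>x. 0 < w x" and \<rho>: "0 < \<rho>" "\<And>x. L w x = \<rho> * w x"
    using eigenfunction_exists by blast
  interpret kicked_eigen F \<nu> w \<rho> by unfold_locales (use w \<rho> in auto)
  define \<psi> where "\<psi> x = - 2 * \<nu> * ln (w x)" for x
  have "exp (- \<psi> y / (2 * \<nu>)) = w y" for y using w(2)[of y] nu_pos by (simp add: \<psi>_def)
  moreover have "\<psi> \<in> C_per 0"
    using slow_cont[OF w_slow w(2)] w(2) bmpD(2)[OF w(1)]
    by (auto simp: C_per_def \<psi>_def periodic_def intro!: continuous_intros less_imp_neq[symmetric])
  moreover have "- 2 * \<nu> * ln (L w x) - \<psi> x = - 2 * \<nu> * ln \<rho>" for x
    using w(2)[of x] \<rho> by (simp add: \<psi>_def ln_mult algebra_simps)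
  ultimately show ?thesis
    unfolding stationary_solution_def kick_heat_op_eq by (intro exI[of _ \<psi>]) auto
qed

lemma bmp_exp: "\<phi> \<in> C_per 0 \<Longrightarrow> bmp (\<lambda>y. exp (- \<phi> y / (2 * \<nu>)))"
  using nu_pos by (intro bmp_cont continuous_intros) (auto simp: C_per_def periodic_def)

lemma stationary_eigen:
  assumes "stationary_solution \<nu> F \<psi>"
  shows "\<exists>\<rho>. kicked_eigen F \<nu> (\<lambda>y. exp (- \<psi> y / (2 * \<nu>))) \<rho>"
proof -
  define w where "w = (\<lambda>y. exp (- \<psi> y / (2 * \<nu>)))"
  obtain c where \<psi>: "\<psi> \<in> C_per 0" and c: "\<And>x. - 2 * \<nu> * ln (L w x) - \<psi> x = c"
    using assms unfolding stationary_solution_def kick_heat_op_eq w_def by blast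
  have w: "bmp w" "\<And>x. 0 < w x" using bmp_exp[OF \<psi>] by (auto simp: w_def)
  have "L w x = exp (- c / (2 * \<nu>)) * w x" for x
  proof -
    have "ln (L w x) = - c / (2 * \<nu>) + - \<psi> x / (2 * \<nu>)" using c[of x] nu_pos by (simp add: field_simps)
    then have "exp (ln (L w x)) = exp (- c / (2 * \<nu>)) * w x" by (simp add: w_def mult_exp_exp)
    then show ?thesis using L_pos[OF w, of x] by simp
  qed
  then have "kicked_eigen F \<nu> w (exp (- c / (2 * \<nu>)))"
    by unfold_locales (use w in auto)
  then show ?thesis unfolding w_def by blast
qed

end

subsection \<open>The kick potential near its minimum\<close>

lemma partial_derivs:
  fixes f :: "real ^ 'd \<Rightarrow> real"
  assumes f: "f differentiable (at x)"
  shows "(f has_derivative (\<lambda>v. \<Sum>i\<in>UNIV. v $ i * partial_deriv i f x)) (at x)"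
proof -
  have d: "(f has_derivative frechet_derivative f (at x)) (at x)"
    using f by (simp add: frechet_derivative_works)
  then have "linear (frechet_derivative f (at x))" by (rule has_derivative_linear)
  then interpret D: linear "frechet_derivative f (at x)" .
  have "frechet_derivative f (at x) v = (\<Sum>i\<in>UNIV. v $ i * partial_deriv i f x)" for v
  proof -
    have "v = (\<Sum>i\<in>UNIV. v $ i *\<^sub>R axis i 1)"
      using basis_expansion[of v] by (simp add: scalar_mult_eq_scaleR)
    then have "frechet_derivative f (at x) v = frechet_derivative f (at x) (\<Sum>i\<in>UNIV. v $ i *\<^sub>R axis i 1)" by simp
    then show ?thesis by (simp add: D.sum D.scale partial_deriv_def)
  qed
  then have "frechet_derivative f (at x) = (\<lambda>v. \<Sum>i\<in>UNIV. v $ i * partial_deriv i f x)" by (rule ext)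
  with d show ?thesis by simp
qed

lemma line_deriv:
  fixes f :: "real ^ 'd \<Rightarrow> real"
  assumes f: "\<And>x. f differentiable (at x)"
  shows "((\<lambda>t. f (x + t *\<^sub>R v)) has_real_derivative (\<Sum>i\<in>UNIV. v $ i * partial_deriv i f (x + t *\<^sub>R v))) (at t)"
proof -
  have "((\<lambda>t. f (x + t *\<^sub>R v)) has_derivative (\<lambda>h. \<Sum>i\<in>UNIV. (h *\<^sub>R v) $ i * partial_deriv i f (x + t *\<^sub>R v))) (at t)"
    by (rule has_derivative_compose[OF _ partial_derivs[OF f]]) (auto intro!: derivative_eq_intros)
  moreover have "(\<lambda>h. \<Sum>i\<in>UNIV. (h *\<^sub>R v) $ i * partial_deriv i f (x + t *\<^sub>R v)) =
      times (\<Sum>i\<in>UNIV. v $ i * partial_deriv i f (x + t *\<^sub>R v))"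
    by (simp add: fun_eq_iff sum_distrib_left mult_ac)
  ultimately show ?thesis by (simp add: has_field_derivative_def)
qed

text \<open>The order of the partial derivatives is the one obtained by differentiating the
  directional derivative once more along the same line; exchanging the two sums gives the quadratic
  form of \<open>hessian\<close>.\<close>

definition hess_form :: "(real ^ 'd \<Rightarrow> real) \<Rightarrow> real ^ 'd \<Rightarrow> real ^ 'd \<Rightarrow> real" where
  "hess_form F x v = (\<Sum>i\<in>UNIV. \<Sum>j\<in>UNIV. v $ i * (v $ j * partial_deriv j (partial_deriv i F) x))"

lemma line_deriv2:
  fixes F :: "real ^ 'd \<Rightarrow> real"
  assumes F: "\<And>i x. partial_deriv i F differentiable (at x)"
  shows "((\<lambda>t. \<Sum>i\<in>UNIV. v $ i * partial_deriv i F (x + t *\<^sub>R v)) has_real_derivative hess_form F (x + t *\<^sub>R v) v) (at t)"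
  unfolding hess_form_def sum_distrib_left[symmetric]
  by (intro DERIV_sum DERIV_cmult line_deriv F)

lemma hess_form_eq: "hess_form F x v = v \<bullet> (hessian F x *v v)"
proof -
  have "v \<bullet> (hessian F x *v v) = (\<Sum>i\<in>UNIV. \<Sum>j\<in>UNIV. v $ i * (partial_deriv i (partial_deriv j F) x * v $ j))"
    by (simp add: inner_vec_def matrix_vector_mult_def hessian_def sum_distrib_left)
  also have "\<dots> = hess_form F x v"
    unfolding hess_form_def by (subst sum.swap) (simp add: mult_ac)
  finally show ?thesis by simp
qed

lemma hess_form_perturb:
  assumes "\<And>i j. \<bar>partial_deriv j (partial_deriv i F) x - H i j\<bar> \<le> e"
  shows "\<bar>hess_form F x v - (\<Sum>i\<in>UNIV. \<Sum>j\<in>UNIV. v $ i * (v $ j * H i j))\<bar> \<le> (real CARD('d))\<^sup>2 * e * (norm (v :: real ^ 'd))\<^sup>2"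
proof -
  have "hess_form F x v - (\<Sum>i\<in>UNIV. \<Sum>j\<in>UNIV. v $ i * (v $ j * H i j)) =
     (\<Sum>i\<in>UNIV. \<Sum>j\<in>UNIV. v $ i * (v $ j * (partial_deriv j (partial_deriv i F) x - H i j)))"
    unfolding hess_form_def by (simp add: sum_subtractf[symmetric] algebra_simps)
  also have "\<bar>\<dots>\<bar> \<le> (\<Sum>i\<in>(UNIV::'d set). \<Sum>j\<in>(UNIV::'d set). norm v * (norm v * e))"
  proof (intro order_trans[OF sum_abs] sum_mono)
    fix i j :: 'd
    show "\<bar>v $ i * (v $ j * (partial_deriv j (partial_deriv i F) x - H i j))\<bar> \<le> norm v * (norm v * e)"
      unfolding abs_mult using assms[of j i] by (intro mult_mono component_le_norm_cart) auto
  qed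
  also have "\<dots> = (real CARD('d))\<^sup>2 * e * (norm v)\<^sup>2" by (simp add: power2_eq_square mult_ac)
  finally show ?thesis .
qed

lemma hess_form_scale: "hess_form F x (c *\<^sub>R v) = c\<^sup>2 * hess_form F x v"
  by (simp add: hess_form_def sum_distrib_left power2_eq_square mult_ac)

lemma hess_form_near_zero:
  fixes F :: "real ^ 'd \<Rightarrow> real"
  assumes cont: "\<And>i j. continuous_on UNIV (partial_deriv j (partial_deriv i F))"
    and pd: "positive_definite (hessian F 0)"
  shows "\<exists>\<kappa> C \<delta>. 0 < \<kappa> \<and> 0 < C \<and> 0 < \<delta> \<and>
    (\<forall>x\<in>ball 0 \<delta>. \<forall>v. \<kappa> * (norm v)\<^sup>2 \<le> hess_form F x v \<and> hess_form F x v \<le> C * (norm v)\<^sup>2)"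
proof -
  let ?d = "real CARD('d)"
  obtain k where k: "0 < k" "\<And>v. norm v = 1 \<Longrightarrow> k \<le> hess_form F 0 v"
  proof -
    have "compact (sphere 0 1 :: (real ^ 'd) set)" by simp
    moreover have "axis undefined 1 \<in> (sphere 0 1 :: (real ^ 'd) set)" by simp
    moreover have "continuous_on (sphere 0 1) (hess_form F 0)"
      unfolding hess_form_def[abs_def] by (intro continuous_intros)
    ultimately obtain v0 where v0: "v0 \<in> sphere 0 1" "\<And>v. v \<in> sphere 0 1 \<Longrightarrow> hess_form F 0 v0 \<le> hess_form F 0 v"
      using continuous_attains_inf[of "sphere 0 1 :: (real ^ 'd) set" "hess_form F 0"] by blast
    have "v0 \<noteq> 0" using v0(1) by auto
    then have "0 < hess_form F 0 v0" using pd by (simp add: positive_definite_def hess_form_eq)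
    then show ?thesis using v0(2) by (intro that[of "hess_form F 0 v0"]) auto
  qed
  have k_all: "k * (norm v)\<^sup>2 \<le> hess_form F 0 v" for v
  proof (cases "v = 0")
    case False
    have "k \<le> hess_form F 0 ((1 / norm v) *\<^sub>R v)" using False by (intro k) simp
    then show ?thesis using False unfolding hess_form_scale by (simp add: field_simps power2_eq_square)
  qed (simp add: hess_form_def)
  \<comment> \<open>A change of each second derivative by at most \<open>e\<close> moves the form by
    at most half of its minimum \<open>k\<close> on the unit sphere.\<close>
  define e where "e = k / (2 * ?d\<^sup>2)"
  have e: "0 < e" "?d\<^sup>2 * e = k / 2" using k by (auto simp: e_def)
  define M where "M = (\<Sum>i\<in>UNIV. \<Sum>j\<in>UNIV. \<bar>partial_deriv j (partial_deriv i F) 0\<bar>)"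
  have M: "\<bar>partial_deriv j (partial_deriv i F) 0\<bar> \<le> M" for i j
  proof -
    have "\<bar>partial_deriv j (partial_deriv i F) 0\<bar> \<le> (\<Sum>j\<in>UNIV. \<bar>partial_deriv j (partial_deriv i F) 0\<bar>)"
      by (rule member_le_sum) auto
    also have "\<dots> \<le> M" unfolding M_def
      by (rule member_le_sum[where f="\<lambda>i. \<Sum>j\<in>UNIV. \<bar>partial_deriv j (partial_deriv i F) 0\<bar>"]) (auto intro: sum_nonneg)
    finally show ?thesis .
  qed
  have "\<forall>\<^sub>F x in nhds 0. \<bar>partial_deriv j (partial_deriv i F) x - partial_deriv j (partial_deriv i F) 0\<bar> < e" for i j
  proof -
    have "isCont (partial_deriv j (partial_deriv i F)) 0" using cont continuous_on_eq_continuous_at by blast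
    then show ?thesis
      using e(1) unfolding continuous_at_eps_delta eventually_nhds_metric dist_real_def by blast
  qed
  then have "\<forall>\<^sub>F x in nhds 0. \<forall>i j. \<bar>partial_deriv j (partial_deriv i F) x - partial_deriv j (partial_deriv i F) 0\<bar> < e"
    by (intro eventually_all_finite) auto
  then obtain \<delta> where \<delta>: "0 < \<delta>"
    "\<And>x i j. x \<in> ball 0 \<delta> \<Longrightarrow> \<bar>partial_deriv j (partial_deriv i F) x - partial_deriv j (partial_deriv i F) 0\<bar> < e"
    unfolding eventually_nhds_metric by (auto simp: dist_commute)
  have main: "k / 2 * (norm v)\<^sup>2 \<le> hess_form F x v \<and> hess_form F x v \<le> (?d\<^sup>2 * M + k / 2) * (norm v)\<^sup>2"
    if x: "x \<in> ball 0 \<delta>" for x v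
  proof -
    have 1: "\<bar>hess_form F x v - hess_form F 0 v\<bar> \<le> k / 2 * (norm v)\<^sup>2"
      using hess_form_perturb[of F x "\<lambda>i j. partial_deriv j (partial_deriv i F) 0" e v] \<delta>(2)[OF x] e(2)
      by (simp add: hess_form_def[of F 0] less_imp_le)
    have 2: "\<bar>hess_form F 0 v\<bar> \<le> ?d\<^sup>2 * M * (norm v)\<^sup>2"
      using hess_form_perturb[of F 0 "\<lambda>i j. 0" M v] M by simp
    have "(?d\<^sup>2 * M + k / 2) * (norm v)\<^sup>2 = ?d\<^sup>2 * M * (norm v)\<^sup>2 + k / 2 * (norm v)\<^sup>2"
      "k * (norm v)\<^sup>2 = k / 2 * (norm v)\<^sup>2 + k / 2 * (norm v)\<^sup>2"
      by (simp_all add: algebra_simps)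
    then show ?thesis using abs_le_D1[OF 1] abs_le_D2[OF 1] abs_le_D1[OF 2] k_all[of v] by linarith
  qed
  have "0 \<le> M" using M[of undefined undefined] by linarith
  then have "0 < ?d\<^sup>2 * M + k / 2" using k by (intro add_nonneg_pos) auto
  with main k \<delta>(1) show ?thesis
    by (intro exI[of _ "k / 2"] exI[of _ "?d\<^sup>2 * M + k / 2"] exI[of _ \<delta>]) auto
qed

text \<open>Collects all that the constants depend on. The two Hessian bounds near 0 yield strong
  convexity and the quadratic upper bound; compactness of a cell without the wells yields
  \<open>c1\<close>.\<close>

lemma kick_potential:
  fixes F :: "real ^ 'd \<Rightarrow> real"
  assumes F: "F \<in> C_per 3" "F 0 = 0" and argmin: "{x. is_arg_min F (\<lambda>_. True) x} = integer_lattice"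
    and pd: "positive_definite (hessian F 0)"
  obtains r \<kappa> c1 FM CF where
    "continuous_on UNIV F" "periodic F" "\<And>x. 0 \<le> F x" "0 < r" "r \<le> 1 / 4" "0 < \<kappa>" "0 < c1" "0 \<le> CF"
    "\<And>x y t. x \<in> ball 0 r \<Longrightarrow> y \<in> ball 0 r \<Longrightarrow> 0 \<le> t \<Longrightarrow> t \<le> 1 \<Longrightarrow>
      F ((1 - t) *\<^sub>R x + t *\<^sub>R y) \<le> (1 - t) * F x + t * F y - \<kappa> / 2 * (t * (1 - t)) * (norm (x - y))\<^sup>2"
    "\<And>z. (\<And>k. k \<in> integer_lattice \<Longrightarrow> z \<notin> ball k r) \<Longrightarrow> c1 \<le> F z"
    "\<And>x. F x \<le> FM" "\<And>y. y \<in> ball 0 r \<Longrightarrow> F y \<le> CF * (norm y)\<^sup>2"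
proof -
  have per: "periodic F" and d0: "\<And>x. F differentiable (at x)" and d1: "\<And>i x. partial_deriv i F differentiable (at x)"
    and d2: "\<And>i j x. partial_deriv j (partial_deriv i F) differentiable (at x)"
    using F(1) by (auto simp: C_per_def numeral_3_eq_3)
  have cont: "continuous_on UNIV F" "\<And>i j. continuous_on UNIV (partial_deriv j (partial_deriv i F))"
    using d0 d2 by (auto simp: continuous_on_eq_continuous_at intro: differentiable_imp_continuous_within)
  have min: "x \<in> integer_lattice \<longleftrightarrow> (\<forall>y. F x \<le> F y)" for x
    using argmin unfolding is_arg_min_def set_eq_iff by (auto simp: not_less)
  have nonneg: "0 \<le> F x" for x using min[of 0] F(2) by simp
  have zero: "x \<in> integer_lattice" if "F x \<le> 0" for x using min[of x] nonneg that by (auto intro: order_trans)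
  obtain \<kappa> C \<delta> where kC: "0 < \<kappa>" "0 < C" "0 < \<delta>"
    "\<And>x v. x \<in> ball 0 \<delta> \<Longrightarrow> \<kappa> * (norm v)\<^sup>2 \<le> hess_form F x v"
    "\<And>x v. x \<in> ball 0 \<delta> \<Longrightarrow> hess_form F x v \<le> C * (norm v)\<^sup>2"
    using hess_form_near_zero[OF cont(2) pd] by blast
  define r where "r = min \<delta> (1 / 4)"
  have r: "0 < r" "r \<le> 1 / 4" "ball 0 r \<subseteq> (ball 0 \<delta> :: (real ^ 'd) set)" using kC(3) by (auto simp: r_def)
  have convex: "F ((1 - t) *\<^sub>R x + t *\<^sub>R y) \<le> (1 - t) * F x + t * F y - \<kappa> / 2 * (t * (1 - t)) * (norm (x - y))\<^sup>2"
    if xy: "x \<in> ball 0 r" "y \<in> ball 0 r" and t: "0 \<le> t" "t \<le> 1" for x y t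
  proof -
    define v where "v = y - x"
    define N where "N = (norm v)\<^sup>2"
    \<comment> \<open>Strong convexity is ordinary convexity after subtraction of the quadratic part
      along the segment.\<close>
    define g where "g s = F (x + s *\<^sub>R v) - \<kappa> / 2 * N * s\<^sup>2" for s
    have "convex_on {0..1} g"
    proof (rule f''_ge0_imp_convex)
      fix s :: real assume s: "s \<in> {0..1}"
      show "(g has_real_derivative ((\<Sum>i\<in>UNIV. v $ i * partial_deriv i F (x + s *\<^sub>R v)) - \<kappa> * N * s)) (at s)"
        unfolding g_def by (auto intro!: derivative_eq_intros line_deriv d0)
      show "((\<lambda>s. (\<Sum>i\<in>UNIV. v $ i * partial_deriv i F (x + s *\<^sub>R v)) - \<kappa> * N * s) has_real_derivative
          (hess_form F (x + s *\<^sub>R v) v - \<kappa> * N)) (at s)"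
        by (rule DERIV_diff[OF line_deriv2[OF d1]]) (auto intro!: derivative_eq_intros)
      have "x + s *\<^sub>R v = (1 - s) *\<^sub>R x + s *\<^sub>R y" by (simp add: v_def algebra_simps)
      then have "x + s *\<^sub>R v \<in> ball 0 r" using convexD_alt[OF convex_ball xy, of s] s by simp
      then show "0 \<le> hess_form F (x + s *\<^sub>R v) v - \<kappa> * N" using kC(4) r(3) by (auto simp: N_def)
    qed simp
    from convex_onD[OF this t, of 0 1] have "g t \<le> (1 - t) * g 0 + t * g 1" by simp
    define K where "K = \<kappa> / 2 * N"
    have gK: "g s = F (x + s *\<^sub>R v) - K * s\<^sup>2" for s by (simp add: g_def K_def)
    have "F (x + t *\<^sub>R v) \<le> (1 - t) * F x + t * F y - K * (t * (1 - t))"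
      using \<open>g t \<le> _\<close> unfolding gK by (simp add: v_def power2_eq_square algebra_simps)
    moreover have "x + t *\<^sub>R v = (1 - t) *\<^sub>R x + t *\<^sub>R y" by (simp add: v_def algebra_simps)
    moreover have "K * (t * (1 - t)) = \<kappa> / 2 * (t * (1 - t)) * (norm (x - y))\<^sup>2"
      by (simp add: K_def N_def v_def norm_minus_commute mult_ac)
    ultimately show ?thesis by (simp only:)
  qed
  have quad: "F y \<le> C / 2 * (norm y)\<^sup>2" if y: "y \<in> ball 0 r" for y
  proof -
    define N where "N = (norm y)\<^sup>2"
    \<comment> \<open>Convex by the upper Hessian bound and with zero slope at 0, where
      \<open>F\<close> is minimal; hence \<open>g 1 \<ge> g 0\<close>. The interval is taken
      symmetric so that 0 is an interior point for the tangent.\<close>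
    define g where "g s = C / 2 * N * s\<^sup>2 - F (0 + s *\<^sub>R y)" for s
    define g' where "g' s = C * N * s - (\<Sum>i\<in>UNIV. y $ i * partial_deriv i F (0 + s *\<^sub>R y))" for s
    have g': "(g has_real_derivative g' s) (at s)" for s
      unfolding g_def g'_def by (auto intro!: derivative_eq_intros line_deriv d0 simp del: add_0)
    have "convex_on {-1..1} g"
    proof (rule f''_ge0_imp_convex)
      fix s :: real assume s: "s \<in> {-1..1}"
      show "(g has_real_derivative g' s) (at s)" by (rule g')
      show "(g' has_real_derivative (C * N - hess_form F (0 + s *\<^sub>R y) y)) (at s)"
        unfolding g'_def by (rule DERIV_diff[OF _ line_deriv2[OF d1]]) (auto intro!: derivative_eq_intros)
      have "\<bar>s\<bar> * norm y \<le> 1 * norm y" using s by (intro mult_right_mono) auto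
      then have "0 + s *\<^sub>R y \<in> ball 0 r" using y by simp
      then show "0 \<le> C * N - hess_form F (0 + s *\<^sub>R y) y" using kC(5) r(3) by (auto simp: N_def simp del: add_0)
    qed simp
    then have "g 1 - g 0 \<ge> g' 0 * (1 - 0)"
      by (rule convex_on_imp_above_tangent) (auto intro: has_field_derivative_at_within g')
    moreover have "g' 0 = 0"
    proof -
      have "((\<lambda>s. F (0 + s *\<^sub>R y)) has_real_derivative (\<Sum>i\<in>UNIV. y $ i * partial_deriv i F (0 + 0 *\<^sub>R y))) (at 0)"
        by (rule line_deriv[OF d0])
      then have "(\<Sum>i\<in>UNIV. y $ i * partial_deriv i F (0 + 0 *\<^sub>R y)) = 0"
        by (rule DERIV_local_min[of _ _ _ 1]) (use nonneg F(2) in auto)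
      then show ?thesis by (simp add: g'_def)
    qed
    ultimately show ?thesis by (simp add: g_def N_def F(2))
  qed
  obtain FM where FM: "\<And>x. F x \<le> FM" using periodic_bounded[OF cont(1) per] by (auto simp: abs_le_iff)
  define K where "K = cball 0 (real CARD('d)) - (\<Union>k\<in>integer_lattice. ball k r :: (real ^ 'd) set)"
  have "\<exists>c>0. \<forall>x\<in>K. c \<le> F x"
  proof (cases "K = {}")
    case False
    have "compact K" unfolding K_def by (intro compact_diff compact_cball open_UN) auto
    then obtain x0 where x0: "x0 \<in> K" "\<And>x. x \<in> K \<Longrightarrow> F x0 \<le> F x"
      using continuous_attains_inf[of K F] False cont(1) by (auto intro: continuous_on_subset)
    have "x0 \<notin> integer_lattice" using x0(1) r(1) by (auto simp: K_def)
    then have "0 < F x0" using zero[of x0] by linarith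
    then show ?thesis using x0(2) by blast
  qed (auto intro: exI[of _ 1])
  then obtain c1 where c1: "0 < c1" "\<And>x. x \<in> K \<Longrightarrow> c1 \<le> F x" by blast
  have far: "c1 \<le> F z" if z: "\<And>k. k \<in> integer_lattice \<Longrightarrow> z \<notin> ball k r" for z
  proof -
    have "z - nearest z \<notin> ball k r" if k: "k \<in> integer_lattice" for k
      using z[OF lattice_add[OF k nearest_in_lattice[of z]]] by (simp add: dist_norm algebra_simps)
    then have "z - nearest z \<in> K"
      using norm_cube_le[OF diff_nearest_in_cube[of z]] by (auto simp: K_def)
    then have "c1 \<le> F (z - nearest z)" by (rule c1)
    also have "\<dots> = F z"
      using per lattice_minus[OF nearest_in_lattice[of z]] unfolding periodic_def by (metis add_uminus_conv_diff)
    finally show ?thesis .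
  qed
  have "0 \<le> C / 2" using kC(2) by simp
  then show ?thesis
    by (rule that[OF cont(1) per nonneg r(1,2) kC(1) c1(1) _ convex far FM quad])
qed

subsection \<open>Exponential convergence\<close>

context kicked_eigen
begin

lemma Ln_w: "(L ^^ n) w = (\<lambda>x. \<rho> ^ n * w x)"
proof (induction n)
  case (Suc n)
  then show ?case using plin_scale[OF L_plin w(1), of "\<rho> ^ n"] by (simp add: L_w mult_ac)
qed simp

end

context kicked_gap
begin

text \<open>The first \<open>n1\<close> kicks make the solution comparable to the eigenfunction up
  to \<open>K\<^sup>2\<close>, so its component orthogonal to \<open>w\<close> is controlled in
  norm; the gap acts during the next \<open>k\<close> kicks; the last \<open>n1\<close> kicks return
  to pointwise values. No bound on \<open>u\<close> enters.\<close>

lemma late_ratio: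
  assumes K: "1 \<le> K"
    and cr: "\<And>f x y. bmp f \<Longrightarrow> (\<And>x. 0 < f x) \<Longrightarrow> (L ^^ n1) f y * w x \<le> K * (w y * (L ^^ n1) f x)"
    and u: "bmp u" "\<And>x. 0 < u x"
  shows "ln ((L ^^ (n1 + (k + n1))) u x / w x) - ln ((L ^^ (n1 + (k + n1))) u y / w y) \<le> 4 * K ^ 3 * \<theta> ^ k"
proof -
  define v where "v = (L ^^ n1) u"
  have v: "bmp v" "\<And>x. 0 < v x" unfolding v_def by (auto intro: plin_bmp[OF Ln_plin] Ln_pos u)
  \<comment> \<open>The scale of \<open>v\<close> relative to \<open>w\<close>: the cross ratio
    bound with the origin gives \<open>p * w \<le> v \<le> K\<^sup>2 * p * w\<close>, and
    \<open>p\<close> cancels at the end.\<close>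
  define p where "p = v 0 / w 0 / K"
  have p: "0 < p" using v w K by (simp add: p_def)
  have v_low: "p * w x \<le> v x" for x
    using cr[OF u, of 0 x] K w(2)[of 0] by (simp add: p_def v_def field_simps)
  have v_up: "v x \<le> K\<^sup>2 * p * w x" for x
    using cr[OF u, of x 0] K w(2)[of 0] by (simp add: p_def v_def field_simps power2_eq_square)
  define W where "W = ip w w"
  have W: "0 < W" unfolding W_def by (rule ip_pos[OF w])
  define \<alpha> where "\<alpha> = ip v w / W"
  define f where "f x = 1 * v x + (- \<alpha>) * w x" for x
  have f: "bmp f" unfolding f_def by (intro bmp_lin v w)
  have fw: "ip f w = 0"
    unfolding f_def ip_lin_left[OF w(1) v(1) w(1)] using W by (simp add: \<alpha>_def W_def)
  have "ip f f \<le> (K\<^sup>2 * p)\<^sup>2 * W"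
  proof -
    have "ip f f = 1 * ip v f + (- \<alpha>) * ip w f"
      using ip_lin_left[OF f v(1) w(1), of 1 "- \<alpha>"] unfolding f_def[symmetric] .
    also have "\<dots> = 1 * ip v v + (- \<alpha>) * ip v w"
      using fw ip_lin_right[OF v(1) v(1) w(1), of 1 "- \<alpha>"] unfolding f_def[symmetric] ip_commute[of w f] by simp
    also have "\<dots> \<le> ip v v" using W ip_nonneg[of v w] less_imp_le[OF v(2)] less_imp_le[OF w(2)]
      by (simp add: \<alpha>_def)
    also have "\<dots> \<le> ip (\<lambda>x. K\<^sup>2 * p * w x) (\<lambda>x. K\<^sup>2 * p * w x)"
      using v_up v p K by (intro ip_mono v bmp_scale w mult_mono) (auto intro: less_imp_le order_trans[OF less_imp_le])
    also have "\<dots> = (K\<^sup>2 * p)\<^sup>2 * W"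
      using ip_lin_right[OF bmp_scale[OF w(1)] w(1) w(1), of "K\<^sup>2 * p" "K\<^sup>2 * p" 0]
        ip_lin_left[OF w(1) w(1) w(1), of "K\<^sup>2 * p" 0] by (simp add: W_def power2_eq_square)
    finally show ?thesis .
  qed
  then have "(\<theta> * \<rho>) ^ (2 * k) * ip f f \<le> (\<theta> * \<rho>) ^ (2 * k) * ((K\<^sup>2 * p)\<^sup>2 * W)"
    using theta rho by (intro mult_left_mono) auto
  define fk where "fk = (L ^^ k) f"
  define Q where "Q = (\<theta> * \<rho>) ^ k * (K\<^sup>2 * p)"
  have Q: "0 < Q" using theta rho K p by (simp add: Q_def)
  have fk: "bmp fk" "ip fk fk \<le> Q\<^sup>2 * W"
  proof -
    have "Q\<^sup>2 = (\<theta> * \<rho>) ^ (2 * k) * (K\<^sup>2 * p)\<^sup>2"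
      by (simp only: Q_def power_mult_distrib power_even_eq)
    then show "ip fk fk \<le> Q\<^sup>2 * W"
      using gap_power(2)[OF f fw, of k] \<open>(\<theta> * \<rho>) ^ (2 * k) * ip f f \<le> _\<close> by (simp only: fk_def mult.assoc)
  qed (simp add: fk_def plin_bmp[OF Ln_plin f])
  \<comment> \<open>The cross ratio bound requires a strictly positive function, so
    \<open>\<bar>fk\<bar>\<close> is raised by a multiple of \<open>w\<close> of the same size in
    norm.\<close>
  define g where "g x = 1 * \<bar>fk x\<bar> + Q * w x" for x
  have g: "bmp g" "\<And>x. 0 < g x"
    unfolding g_def using Q w(2) by (auto intro!: bmp_lin[OF bmp_abs[OF fk(1)] w(1), of 1 Q, simplified] add_nonneg_pos)
  have wg: "ip w g \<le> 2 * Q * W"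
  proof -
    have "ip w g \<le> ip (\<lambda>_. 1) (\<lambda>x. (1 / (2 * Q)) * (fk x * fk x) + (3 * Q / 2) * (w x * w x))"
    proof (intro ip_mono w g bmp_const bmp_lin bmp_mult fk)
      fix x
      have "0 \<le> (\<bar>fk x\<bar> - Q * w x)\<^sup>2 / (2 * Q)" using Q by simp
      also have "\<dots> = (1 / (2 * Q)) * (fk x * fk x) + (Q / 2) * (w x * w x) - \<bar>fk x\<bar> * w x"
        using Q by (simp add: power2_eq_square field_simps)
      finally show "w x * g x \<le> 1 * ((1 / (2 * Q)) * (fk x * fk x) + (3 * Q / 2) * (w x * w x))"
        by (simp add: g_def algebra_simps)
    qed
    also have "\<dots> = (1 / (2 * Q)) * ip (\<lambda>_. 1) (\<lambda>x. fk x * fk x) + (3 * Q / 2) * ip (\<lambda>_. 1) (\<lambda>x. w x * w x)"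
      by (intro ip_lin_right bmp_const bmp_mult fk w)
    also have "\<dots> = (1 / (2 * Q)) * ip fk fk + (3 * Q / 2) * W" by (simp add: ip_def W_def)
    also have "\<dots> \<le> (1 / (2 * Q)) * (Q\<^sup>2 * W) + (3 * Q / 2) * W"
      using fk(2) Q by (intro add_right_mono mult_left_mono) auto
    also have "\<dots> = 2 * Q * W" using Q by (simp add: power2_eq_square field_simps)
    finally show ?thesis .
  qed
  have Lg: "(L ^^ n1) g y \<le> 2 * K * \<rho> ^ n1 * Q * w y" for y
  proof -
    have bLg: "bmp ((L ^^ n1) g)" by (rule plin_bmp[OF Ln_plin g(1)])
    \<comment> \<open>Averaging the cross ratio bound over \<open>x\<close> with weight
      \<open>w\<close> bounds a point value by a mean, which symmetry and the eigenvalue equation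
      evaluate exactly.\<close>
    have "ip w (\<lambda>x. (L ^^ n1) g y * w x) \<le> ip w (\<lambda>x. K * w y * (L ^^ n1) g x)"
      using cr[OF g] w(2) by (intro ip_mono bmp_scale w bLg mult_left_mono) (auto simp: mult_ac intro: less_imp_le)
    moreover have "ip w (\<lambda>x. (L ^^ n1) g y * w x) = (L ^^ n1) g y * W"
      using ip_lin_right[OF w(1) w(1) w(1), of "(L ^^ n1) g y" 0] by (simp add: W_def)
    moreover have "ip w (\<lambda>x. K * w y * (L ^^ n1) g x) = K * w y * ip w ((L ^^ n1) g)"
      using ip_lin_right[OF w(1) bLg bLg, of "K * w y" 0] by simp
    moreover have "ip w ((L ^^ n) g) = \<rho> ^ n * ip w g" for n
    proof (induction n)
      case (Suc n)
      have b: "bmp ((L ^^ n) g)" by (rule plin_bmp[OF Ln_plin g(1)])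
      have "ip w (L ((L ^^ n) g)) = ip ((L ^^ n) g) (L w)" by (rule ip_L_commute[OF w(1) b])
      also have "\<dots> = \<rho> * ip ((L ^^ n) g) w" using ip_lin_right[OF b w(1) w(1), of \<rho> 0] by (simp add: L_w)
      finally show ?case using Suc by (simp add: ip_commute[of _ w])
    qed simp
    ultimately have "(L ^^ n1) g y * W \<le> K * w y * (\<rho> ^ n1 * ip w g)" by simp
    also have "\<dots> \<le> K * w y * (\<rho> ^ n1 * (2 * Q * W))"
      using wg K rho w(2)[of y] by (intro mult_left_mono) auto
    finally have "(L ^^ n1) g y * W \<le> (2 * K * \<rho> ^ n1 * Q * w y) * W" by (simp add: mult_ac)
    then show ?thesis using W by simp
  qed
  define M where "M = n1 + k"
  have bound: "\<bar>(L ^^ M) f y\<bar> \<le> 2 * K ^ 3 * \<theta> ^ k * p * (\<rho> ^ M * w y)" for y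
  proof -
    have "\<bar>(L ^^ M) f y\<bar> = \<bar>(L ^^ n1) fk y\<bar>" by (simp add: M_def fk_def funpow_add)
    also have "\<dots> \<le> (L ^^ n1) (\<lambda>x. \<bar>fk x\<bar>) y" by (rule plin_abs[OF Ln_plin fk(1)])
    also have "\<dots> \<le> (L ^^ n1) g y"
      using Q w(2) by (intro plin_mono[OF Ln_plin] bmp_abs fk g) (auto simp: g_def intro: less_imp_le mult_nonneg_nonneg)
    also have "\<dots> \<le> 2 * K * \<rho> ^ n1 * Q * w y" by (rule Lg)
    also have "\<dots> = 2 * K ^ 3 * \<theta> ^ k * p * (\<rho> ^ M * w y)"
      by (simp add: Q_def M_def power_add power_mult_distrib power3_eq_cube power2_eq_square mult_ac)
    finally show ?thesis .
  qed
  define G where "G x = (L ^^ M) v x / (\<rho> ^ M * w x)" for x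
  have rw: "0 < \<rho> ^ M * w x" for x using rho w by simp
  have Gp: "p \<le> G x" for x
  proof -
    have "(L ^^ M) (\<lambda>x. p * w x) x \<le> (L ^^ M) v x" by (intro plin_mono[OF Ln_plin] bmp_scale w v v_low)
    then show ?thesis unfolding plin_scale[OF Ln_plin w(1)] Ln_w G_def using rw[of x] by (simp add: pos_le_divide_eq)
  qed
  have Ga: "\<bar>G x - \<alpha>\<bar> \<le> 2 * K ^ 3 * \<theta> ^ k * p" for x
  proof -
    have "(L ^^ M) f x = 1 * (L ^^ M) v x + (- \<alpha>) * (L ^^ M) w x"
      unfolding f_def plin_lin[OF Ln_plin v(1) w(1)] ..
    then have "(L ^^ M) f x = (G x - \<alpha>) * (\<rho> ^ M * w x)" using rho w(2)[of x] by (simp add: Ln_w G_def left_diff_distrib)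
    then have "\<bar>G x - \<alpha>\<bar> * (\<rho> ^ M * w x) \<le> 2 * K ^ 3 * \<theta> ^ k * p * (\<rho> ^ M * w x)"
      using bound[of x] rho w(2)[of x] by (simp add: abs_mult)
    then show ?thesis by (rule mult_right_le_imp_le) (rule rw)
  qed
  have Lu: "(L ^^ (n1 + (k + n1))) u x / w x = \<rho> ^ M * G x" for x
    using rho by (simp add: G_def v_def M_def funpow_add)
  have G0: "0 < G x" for x using Gp[of x] p by linarith
  have "ln ((L ^^ (n1 + (k + n1))) u x / w x) - ln ((L ^^ (n1 + (k + n1))) u y / w y) = ln (G x / G y)"
    unfolding Lu using G0[of x] G0[of y] rho by (simp add: ln_mult ln_div)
  also have "\<dots> \<le> G x / G y - 1" using G0 by (intro ln_le_minus_one) simp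
  also have "\<dots> = (G x - G y) / G y" using G0[of y] by (simp add: field_simps)
  also have "\<dots> \<le> (4 * K ^ 3 * \<theta> ^ k * p) / p"
  proof (rule frac_le)
    show "0 \<le> 4 * K ^ 3 * \<theta> ^ k * p" using K theta p by (intro mult_nonneg_nonneg) auto
    show "G x - G y \<le> 4 * K ^ 3 * \<theta> ^ k * p" using Ga[of x] Ga[of y] by (simp add: abs_le_iff)
  qed (use p Gp in auto)
  also have "\<dots> = 4 * K ^ 3 * \<theta> ^ k" using p by simp
  finally show ?thesis .
qed

end

section \<open>The norm modulo constants and elementary inequalities for the constants\<close>

lemma star_norm_le:
  fixes f :: "real ^ 'd \<Rightarrow> real"
  assumes "\<And>x. \<bar>f x + c\<bar> \<le> K" shows "star_norm f \<le> K"
proof -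
  have bdd: "bdd_above (range (\<lambda>x. \<bar>f x + b\<bar>))" for b
  proof (rule bdd_aboveI2)
    fix x show "\<bar>f x + b\<bar> \<le> K + \<bar>b - c\<bar>" using assms[of x] by linarith
  qed
  have "0 \<le> (SUP x. \<bar>f x + b\<bar>)" for b by (rule cSUP_upper2[OF bdd, of 0]) auto
  then have "star_norm f \<le> (SUP x. \<bar>f x + c\<bar>)"
    unfolding star_norm_def by (intro cINF_lower) (auto intro!: bdd_belowI2)
  also have "\<dots> \<le> K" by (rule cSUP_least) (use assms in auto)
  finally show ?thesis .
qed

lemma star_norm_nonneg:
  fixes f :: "real ^ 'd \<Rightarrow> real"
  assumes "\<And>x. \<bar>f x\<bar> \<le> M" shows "0 \<le> star_norm f"
proof -
  have bdd: "bdd_above (range (\<lambda>x. \<bar>f x + b\<bar>))" for b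
  proof (rule bdd_aboveI2)
    fix x show "\<bar>f x + b\<bar> \<le> M + \<bar>b\<bar>" using assms[of x] by linarith
  qed
  have "0 \<le> (SUP x. \<bar>f x + b\<bar>)" for b by (rule cSUP_upper2[OF bdd, of 0]) auto
  then show ?thesis unfolding star_norm_def by (intro cINF_greatest) auto
qed

lemma star_norm_diff_le:
  fixes f g :: "real ^ 'd \<Rightarrow> real"
  assumes f: "\<And>x. \<bar>f x\<bar> \<le> M" and g: "\<And>x. \<bar>g x + b\<bar> \<le> K"
  shows "star_norm (\<lambda>x. f x - g x) \<le> star_norm f + K"
proof -
  have "star_norm (\<lambda>x. f x - g x) - K \<le> (SUP x. \<bar>f x + c\<bar>)" for c
  proof -
    have bdd: "bdd_above (range (\<lambda>x. \<bar>f x + c\<bar>))"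
    proof (rule bdd_aboveI2)
      fix x show "\<bar>f x + c\<bar> \<le> M + \<bar>c\<bar>" using f[of x] by linarith
    qed
    have "star_norm (\<lambda>x. f x - g x) \<le> (SUP x. \<bar>f x + c\<bar>) + K"
    proof (rule star_norm_le[where c="c - b"])
      fix x
      have "\<bar>f x + c\<bar> \<le> (SUP x. \<bar>f x + c\<bar>)" by (rule cSUP_upper[OF _ bdd]) simp
      then show "\<bar>f x - g x + (c - b)\<bar> \<le> (SUP x. \<bar>f x + c\<bar>) + K" using g[of x] by linarith
    qed
    then show ?thesis by simp
  qed
  then have "star_norm (\<lambda>x. f x - g x) - K \<le> star_norm f"
    unfolding star_norm_def[of f] by (intro cINF_greatest) auto
  then show ?thesis by simp
qed

text \<open>Converts the requirement that losses per kick, over a time of order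
  \<open>ln (1 / \<nu>)\<close>, stay below \<open>exp (1 / \<nu>)\<close> into an explicit
  smallness condition on \<nu>.\<close>

lemma log_le_reciprocal:
  fixes A B \<nu> :: real
  assumes "0 \<le> A" "0 \<le> B" "0 < \<nu>" "\<nu> \<le> 1 / (2 * B + A + 1)\<^sup>2"
  shows "A + B * ln (1 / \<nu>) \<le> 1 / \<nu>"
proof -
  define y where "y = sqrt (1 / \<nu>)"
  have y: "0 < y" "y * y = 1 / \<nu>" using assms by (auto simp: y_def real_sqrt_mult[symmetric])
  have q: "0 < 2 * B + A + 1" using assms by linarith
  have "(2 * B + A + 1)\<^sup>2 \<le> 1 / \<nu>" using assms q by (simp add: field_simps)
  then have "2 * B + A + 1 \<le> y" unfolding y_def by (rule real_le_rsqrt)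
  then have "(2 * B + A + 1) * y \<le> y * y" using y by (intro mult_right_mono) auto
  moreover have "1 \<le> y" using \<open>2 * B + A + 1 \<le> y\<close> assms by linarith
  then have "A * 1 \<le> A * y" using assms by (intro mult_left_mono) auto
  moreover have "ln (1 / \<nu>) \<le> 2 * y"
  proof -
    have "ln (1 / \<nu>) = ln (y * y)" using y(2) by simp
    also have "\<dots> = 2 * ln y" using y(1) by (simp add: ln_mult)
    also have "\<dots> \<le> 2 * y" using ln_le_minus_one[OF y(1)] by simp
    finally show ?thesis .
  qed
  then have "B * ln (1 / \<nu>) \<le> B * (2 * y)" using assms by (intro mult_left_mono)
  ultimately show ?thesis using y by (simp add: algebra_simps)
qed

lemma cosh_small:
  fixes \<kappa> :: real assumes "0 < \<kappa>" shows "\<exists>\<tau>>0. (cosh \<tau>)\<^sup>2 \<le> 1 + \<kappa>"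
proof -
  have "((\<lambda>t::real. (cosh t)\<^sup>2) \<longlongrightarrow> (cosh 0)\<^sup>2) (at_right 0)"
    by (intro tendsto_intros)
  then have "\<forall>\<^sub>F t :: real in at_right 0. (cosh t)\<^sup>2 < 1 + \<kappa>"
    using assms by (intro order_tendstoD) auto
  moreover have "\<forall>\<^sub>F t :: real in at_right 0. 0 < t" by (simp add: eventually_at_right_less)
  ultimately have "\<forall>\<^sub>F t :: real in at_right 0. 0 < t \<and> (cosh t)\<^sup>2 \<le> 1 + \<kappa>"
    by eventually_elim auto
  then show ?thesis by (auto dest: eventually_happens)
qed

section \<open>Assembling the short-time and long-time bounds\<close>

context kicked_estimates
begin

text \<open>The exponentially small factor in \<open>nice_lower\<close> does not depend on
  \<open>n\<close>, so comparing growth rates as \<open>n\<close> tends to infinity eliminates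
  it.\<close>

lemma eigenvalue_ge:
  assumes "kicked_eigen F \<nu> w \<rho>" shows "a \<le> \<rho>"
proof (rule ccontr)
  interpret W: kicked_eigen F \<nu> w \<rho> by fact
  have w: "nice w" using W.w W.w_slow by (simp add: nice_def)
  define q where "q = exp (- 2 * (real CARD('d))\<^sup>2 / (2 * \<nu>))"
  assume "\<not> a \<le> \<rho>"
  then have "1 < a / \<rho>" using W.rho by simp
  then obtain n where n: "1 / q < (a / \<rho>) ^ n" using real_arch_pow by blast
  have "a ^ n * w 0 * q \<le> \<rho> ^ n * w 0" using nice_lower[OF w, of n 0] by (simp add: W.Ln_w q_def)
  then have "(a / \<rho>) ^ n * q \<le> 1" using W.w(2)[of 0] W.rho by (simp add: power_divide field_simps)
  then show False using n by (simp add: q_def field_simps)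
qed

text \<open>At radius \<open>R * sqrt \<nu>\<close> nothing depends on \<nu> any more: the Gaussian
  varies by the factor \<open>exp (- R\<^sup>2)\<close> over the ball, and outside it, within the
  wells of radius \<open>r\<close>, \<open>F\<close> is at least a multiple of
  \<open>R\<^sup>2 * \<nu>\<close>. A large \<open>R\<close> makes the far part small against
  \<open>a\<close>, hence against \<open>\<rho>\<close>.\<close>

lemma gap_scale:
  assumes F0: "F 0 = 0" and W: "kicked_eigen F \<nu> w \<rho>" and R: "0 < R" "R * sqrt \<nu> \<le> r"
    and small: "gauss_ratio * exp (- (\<kappa> * R\<^sup>2 / 16)) \<le> a / 2" "gauss_ratio * exp (- (min c1 (1 / 8) / (4 * \<nu>))) \<le> a / 2"
  defines "C1 \<equiv> 1 / (4 * pi * \<nu>) powr (real CARD('d) / 2)"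
  shows "kicked_gap F \<nu> w \<rho> (R * sqrt \<nu>) (min c1 (\<kappa> / 4 * (R\<^sup>2 * \<nu>))) (C1 * exp (- R\<^sup>2)) C1"
proof -
  interpret W: kicked_eigen F \<nu> w \<rho> by fact
  define s where "s = R * sqrt \<nu>"
  have s: "0 < s" "s \<le> r" "s\<^sup>2 = R\<^sup>2 * \<nu>" using R nu_pos by (auto simp: s_def power_mult_distrib)
  have C1: "0 < C1" using nu_pos by (simp add: C1_def)
  \<comment> \<open>Strong convexity at the midpoint of 0 and \<open>z\<close>, where
    \<open>F\<close> is still nonnegative.\<close>
  have quad: "\<kappa> / 4 * (norm z)\<^sup>2 \<le> F z" if z: "z \<in> ball 0 r" for z
  proof -
    have "F ((1 - 1/2) *\<^sub>R 0 + (1/2) *\<^sub>R z) \<le> (1 - 1/2) * F 0 + 1/2 * F z - \<kappa> / 2 * (1/2 * (1 - 1/2)) * (norm (0 - z))\<^sup>2"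
      using z r by (intro F_convex) auto
    moreover have "0 \<le> F ((1 - 1/2) *\<^sub>R 0 + (1/2) *\<^sub>R z)" by (rule F_nonneg)
    ultimately show ?thesis using F0 by simp
  qed
  have far: "min c1 (\<kappa> / 4 * (R\<^sup>2 * \<nu>)) \<le> F z" if z: "\<And>k. k \<in> integer_lattice \<Longrightarrow> z \<notin> ball k s" for z
  proof (cases "\<exists>k\<in>integer_lattice. z \<in> ball k r")
    case True
    then obtain k where k: "k \<in> integer_lattice" "z \<in> ball k r" by blast
    have "s \<le> norm (z - k)" using z[OF k(1)] by (simp add: dist_norm norm_minus_commute)
    then have "s\<^sup>2 \<le> (norm (z - k))\<^sup>2" using s by (intro power_mono) auto
    then have "\<kappa> / 4 * (R\<^sup>2 * \<nu>) \<le> \<kappa> / 4 * (norm (z - k))\<^sup>2" using kappa s(3) by (intro mult_left_mono) auto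
    also have "\<dots> \<le> F (z - k)" using k by (intro quad) (simp add: dist_norm norm_minus_commute)
    also have "F (z - k) = F z"
      using F_per lattice_minus[OF k(1)] unfolding periodic_def by (metis add_uminus_conv_diff)
    finally show ?thesis by simp
  next
    case False
    then show ?thesis using c1(2)[of z] by auto
  qed
  show ?thesis
    unfolding s_def[symmetric]
  proof unfold_locales
    show "0 < s" "s \<le> 1 / 4" using s r by auto
    show "0 < C1 * exp (- R\<^sup>2)" using C1 by simp
    show "C1 * exp (- R\<^sup>2) \<le> C1" using C1 by simp
    show "gauss \<nu> z \<le> C1" for z :: "real ^ 'd" using nu_pos by (simp add: gauss_def C1_def divide_right_mono)
    show "C1 * exp (- R\<^sup>2) \<le> gauss \<nu> (y - x)" if xy: "x \<in> ball 0 s" "y \<in> ball 0 s" for x y :: "real ^ 'd"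
    proof -
      have "norm (y - x) \<le> 2 * s" using norm_triangle_ineq4[of y x] xy by simp
      then have "(norm (y - x))\<^sup>2 \<le> (2 * s)\<^sup>2" by (intro power_mono) auto
      also have "\<dots> = 4 * \<nu> * R\<^sup>2" using s(3) by (simp add: power_mult_distrib)
      finally have "(norm (y - x))\<^sup>2 / (4 * \<nu>) \<le> R\<^sup>2" using nu_pos by (simp add: field_simps)
      then show ?thesis using nu_pos by (simp add: gauss_def C1_def divide_right_mono)
    qed
    show "min c1 (\<kappa> / 4 * (R\<^sup>2 * \<nu>)) \<le> F z" if "\<And>k. k \<in> integer_lattice \<Longrightarrow> z \<notin> ball k s" for z
      using far that by blast
    define c where "c = min c1 (\<kappa> / 4 * (R\<^sup>2 * \<nu>))"
    have eq: "(\<kappa> / 4 * (R\<^sup>2 * \<nu>)) / (4 * \<nu>) = \<kappa> * R\<^sup>2 / 16" using nu_pos by simp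
    have "min (min p z) e = z \<or> min (min p z) e = min p e" for p z e :: real by (auto simp: min_def)
    then have "min c (1 / 8) / (4 * \<nu>) = \<kappa> * R\<^sup>2 / 16 \<or> min c (1 / 8) / (4 * \<nu>) = min c1 (1 / 8) / (4 * \<nu>)"
      unfolding c_def using eq by metis
    then have "exp (- min c (1 / 8) / (4 * \<nu>)) = exp (- (\<kappa> * R\<^sup>2 / 16)) \<or>
        exp (- min c (1 / 8) / (4 * \<nu>)) = exp (- (min c1 (1 / 8) / (4 * \<nu>)))"
      by (simp only: minus_divide_left[symmetric]) auto
    then have "gauss_ratio * exp (- min c (1 / 8) / (4 * \<nu>)) \<le> a / 2" using small by (elim disjE) (simp_all only:)
    also have "\<dots> \<le> \<rho> / 2" using eigenvalue_ge[OF W] by simp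
    finally show "gauss_ratio * exp (- min (min c1 (\<kappa> / 4 * (R\<^sup>2 * \<nu>))) (1 / 8) / (4 * \<nu>)) \<le> \<rho> / 2" by (simp add: c_def)
  qed
qed

text \<open>Up to time \<open>2 * n1\<close> the cross ratio bound alone suffices, since its floor
  of order \<nu> is still below the decay rate \<open>mu\<close>; from then on
  \<open>late_ratio\<close> takes over, and the factor \<nu> in front of \<open>th ^ k\<close>
  supplies the decay for the first \<open>2 * n1\<close> kicks.\<close>

lemma log_ratio_decay:
  assumes F0: "F 0 = 0" and W: "kicked_eigen F \<nu> w \<rho>"
    and \<tau>: "0 < \<tau>" "(cosh \<tau>)\<^sup>2 \<le> 1 + \<kappa>"
    and c: "0 < c" "\<And>J. c \<le> (\<Prod>i<2 * J + 1. \<bar>tanh ((real i - real J - 1/2) * \<tau>)\<bar>)"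
    and m: "3 * (real CARD('d))\<^sup>2 + FM / 2 + 1 \<le> real m * min c1 (1 / 8) / 4" "0 < m"
    and R: "0 < R" "R * sqrt \<nu> \<le> r" "gauss_ratio * exp (- (\<kappa> * R\<^sup>2 / 16)) \<le> a / 2"
    and nu: "gauss_ratio * exp (- (min c1 (1 / 8) / (4 * \<nu>))) \<le> a / 2" "\<nu> < 1"
      "(ln (2 * 2 ^ m) + 8 * ln (gauss_ratio / a)) + 4 * ln (gauss_ratio / a) / (\<tau> / real m) * ln (1 / \<nu>) \<le> 1 / \<nu>"
    and u: "bmp u" "\<And>x. 0 < u x" and n: "0 < n"
  defines "lam \<equiv> \<tau> / real m" and "Kc \<equiv> 2 * real m / c ^ CARD('d)"
    and "Bc \<equiv> 8 * real CARD('d) * r * exp (2 * \<tau>) + 2 * (real CARD('d))\<^sup>2 * exp \<tau>"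
    and "th \<equiv> 1 - exp (- R\<^sup>2) / 2"
  shows "2 * \<nu> * (ln ((L ^^ n) u x / w x) - ln ((L ^^ n) u y / w y)) \<le>
    (8 * (Kc * exp (Bc / 2)) ^ 3 * exp (2 * lam) + 2 * ln Kc * exp (2 * lam) + Bc * exp lam)
      * exp (- min (lam / 2) (- ln th) * real n)"
proof -
  define C1 where "C1 = 1 / (4 * pi * \<nu>) powr (real CARD('d) / 2)"
  interpret G: kicked_gap F \<nu> w \<rho> "R * sqrt \<nu>" "min c1 (\<kappa> / 4 * (R\<^sup>2 * \<nu>))" "C1 * exp (- R\<^sup>2)" C1
    unfolding C1_def by (rule gap_scale[OF F0 W R(1,2,3) nu(1)])
  have "C1 > 0" using nu_pos by (simp add: C1_def)
  then have th: "G.\<theta> = th" by (simp add: G.\<theta>_def th_def)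
  have th01: "1 / 2 \<le> th" "th < 1" using G.theta by (auto simp: th)
  have w: "nice w" using G.w G.w_slow by (simp add: nice_def)
  define mu where "mu = min (lam / 2) (- ln th)"
  have lam: "0 < lam" using \<tau> m by (simp add: lam_def)
  have mu: "0 < mu" "mu \<le> lam / 2" "mu \<le> - ln th" using lam th01 by (auto simp: mu_def)
  have "c \<le> 1" using c(2)[of 0] tanh_real_lt_1[of "\<tau> / 2"] tanh_real_gt_neg1[of "\<tau> / 2"] by simp
  then have cd: "c ^ CARD('d) \<le> 1" "0 < c ^ CARD('d)" using c(1) by (auto simp: power_le_one)
  have Kc1: "1 \<le> Kc" using m(2) cd by (simp add: Kc_def field_simps)
  have Bc0: "0 \<le> Bc" using r by (simp add: Bc_def)
  define K where "K = Kc * exp (Bc / 2)"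
  have K1: "1 \<le> K" using mult_mono[of 1 Kc 1 "exp (Bc / 2)"] Kc1 Bc0 by (simp add: K_def)
  \<comment> \<open>The time at which \<open>exp (- lam * n0) \<le> \<nu>\<close>, so that the
    exponent in the cross ratio drops to \<open>Bc / 2\<close>.\<close>
  define n0 where "n0 = nat \<lceil>ln (1 / \<nu>) / lam\<rceil>"
  have lnu: "0 < ln (1 / \<nu>)" using nu(2) nu_pos by simp
  have n0: "ln (1 / \<nu>) / lam \<le> real n0" "real n0 \<le> ln (1 / \<nu>) / lam + 1"
    using lnu lam ceiling_correct[of "ln (1 / \<nu>) / lam"] by (auto simp: n0_def)
  have e_n0: "exp (- lam * real n0) \<le> \<nu>"
  proof -
    have "ln (1 / \<nu>) \<le> lam * real n0" using n0(1) lam by (simp add: field_simps)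
    then have "exp (- lam * real n0) \<le> exp (- ln (1 / \<nu>))" by simp
    then show ?thesis using nu_pos by (simp add: exp_minus)
  qed
  \<comment> \<open>One kick in addition, to make arbitrary positive data \<open>nice\<close>; the
    same shift explains \<open>Suc k\<close> in \<open>cross\<close>.\<close>
  define n1 where "n1 = Suc n0"
  have nu_n1: "\<nu> \<le> exp (2 * lam) * exp (- mu * (2 * real n1))"
  proof -
    have "lam * real n1 \<le> ln (1 / \<nu>) + 2 * lam" using n0(2) lam by (simp add: n1_def field_simps)
    moreover have "mu * (2 * real n1) \<le> lam / 2 * (2 * real n1)" using mu by (intro mult_right_mono) auto
    ultimately have "ln \<nu> \<le> 2 * lam - mu * (2 * real n1)" using nu_pos by (simp add: ln_div)
    then have "exp (ln \<nu>) \<le> exp (2 * lam - mu * (2 * real n1))" by simp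
    then show ?thesis using nu_pos by (simp add: mult_exp_exp)
  qed
  have ba: "1 \<le> gauss_ratio / a" using a gauss_ratio_ge1 by (simp add: field_simps)
  have cross: "(L ^^ Suc k) f y * w x \<le> Kc * exp (Bc * exp (- lam * real k) / (2 * \<nu>)) * (w y * (L ^^ Suc k) f x)"
    if f: "bmp f" "\<And>x. 0 < f x" and k: "k \<le> 2 * n1" for f k x y
  proof -
    \<comment> \<open>The origin of the numbers 4 and 8 in the smallness assumption:
      \<open>k\<close> may go up to \<open>2 * n1\<close>, and \<open>n1\<close> exceeds
      \<open>ln (1 / \<nu>) / lam\<close> by at most 2.\<close>
    have "2 * real k \<le> 4 * (ln (1 / \<nu>) / lam) + 8" using k n0(2) by (simp add: n1_def)
    then have "2 * real k * ln (gauss_ratio / a) \<le> (4 * (ln (1 / \<nu>) / lam) + 8) * ln (gauss_ratio / a)"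
      using ba by (intro mult_right_mono) auto
    then have "ln (2 * 2 ^ m) + 2 * real k * ln (gauss_ratio / a) \<le> 1 / \<nu>"
      using nu(3) by (simp add: lam_def[symmetric] algebra_simps)
    then have "exp (ln (2 * 2 ^ m) + 2 * real k * ln (gauss_ratio / a)) \<le> exp (1 / \<nu>)" by simp
    also have "exp (ln (2 * 2 ^ m) + 2 * real k * ln (gauss_ratio / a)) = 2 * 2 ^ m * (gauss_ratio / a) ^ (2 * k)"
    proof -
      have "exp (2 * real k * ln (gauss_ratio / a)) = (gauss_ratio / a) ^ (2 * k)"
        using ba by (simp add: exp_of_nat_mult[of "2 * k", simplified])
      then show ?thesis by (simp add: exp_add)
    qed
    finally have "2 * 2 ^ m * (gauss_ratio / a) ^ (2 * k) \<le> exp (1 / \<nu>)" .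
    from cross_ratio[OF \<tau> c m(1) this nice_L[OF f] w, of y x]
    have "(L ^^ Suc k) f y * (\<rho> ^ k * w x) \<le>
      Kc * exp (Bc * exp (- lam * real k) / (2 * \<nu>)) * ((\<rho> ^ k * w y) * (L ^^ Suc k) f x)"
      unfolding Kc_def Bc_def lam_def G.Ln_w funpow_Suc_right o_def .
    then have "\<rho> ^ k * ((L ^^ Suc k) f y * w x) \<le>
      \<rho> ^ k * (Kc * exp (Bc * exp (- lam * real k) / (2 * \<nu>)) * (w y * (L ^^ Suc k) f x))"
      by (simp only: mult_ac)
    then show ?thesis using G.rho by simp
  qed
  have pos: "0 < (L ^^ k) u z" for k z by (rule Ln_pos[OF u])
  have three: "0 \<le> 8 * K ^ 3 * exp (2 * lam)" "0 \<le> 2 * ln Kc * exp (2 * lam)" "0 \<le> Bc * exp lam"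
    using K1 Kc1 Bc0 by auto
  show ?thesis
  proof (cases "2 * n1 \<le> n")
    case True
    define k where "k = n - 2 * n1"
    have nk: "n = n1 + (k + n1)" using True by (simp add: k_def)
    have cr: "(L ^^ n1) f y * w x \<le> K * (w y * (L ^^ n1) f x)" if f: "bmp f" "\<And>x. 0 < f x" for f x y
    proof -
      have "Bc * exp (- lam * real n0) / (2 * \<nu>) \<le> Bc * \<nu> / (2 * \<nu>)"
        using e_n0 Bc0 nu_pos by (intro divide_right_mono mult_left_mono) auto
      then have "Kc * exp (Bc * exp (- lam * real n0) / (2 * \<nu>)) \<le> K"
        unfolding K_def using nu_pos Kc1 by (intro mult_left_mono) auto
      then have "Kc * exp (Bc * exp (- lam * real n0) / (2 * \<nu>)) * (w y * (L ^^ Suc n0) f x) \<le> K * (w y * (L ^^ Suc n0) f x)"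
        using G.w(2)[of y] Ln_pos[OF f, of "Suc n0" x] by (intro mult_right_mono) (auto intro: less_imp_le)
      moreover have "n0 \<le> 2 * n1" by (simp add: n1_def)
      ultimately show ?thesis using cross[OF f, of n0 y x] unfolding n1_def by linarith
    qed
    have "ln ((L ^^ n) u x / w x) - ln ((L ^^ n) u y / w y) \<le> 4 * K ^ 3 * th ^ k"
      using G.late_ratio[OF K1 cr u, of k x y] unfolding nk th .
    then have "2 * \<nu> * (ln ((L ^^ n) u x / w x) - ln ((L ^^ n) u y / w y)) \<le> 2 * \<nu> * (4 * K ^ 3 * th ^ k)"
      using nu_pos by (intro mult_left_mono) auto
    also have "\<dots> = 8 * K ^ 3 * (\<nu> * th ^ k)" by simp
    also have "\<dots> \<le> 8 * K ^ 3 * (exp (2 * lam) * exp (- mu * real n))"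
    proof -
      have "th ^ k = exp (real k * ln th)" using th01 by (simp add: exp_of_nat_mult)
      also have "\<dots> \<le> exp (- mu * real k)"
        using mult_left_mono[OF mu(3), of "real k"] by (simp add: mult.commute)
      finally have "\<nu> * th ^ k \<le> (exp (2 * lam) * exp (- mu * (2 * real n1))) * exp (- mu * real k)"
        using nu_n1 nu_pos th01 by (intro mult_mono) auto
      also have "\<dots> = exp (2 * lam) * exp (- mu * real n)" by (simp add: mult_exp_exp nk algebra_simps)
      finally show ?thesis using K1 by (intro mult_left_mono) auto
    qed
    also have "\<dots> = 8 * K ^ 3 * exp (2 * lam) * exp (- mu * real n)" by simp
    also have "\<dots> \<le> (8 * K ^ 3 * exp (2 * lam) + 2 * ln Kc * exp (2 * lam) + Bc * exp lam) * exp (- mu * real n)"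
      using three by (intro mult_right_mono) auto
    finally show ?thesis by (simp add: K_def mu_def)
  next
    case False
    define k where "k = n - 1"
    have nk: "n = Suc k" "k \<le> 2 * n1" using n False by (auto simp: k_def)
    define Y where "Y = Kc * exp (Bc * exp (- lam * real k) / (2 * \<nu>))"
    have Y: "0 < Y" using Kc1 by (simp add: Y_def)
    have "(L ^^ n) u x * w y \<le> Y * (w x * (L ^^ n) u y)"
      using cross[OF u nk(2), of x y] unfolding nk(1) Y_def .
    then have "(L ^^ n) u x / w x \<le> Y * ((L ^^ n) u y / w y)"
      using G.w(2)[of x] G.w(2)[of y] by (simp add: field_simps)
    then have "ln ((L ^^ n) u x / w x) \<le> ln (Y * ((L ^^ n) u y / w y))"
      using pos[of n x] pos[of n y] G.w(2)[of x] G.w(2)[of y] Y by (subst ln_le_cancel_iff) auto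
    also have "\<dots> = ln Y + ln ((L ^^ n) u y / w y)"
      using pos[of n y] G.w(2)[of y] Y by (intro ln_mult_pos) auto
    also have "ln Y = ln Kc + Bc * exp (- lam * real k) / (2 * \<nu>)" using Kc1 by (simp add: Y_def ln_mult_pos)
    finally have "2 * \<nu> * (ln ((L ^^ n) u x / w x) - ln ((L ^^ n) u y / w y)) \<le>
        2 * \<nu> * (ln Kc + Bc * exp (- lam * real k) / (2 * \<nu>))"
      using nu_pos by (intro mult_left_mono) auto
    also have "\<dots> = 2 * ln Kc * \<nu> + Bc * exp (- lam * real k)" using nu_pos by (simp add: field_simps)
    also have "\<dots> \<le> 2 * ln Kc * (exp (2 * lam) * exp (- mu * real n)) + Bc * (exp lam * exp (- mu * real n))"
    proof (intro add_mono mult_left_mono)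
      have "mu * real n \<le> mu * (2 * real n1)" using False mu(1) by (intro mult_left_mono) auto
      then have "exp (- mu * (2 * real n1)) \<le> exp (- mu * real n)" by simp
      then show "\<nu> \<le> exp (2 * lam) * exp (- mu * real n)"
        using nu_n1 by (elim order_trans) (intro mult_left_mono, auto)
      have "mu * real n \<le> lam * real n" using mu lam by (intro mult_right_mono) auto
      then show "exp (- lam * real k) \<le> exp lam * exp (- mu * real n)"
        by (simp add: mult_exp_exp nk algebra_simps)
    qed (use Kc1 Bc0 in auto)
    also have "\<dots> = (2 * ln Kc * exp (2 * lam) + Bc * exp lam) * exp (- mu * real n)" by (simp add: algebra_simps)
    also have "\<dots> \<le> (8 * K ^ 3 * exp (2 * lam) + 2 * ln Kc * exp (2 * lam) + Bc * exp lam) * exp (- mu * real n)"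
      using three by (intro mult_right_mono) auto
    finally show ?thesis by (simp add: K_def mu_def)
  qed
qed

end

section \<open>Choice of the constants and convergence\<close>

theorem theorem1:
  "\<exists>B :: real \<Rightarrow> real \<Rightarrow> real.
     (\<forall>r\<ge>0. \<forall>c>0. 0 < B r c) \<and>
     (\<forall>F :: real ^ 'd \<Rightarrow> real.
        F \<in> C_per 3 \<and> F 0 = 0 \<and>
        {x. is_arg_min F (\<lambda>_. True) x} = integer_lattice \<and>
        positive_definite (hessian F 0) \<longrightarrow>
        (\<exists>\<mu>>0. \<exists>\<nu>0>0. \<exists>C>0. \<forall>\<nu>. 0 < \<nu> \<and> \<nu> < \<nu>0 \<longrightarrow>
           (\<exists>\<psi>. stationary_solution \<nu> F \<psi>) \<and>
           (\<forall>\<psi>. stationary_solution \<nu> F \<psi> \<longrightarrow>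
             (\<forall>\<phi>0 \<in> C_per 0. \<forall>n::nat.
                star_norm (\<lambda>x. kicked_solution \<nu> F \<phi>0 n x - \<psi> x)
                  \<le> B (star_norm \<phi>0) C * exp (- \<mu> * real n)))))"
\<comment> \<open>The size of the initial condition matters only at \<open>n = 0\<close>; after one
  kick the bound no longer depends on it, so a sum is enough.\<close>
proof (intro exI[of _ "\<lambda>r c. r + c"] conjI allI impI)
  fix r c :: real assume "0 \<le> r" "0 < c" then show "0 < r + c" by simp
next
  fix F :: "real ^ 'd \<Rightarrow> real"
  assume "F \<in> C_per 3 \<and> F 0 = 0 \<and> {x. is_arg_min F (\<lambda>_. True) x} = integer_lattice \<and>
    positive_definite (hessian F 0)"
  then have asm: "F \<in> C_per 3" "F 0 = 0" "{x. is_arg_min F (\<lambda>_. True) x} = integer_lattice"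
    "positive_definite (hessian F 0)" by auto
  show "\<exists>\<mu>>0. \<exists>\<nu>0>0. \<exists>C>0. \<forall>\<nu>. 0 < \<nu> \<and> \<nu> < \<nu>0 \<longrightarrow>
           (\<exists>\<psi>. stationary_solution \<nu> F \<psi>) \<and>
           (\<forall>\<psi>. stationary_solution \<nu> F \<psi> \<longrightarrow>
             (\<forall>\<phi>0 \<in> C_per 0. \<forall>n::nat.
                star_norm (\<lambda>x. kicked_solution \<nu> F \<phi>0 n x - \<psi> x)
                  \<le> (star_norm \<phi>0 + C) * exp (- \<mu> * real n)))"
  proof (rule kick_potential[OF asm])
  fix r \<kappa> c1 FM CF
  assume Fc: "continuous_on UNIV F" and Fp: "periodic F" and Fn: "\<And>x. 0 \<le> F x"
    and r: "0 < r" "r \<le> 1 / 4" and \<kappa>: "0 < \<kappa>" and c1: "0 < c1" and CF: "0 \<le> CF"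
    and convex: "\<And>x y t. x \<in> ball 0 r \<Longrightarrow> y \<in> ball 0 r \<Longrightarrow> 0 \<le> t \<Longrightarrow> t \<le> 1 \<Longrightarrow>
      F ((1 - t) *\<^sub>R x + t *\<^sub>R y) \<le> (1 - t) * F x + t * F y - \<kappa> / 2 * (t * (1 - t)) * (norm (x - y))\<^sup>2"
    and far: "\<And>z. (\<And>k. k \<in> integer_lattice \<Longrightarrow> z \<notin> ball k r) \<Longrightarrow> c1 \<le> F z"
    and FM: "\<And>x. F x \<le> FM" and quad: "\<And>y. y \<in> ball 0 r \<Longrightarrow> F y \<le> CF * (norm y)\<^sup>2"
  let ?d = "real CARD('d)"
  define b where "b = 2 powr (?d / 2)"
  have b1: "1 \<le> b" unfolding b_def by (rule ge_one_powr_ge_zero) auto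
  define a' where "a' = unit_ball_vol ?d * exp (- 1 - CF / 2) / (4 * pi) powr (?d / 2)"
  have a': "0 < a'" by (simp add: a'_def)
  define a where "a = min 1 a'"
  have a: "0 < a" "a \<le> 1" "a \<le> a'" using a' by (auto simp: a_def)
  obtain \<tau> where \<tau>: "0 < \<tau>" "(cosh \<tau>)\<^sup>2 \<le> 1 + \<kappa>" using cosh_small[OF \<kappa>] by blast
  obtain c where c: "0 < c" "\<And>J. c \<le> (\<Prod>i<2 * J + 1. \<bar>tanh ((real i - real J - 1/2) * \<tau>)\<bar>)"
    using prod_tanh_bound[OF \<tau>(1)] by blast
  have FM0: "0 \<le> FM" using Fn[of 0] FM[of 0] by linarith
  have c1m: "0 < min c1 (1 / 8)" using c1 by simp
  obtain m :: nat where m0: "(3 * ?d\<^sup>2 + FM / 2 + 1) * 4 / min c1 (1 / 8) \<le> real m"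
    using real_arch_simple by blast
  have m: "3 * ?d\<^sup>2 + FM / 2 + 1 \<le> real m * min c1 (1 / 8) / 4" using m0 c1m by (simp add: pos_divide_le_eq)
  have mpos: "0 < m"
  proof (rule ccontr)
    assume "\<not> 0 < m"
    then have "3 * ?d\<^sup>2 + FM / 2 + 1 \<le> 0" using m by simp
    then show False using FM0 zero_le_power2[of ?d] by linarith
  qed
  \<comment> \<open>Chosen so that \<open>b * exp (- X) = a / 2\<close>, the bound on the far part;
    \<open>R\<close> then makes \<open>\<kappa> * R\<^sup>2 / 16\<close> equal to
    \<open>X\<close>.\<close>
  define X where "X = ln (2 * b / a)"
  have ba: "1 \<le> b / a" using a b1 by (simp add: field_simps)
  have X: "0 < X" using ba a by (simp add: X_def)
  have bX: "b * exp (- X) = a / 2" using a b1 by (simp add: X_def exp_minus)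
  define R where "R = sqrt (16 * X / \<kappa>)"
  have R: "0 < R" "\<kappa> * R\<^sup>2 / 16 = X" using X \<kappa> by (auto simp: R_def)
  define lam where "lam = \<tau> / real m"
  define Kc where "Kc = 2 * real m / c ^ CARD('d)"
  define Bc where "Bc = 8 * ?d * r * exp (2 * \<tau>) + 2 * ?d\<^sup>2 * exp \<tau>"
  define th where "th = 1 - exp (- R\<^sup>2) / 2"
  define \<mu> where "\<mu> = min (lam / 2) (- ln th)"
  define Cs where "Cs = 8 * (Kc * exp (Bc / 2)) ^ 3 * exp (2 * lam) + 2 * ln Kc * exp (2 * lam) + Bc * exp lam"
  define A1 B1 where "A1 = ln (2 * 2 ^ m) + 8 * ln (b / a)" "B1 = 4 * ln (b / a) / lam"
  \<comment> \<open>In this order: \<open>ln (1 / \<nu>)\<close> is positive; the ball of radius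
    \<open>sqrt \<nu>\<close> lies in the well; so does the ball of radius
    \<open>R * sqrt \<nu>\<close>; excursions from the wells are small against \<open>a\<close>;
    losses up to the matching time stay below \<open>exp (1 / \<nu>)\<close>.\<close>
  define \<nu>0 where "\<nu>0 = Min {1, r\<^sup>2, (r / R)\<^sup>2, min c1 (1 / 8) / (4 * X), 1 / (2 * B1 + A1 + 1)\<^sup>2}"
  have lam: "0 < lam" using \<tau> mpos by (simp add: lam_def)
  have "c \<le> 1" using c(2)[of 0] tanh_real_lt_1[of "\<tau> / 2"] tanh_real_gt_neg1[of "\<tau> / 2"] by simp
  then have cd: "c ^ CARD('d) \<le> 1" "0 < c ^ CARD('d)" using c(1) by (auto simp: power_le_one)
  have Kc1: "1 \<le> Kc" using mpos cd by (simp add: Kc_def field_simps)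
  have Bc0: "0 \<le> Bc" using r by (simp add: Bc_def)
  have th01: "0 < th" "th < 1"
  proof -
    have "exp (- R\<^sup>2) \<le> 1" by simp
    then show "0 < th" "th < 1" unfolding th_def using exp_gt_zero[of "- R\<^sup>2"] by linarith+
  qed
  have \<mu>: "0 < \<mu>" using lam th01 by (simp add: \<mu>_def)
  have Cs: "0 < Cs"
    using Kc1 Bc0 by (auto simp: Cs_def intro!: add_pos_nonneg)
  have AB: "0 \<le> A1" "0 \<le> B1"
  proof -
    have "1 \<le> (2 :: real) ^ m" by (rule one_le_power) simp
    then have "0 \<le> ln (2 * 2 ^ m :: real)" by (intro ln_ge_zero) linarith
    then show "0 \<le> A1" "0 \<le> B1" using ba lam by (auto simp: A1_B1_def intro!: add_nonneg_nonneg)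
  qed
  have \<nu>0: "0 < \<nu>0" using r R c1m X AB by (auto simp: \<nu>0_def)
  show ?thesis
  proof (rule exI[of _ \<mu>], rule conjI[OF \<mu>], rule exI[of _ \<nu>0], rule conjI[OF \<nu>0],
      rule exI[of _ "Cs + ?d\<^sup>2"], intro conjI allI impI ballI)
    show "0 < Cs + ?d\<^sup>2" using Cs by (simp add: add_pos_nonneg)
    fix \<nu> assume "0 < \<nu> \<and> \<nu> < \<nu>0"
    then have \<nu>: "0 < \<nu>" "\<nu> < 1" "\<nu> < r\<^sup>2" "\<nu> < (r / R)\<^sup>2" "\<nu> < min c1 (1 / 8) / (4 * X)"
      "\<nu> < 1 / (2 * B1 + A1 + 1)\<^sup>2" by (auto simp: \<nu>0_def)
    interpret kicked F \<nu> using Fc Fp Fn \<nu>(1) by unfold_locales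
    show "\<exists>\<psi>. stationary_solution \<nu> F \<psi>" by (rule stationary_exists)
    have sq: "sqrt \<nu> < r" using \<nu>(3) r by (simp add: real_less_lsqrt)
    have low: "e * a \<le> L f x" if "bmp f" "\<And>x. 0 \<le> f x" "0 \<le> e" "\<And>x. norm x \<le> sqrt \<nu> \<Longrightarrow> e \<le> f x" "norm x \<le> sqrt \<nu>" for f e x
    proof -
      have "e * a \<le> e * a'" using a that(3) by (intro mult_left_mono)
      also have "\<dots> \<le> L f x"
        unfolding a'_def using that CF sq by (intro L_lower quad) auto
      finally show ?thesis .
    qed
    interpret kicked_estimates F \<nu> r \<kappa> a c1 FM
      by unfold_locales (use r \<kappa> convex a c1 far FM low in auto)
    have gauss_ratio: "gauss_ratio = b" by (simp add: gauss_ratio_def b_def)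
    have Rr: "R * sqrt \<nu> \<le> r"
    proof -
      have "sqrt \<nu> \<le> r / R" using \<nu>(4) R r by (intro real_le_lsqrt) auto
      then show ?thesis using R by (simp add: field_simps)
    qed
    have s1: "gauss_ratio * exp (- (\<kappa> * R\<^sup>2 / 16)) \<le> a / 2" by (simp only: R(2) gauss_ratio bX)
    have s2: "gauss_ratio * exp (- (min c1 (1 / 8) / (4 * \<nu>))) \<le> a / 2"
    proof -
      have "X \<le> min c1 (1 / 8) / (4 * \<nu>)" using \<nu>(1,5) X by (simp add: field_simps)
      then have "b * exp (- (min c1 (1 / 8) / (4 * \<nu>))) \<le> b * exp (- X)" using b1 by (intro mult_left_mono) auto
      then show ?thesis by (simp only: gauss_ratio bX)
    qed
    have s3: "(ln (2 * 2 ^ m) + 8 * ln (gauss_ratio / a)) + 4 * ln (gauss_ratio / a) / (\<tau> / real m) * ln (1 / \<nu>) \<le> 1 / \<nu>"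
      using log_le_reciprocal[OF AB \<nu>(1) less_imp_le[OF \<nu>(6)]] by (simp only: A1_B1_def gauss_ratio lam_def)
    fix \<psi> \<phi>0 :: "real ^ 'd \<Rightarrow> real" and n :: nat
    assume \<psi>: "stationary_solution \<nu> F \<psi>" and \<phi>0: "\<phi>0 \<in> C_per 0"
    define w where "w = (\<lambda>y. exp (- \<psi> y / (2 * \<nu>)))"
    define u where "u = (\<lambda>y. exp (- \<phi>0 y / (2 * \<nu>)))"
    obtain \<rho> where W: "kicked_eigen F \<nu> w \<rho>" using stationary_eigen[OF \<psi>] unfolding w_def by blast
    interpret W: kicked_eigen F \<nu> w \<rho> by (rule W)
    have u: "bmp u" "\<And>x. 0 < u x" using bmp_exp[OF \<phi>0] by (auto simp: u_def)
    obtain M where M: "\<And>x. \<bar>\<phi>0 x\<bar> \<le> M" using \<phi>0 periodic_bounded by (auto simp: C_per_def)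
    have sn: "0 \<le> star_norm \<phi>0" by (rule star_norm_nonneg[OF M])
    show "star_norm (\<lambda>x. kicked_solution \<nu> F \<phi>0 n x - \<psi> x) \<le> (star_norm \<phi>0 + (Cs + ?d\<^sup>2)) * exp (- \<mu> * real n)"
    proof (cases "n = 0")
      case True
      \<comment> \<open>Without any kick only the regularity of \<open>\<psi>\<close> is available;
        this is why \<open>?d\<^sup>2\<close> is added to \<open>Cs\<close>.\<close>
      have \<psi>_osc: "\<psi> x - \<psi> y \<le> ?d\<^sup>2" for x y
      proof -
        have "w y \<le> w x * exp (?d\<^sup>2 / (2 * \<nu>))" by (rule slow_osc[OF W.w_slow W.w])
        then have "- \<psi> y / (2 * \<nu>) \<le> - \<psi> x / (2 * \<nu>) + ?d\<^sup>2 / (2 * \<nu>)"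
          by (simp add: w_def mult_exp_exp)
        then show ?thesis using \<nu>(1) by (simp add: field_simps)
      qed
      have "star_norm (\<lambda>x. \<phi>0 x - \<psi> x) \<le> star_norm \<phi>0 + ?d\<^sup>2"
      proof (rule star_norm_diff_le[OF M])
        show "\<bar>\<psi> x + (- \<psi> 0)\<bar> \<le> ?d\<^sup>2" for x using \<psi>_osc[of x 0] \<psi>_osc[of 0 x] by (simp add: abs_le_iff)
      qed
      moreover have "kicked_solution \<nu> F \<phi>0 0 = \<phi>0"
        using \<nu>(1) by (simp add: kicked_solution_def fun_eq_iff)
      ultimately show ?thesis using True Cs by simp
    next
      case False
      then have n: "0 < n" by simp
      define h where "h x = kicked_solution \<nu> F \<phi>0 n x - \<psi> x" for x
      have h: "h x = - (2 * \<nu> * ln ((L ^^ n) u x / w x))" for x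
      proof -
        have e: "kick_heat_op \<nu> F = L" using kick_heat_op_eq by (rule ext)
        have "ln ((L ^^ n) u x / w x) = ln ((L ^^ n) u x) - ln (w x)"
          using Ln_pos[OF u, of n x] W.w(2)[of x] by (simp add: ln_div)
        moreover have "ln (w x) = - \<psi> x / (2 * \<nu>)" by (simp add: w_def)
        moreover have "h x = - 2 * \<nu> * ln ((L ^^ n) u x) - \<psi> x"
          unfolding h_def kicked_solution_def e u_def ..
        ultimately show ?thesis using \<nu>(1) by (simp add: field_simps)
      qed
      have osc: "h x - h y \<le> Cs * exp (- \<mu> * real n)" for x y
        using log_ratio_decay[OF asm(2) W \<tau> c m mpos R(1) Rr s1 s2 \<nu>(2) s3 u n, of y x]
        unfolding h Cs_def \<mu>_def lam_def Kc_def Bc_def th_def by (simp add: algebra_simps)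
      have "star_norm h \<le> Cs * exp (- \<mu> * real n)"
      proof (rule star_norm_le)
        show "\<bar>h x + (- h 0)\<bar> \<le> Cs * exp (- \<mu> * real n)" for x
          using osc[of x 0] osc[of 0 x] by (simp add: abs_le_iff)
      qed
      also have "\<dots> \<le> (star_norm \<phi>0 + (Cs + ?d\<^sup>2)) * exp (- \<mu> * real n)"
        using sn by (intro mult_right_mono) auto
      finally show ?thesis unfolding h_def .
    qed
  qed
qed
qed

end
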